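(* Let $N\ge 2$ be an integer and let $f:[0,+\infty)\to\mathbb{R}$ be locally Lipschitz-continuous and such that: (i) there is $\mu>0$ with $f>0$ on $(0,\mu)$ and $f\le 0$ on $[\mu,+\infty)$; (ii) there is $\mu'\in(0,\mu)$ such that $f$ is nonincreasing on $[\mu',\mu]$; (iii) either $f(0)>0$, or [$f(0)=0$ and $\liminf_{s\to 0^+} f(s)/s>0$]; (iv) $\displaystyle\liminf_{s\to z^-}\frac{f(s)}{s-z}>0$ for all $z>\mu$ such that $f(z)=0$. Let $\Omega'=(0,+\infty)\times\mathbb{R}^{N-1}$, let $u_0:\mathbb{R}^{N-1}\to[0,+\infty)$ be any continuous and bounded function with $u_0\not\equiv 0$ in $\mathbb{R}^{N-1}$, and let $u$ be any nonnegative and bounded solution of $$\begin{cases}\Delta u+f(u)=0 & \text{in }\Omega',\\ u(0,x_2,\ldots,x_N)=u_0(x_2,\ldots,x_N) & \text{for all }(x_2,\ldots,x_N)\in\mathbb{R}^{N-1}.\end{cases}$$ Then there exists $z\ge\mu$ such that $f(z)=0$ and $$u(x_1+h,x_2,\ldots,x_N)\to z\quad\text{as }h\to+\infty\text{ in }C^{2,\beta}_b\big([A,+\infty)\times\mathbb{R}^{N-1}\big)$$ for all $A\in\mathbb{R}$ and $\beta\in[0,1)$.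
   Context: A bounded solution $u$ is understood to be bounded, of class $C^2(\Omega')$ and continuous on $\overline{\Omega'}$. For a closed set $F\subset\mathbb{R}^N$ and $\beta\in[0,1)$, $C^{2,\beta}_b(F)$ is the space of functions $w:F\to\mathbb{R}$ with $\|w\|_{C^{2,\beta}_b(F)}=\sup_{x\in F}\|w\|_{C^{2,\beta}(\overline{B(x,1)}\cap F)}<\infty$, where $B(x,1)$ is the open Euclidean ball of radius $1$ centered at $x$. The convergence as $h\to+\infty$ is considered for $h$ large enough (e.g. $h>-A$) so that the translated function is defined on the given set. *)

theory Defs
  imports "HOL-Analysis.Analysis"
begin

definition partial_deriv :: "'a::euclidean_space \<Rightarrow> ('a \<Rightarrow> real) \<Rightarrow> 'a \<Rightarrow> real" where
  "partial_deriv i w x = frechet_derivative w (at x) i"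

(* Meant for open S: derivatives are taken at x, not within S. *)
definition C2_on :: "'a::euclidean_space set \<Rightarrow> ('a \<Rightarrow> real) \<Rightarrow> bool" where
  "C2_on S w \<longleftrightarrow>
     w differentiable_on S \<and>
     (\<forall>i\<in>Basis. partial_deriv i w differentiable_on S \<and>
       (\<forall>j\<in>Basis. continuous_on S (partial_deriv j (partial_deriv i w))))"

definition laplacian :: "('a::euclidean_space \<Rightarrow> real) \<Rightarrow> 'a \<Rightarrow> real" where
  "laplacian w x = (\<Sum>i\<in>Basis. partial_deriv i (partial_deriv i w) x)"

definition bounded_solution ::
  "(real \<Rightarrow> real) \<Rightarrow> 'a::euclidean_space set \<Rightarrow> ('a \<Rightarrow> real) \<Rightarrow> bool" where
  "bounded_solution f \<Omega> u \<longleftrightarrow>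
     C2_on \<Omega> u \<and> continuous_on (closure \<Omega>) u \<and> bounded (u ` closure \<Omega>) \<and>
     (\<forall>x\<in>\<Omega>. laplacian u x + f (u x) = 0)"

definition extends_continuously :: "'a::euclidean_space set \<Rightarrow> ('a \<Rightarrow> real) \<Rightarrow> bool" where
  "extends_continuously K g \<longleftrightarrow>
     (\<exists>G. continuous_on K G \<and> (\<forall>x\<in>interior K. G x = g x))"

(* The closed sets K below are closures of their interiors.  As usual, a function is C^2 on
   such a K if it is C^2 in the interior and its derivatives extend continuously to K; suprema
   and Hoelder seminorms of derivatives over K are then the same as over the interior. *)
definition C2_closed :: "'a::euclidean_space set \<Rightarrow> ('a \<Rightarrow> real) \<Rightarrow> bool" where
  "C2_closed K w \<longleftrightarrow>
     continuous_on K w \<and> C2_on (interior K) w \<and>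
     (\<forall>i\<in>Basis. extends_continuously K (partial_deriv i w) \<and>
       (\<forall>j\<in>Basis. extends_continuously K (partial_deriv j (partial_deriv i w))))"

definition sup_norm :: "'a set \<Rightarrow> ('a \<Rightarrow> real) \<Rightarrow> ennreal" where
  "sup_norm S g = (SUP x\<in>S. ennreal \<bar>g x\<bar>)"

(* The diagonal contributes 0 / 0 = 0. *)
definition holder_seminorm :: "real \<Rightarrow> 'a::metric_space set \<Rightarrow> ('a \<Rightarrow> real) \<Rightarrow> ennreal" where
  "holder_seminorm \<beta> S g = (SUP x\<in>S. SUP y\<in>S. ennreal (\<bar>g x - g y\<bar> / dist x y powr \<beta>))"

(* Convention C^{2,0} = C^2. *)
definition C2_holder_norm ::
  "real \<Rightarrow> 'a::euclidean_space set \<Rightarrow> ('a \<Rightarrow> real) \<Rightarrow> ennreal" where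
  "C2_holder_norm \<beta> K w =
     sup_norm K w
     + (\<Sum>i\<in>Basis. sup_norm (interior K) (partial_deriv i w))
     + (\<Sum>i\<in>Basis. \<Sum>j\<in>Basis. sup_norm (interior K) (partial_deriv j (partial_deriv i w)))
     + (if \<beta> = 0 then 0 else
         (\<Sum>i\<in>Basis. \<Sum>j\<in>Basis.
            holder_seminorm \<beta> (interior K) (partial_deriv j (partial_deriv i w))))"

definition C2b_norm :: "real \<Rightarrow> 'a::euclidean_space set \<Rightarrow> ('a \<Rightarrow> real) \<Rightarrow> ennreal" where
  "C2b_norm \<beta> F w = (SUP x\<in>F. C2_holder_norm \<beta> (cball x 1 \<inter> F) w)"

definition C2b :: "real \<Rightarrow> 'a::euclidean_space set \<Rightarrow> ('a \<Rightarrow> real) set" where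
  "C2b \<beta> F = {w. (\<forall>x\<in>F. C2_closed (cball x 1 \<inter> F) w) \<and> C2b_norm \<beta> F w < \<infinity>}"

definition converges_in_C2b ::
  "real \<Rightarrow> 'a::euclidean_space set \<Rightarrow> ('b \<Rightarrow> 'a \<Rightarrow> real) \<Rightarrow> ('a \<Rightarrow> real) \<Rightarrow> 'b filter \<Rightarrow> bool" where
  "converges_in_C2b \<beta> F W w L \<longleftrightarrow>
     w \<in> C2b \<beta> F \<and> (\<forall>\<^sub>F h in L. W h \<in> C2b \<beta> F) \<and>
     ((\<lambda>h. C2b_norm \<beta> F (\<lambda>x. W h x - w x)) \<longlongrightarrow> 0) L"

(* R^N with N = 1 + CARD('m) is rendered as real \<times> (real^'m) (Euclidean product norm). *)
definition half_space :: "(real \<times> (real^'m)) set" where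
  "half_space = {0<..} \<times> UNIV"

end

(* Far from the boundary, u dominates an explicit compactly supported subsolution, which gives a
   positive lower bound; evaluating the equation at almost minimum and almost maximum points at infinity
   then yields liminf u >= mu and f S = 0 for S = limsup u.  Since f lies below a multiple of r - S to the
   left of S, the same subsolution argument, applied to S - u, shows that S - u has a gap in its values
   near infinity; by connectedness u converges to S uniformly.  The convergence of the derivatives follows
   from Brandt's elementary form of the Schauder estimates: differences of u that are odd in one or two
   coordinates vanish on the coordinate hyperplanes and are compared with barriers there. *)
theory Submission
  imports Defs
begin

section \<open>The Laplacian along coordinate lines and the maximum principle\<close>

definition has_second_deriv :: "(real \<Rightarrow> real) \<Rightarrow> real \<Rightarrow> bool" where
  "has_second_deriv g D \<longleftrightarrow>
     (\<exists>g'. (\<forall>\<^sub>F t in nhds 0. (g has_real_derivative g' t) (at t)) \<and>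
        (g' has_real_derivative D) (at 0))"

lemma has_second_derivI:
  assumes "\<forall>\<^sub>F t in nhds 0. (g has_real_derivative g' t) (at t)"
    and "(g' has_real_derivative D) (at 0)"
  shows "has_second_deriv g D"
  using assms unfolding has_second_deriv_def by blast

lemma has_second_deriv_const [simp]: "has_second_deriv (\<lambda>t. c) 0"
  by (rule has_second_derivI[where g' = "\<lambda>t. 0"]) (auto intro!: derivative_eq_intros)

lemma has_second_deriv_add:
  assumes "has_second_deriv g D" "has_second_deriv h E"
  shows "has_second_deriv (\<lambda>t. g t + h t) (D + E)"
proof -
  obtain g' h' where
    g: "\<forall>\<^sub>F t in nhds 0. (g has_real_derivative g' t) (at t)" "(g' has_real_derivative D) (at 0)" and
    h: "\<forall>\<^sub>F t in nhds 0. (h has_real_derivative h' t) (at t)" "(h' has_real_derivative E) (at 0)"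
    using assms unfolding has_second_deriv_def by blast
  show ?thesis
  proof (rule has_second_derivI)
    show "\<forall>\<^sub>F t in nhds 0. ((\<lambda>t. g t + h t) has_real_derivative g' t + h' t) (at t)"
      using g(1) h(1) by eventually_elim (rule DERIV_add)
    show "((\<lambda>t. g' t + h' t) has_real_derivative D + E) (at 0)"
      using g(2) h(2) by (rule DERIV_add)
  qed
qed

lemma has_second_deriv_cmult:
  assumes "has_second_deriv g D"
  shows "has_second_deriv (\<lambda>t. c * g t) (c * D)"
proof -
  obtain g' where
    g: "\<forall>\<^sub>F t in nhds 0. (g has_real_derivative g' t) (at t)" "(g' has_real_derivative D) (at 0)"
    using assms unfolding has_second_deriv_def by blast
  show ?thesis
  proof (rule has_second_derivI)
    show "\<forall>\<^sub>F t in nhds 0. ((\<lambda>t. c * g t) has_real_derivative c * g' t) (at t)"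
      using g(1) by eventually_elim (rule DERIV_cmult)
    show "((\<lambda>t. c * g' t) has_real_derivative c * D) (at 0)"
      using g(2) by (rule DERIV_cmult)
  qed
qed

lemma has_second_deriv_mirror:
  assumes "has_second_deriv g D"
  shows "has_second_deriv (\<lambda>t. g (- t)) D"
proof -
  obtain g' where
    g: "\<forall>\<^sub>F t in nhds 0. (g has_real_derivative g' t) (at t)" "(g' has_real_derivative D) (at 0)"
    using assms unfolding has_second_deriv_def by blast
  have "filterlim (\<lambda>t::real. - t) (nhds 0) (nhds 0)"
    using tendsto_minus[OF filterlim_ident, of "0::real"] by simp
  then have "\<forall>\<^sub>F t in nhds 0. (g has_real_derivative g' (- t)) (at (- t))"
    by (rule eventually_compose_filterlim[OF g(1)])
  then have 1: "\<forall>\<^sub>F t in nhds 0. ((\<lambda>t. g (- t)) has_real_derivative - g' (- t)) (at t)"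
    by eventually_elim (rule DERIV_mirror[THEN iffD1])
  have "((\<lambda>t. g' (- t)) has_real_derivative - D) (at 0)"
    by (rule DERIV_mirror[THEN iffD1]) (simp add: g(2))
  from DERIV_minus[OF this] have "((\<lambda>t. - g' (- t)) has_real_derivative D) (at 0)"
    by simp
  with 1 show ?thesis
    by (rule has_second_derivI)
qed

lemma has_second_deriv_le_0_if_local_max:
  assumes "has_second_deriv g D" and max: "\<forall>\<^sub>F t in nhds 0. g t \<le> g 0"
  shows "D \<le> 0"
proof (rule ccontr)
  assume "\<not> D \<le> 0"
  then have "D > 0" by simp
  obtain g' where
    g: "\<forall>\<^sub>F t in nhds 0. (g has_real_derivative g' t) (at t)" "(g' has_real_derivative D) (at 0)"
    using assms(1) unfolding has_second_deriv_def by blast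
  obtain d where d: "d > 0" "\<And>t. \<bar>t\<bar> < d \<Longrightarrow> (g has_real_derivative g' t) (at t) \<and> g t \<le> g 0"
    using eventually_conj[OF g(1) max] by (auto simp: eventually_nhds_metric dist_real_def)
  have "g' 0 = 0"
    using DERIV_local_max[of g "g' 0" 0 d] d by simp
  obtain e where e: "e > 0" "\<And>h. 0 < h \<Longrightarrow> h < e \<Longrightarrow> g' 0 < g' (0 + h)"
    using DERIV_pos_inc_right[OF g(2) \<open>D > 0\<close>] by blast
  define s where "s = min d e / 2"
  have s: "s > 0" "s < d" "s < e"
    using d(1) e(1) by (auto simp: s_def min_def)
  obtain t where t: "0 < t" "t < s" "g s - g 0 = (s - 0) * g' t"
    using MVT2[of 0 s g g'] s d(2) by auto
  have "g' t > 0"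
    using e(2)[of t] t s \<open>g' 0 = 0\<close> by simp
  with t s have "g s > g 0"
    by (metis diff_gt_0_iff_gt diff_zero mult_pos_pos)
  moreover have "g s \<le> g 0"
    using d(2)[of s] s by simp
  ultimately show False by simp
qed

definition has_laplacian :: "('a::euclidean_space \<Rightarrow> real) \<Rightarrow> 'a \<Rightarrow> real \<Rightarrow> bool" where
  "has_laplacian v x L \<longleftrightarrow>
     (\<exists>D. (\<forall>i\<in>Basis. has_second_deriv (\<lambda>t. v (x + t *\<^sub>R i)) (D i)) \<and> L = sum D Basis)"

lemma has_laplacianI:
  assumes "\<And>i. i \<in> Basis \<Longrightarrow> has_second_deriv (\<lambda>t. v (x + t *\<^sub>R i)) (D i)"
    and "L = sum D Basis"
  shows "has_laplacian v x L"
  using assms unfolding has_laplacian_def by blast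

lemma has_laplacian_const: "has_laplacian (\<lambda>x. c) x 0"
  by (rule has_laplacianI[where D = "\<lambda>i. 0"]) auto

lemma has_laplacian_add:
  assumes "has_laplacian v x L" "has_laplacian w x M"
  shows "has_laplacian (\<lambda>x. v x + w x) x (L + M)"
proof -
  obtain D E where
    "\<And>i. i \<in> Basis \<Longrightarrow> has_second_deriv (\<lambda>t. v (x + t *\<^sub>R i)) (D i)" "L = sum D Basis"
    "\<And>i. i \<in> Basis \<Longrightarrow> has_second_deriv (\<lambda>t. w (x + t *\<^sub>R i)) (E i)" "M = sum E Basis"
    using assms unfolding has_laplacian_def by auto
  then show ?thesis
    by (intro has_laplacianI[where D = "\<lambda>i. D i + E i"])
      (auto simp: sum.distrib intro: has_second_deriv_add)
qed

lemma has_laplacian_cmult: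
  assumes "has_laplacian v x L"
  shows "has_laplacian (\<lambda>x. c * v x) x (c * L)"
proof -
  obtain D where
    "\<And>i. i \<in> Basis \<Longrightarrow> has_second_deriv (\<lambda>t. v (x + t *\<^sub>R i)) (D i)" "L = sum D Basis"
    using assms unfolding has_laplacian_def by auto
  then show ?thesis
    by (intro has_laplacianI[where D = "\<lambda>i. c * D i"])
      (auto simp: sum_distrib_left intro: has_second_deriv_cmult)
qed

lemma has_laplacian_minus:
  assumes "has_laplacian v x L"
  shows "has_laplacian (\<lambda>x. - v x) x (- L)"
  using has_laplacian_cmult[OF assms, of "-1"] by simp

lemma has_laplacian_diff:
  assumes "has_laplacian v x L" "has_laplacian w x M"
  shows "has_laplacian (\<lambda>x. v x - w x) x (L - M)"
  using has_laplacian_add[OF assms(1) has_laplacian_minus[OF assms(2)]] by simp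

lemma has_laplacian_shift:
  assumes "has_laplacian v (x + a) L"
  shows "has_laplacian (\<lambda>x. v (x + a)) x L"
proof -
  obtain D where
    D: "\<And>i. i \<in> Basis \<Longrightarrow> has_second_deriv (\<lambda>t. v (x + a + t *\<^sub>R i)) (D i)"
      "L = sum D Basis"
    using assms unfolding has_laplacian_def by auto
  have eq: "x + t *\<^sub>R i + a = x + a + t *\<^sub>R i" for t i
    by (metis add.assoc add.commute)
  show ?thesis
    by (rule has_laplacianI[where D = D]) (simp_all only: eq D)
qed

lemma has_laplacian_le_0_if_local_max:
  fixes v :: "'a::euclidean_space \<Rightarrow> real"
  assumes "has_laplacian v x L" and max: "\<forall>\<^sub>F y in nhds x. v y \<le> v x"
  shows "L \<le> 0"
proof -
  obtain D where
    D: "\<And>i. i \<in> Basis \<Longrightarrow> has_second_deriv (\<lambda>t. v (x + t *\<^sub>R i)) (D i)" "L = sum D Basis"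
    using assms(1) unfolding has_laplacian_def by auto
  have "D i \<le> 0" if "i \<in> Basis" for i
  proof (rule has_second_deriv_le_0_if_local_max[OF D(1)[OF that]])
    have "filterlim (\<lambda>t. x + t *\<^sub>R i) (nhds (x + 0 *\<^sub>R i)) (nhds 0)"
      by (intro tendsto_intros filterlim_ident)
    then have "filterlim (\<lambda>t. x + t *\<^sub>R i) (nhds x) (nhds 0)"
      by simp
    from eventually_compose_filterlim[OF max this]
    show "\<forall>\<^sub>F t in nhds 0. v (x + t *\<^sub>R i) \<le> v (x + 0 *\<^sub>R i)"
      by simp
  qed
  then show ?thesis
    unfolding D(2) by (rule sum_nonpos)
qed

lemma maximum_principle:
  fixes v :: "'a::euclidean_space \<Rightarrow> real"
  assumes K: "compact K" "continuous_on K v" and S: "open S" "S \<subseteq> K"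
    and bdry: "\<And>x. x \<in> K - S \<Longrightarrow> v x \<le> 0"
    and lap: "\<And>x. x \<in> S \<Longrightarrow> v x > 0 \<Longrightarrow> \<exists>L>0. has_laplacian v x L"
    and x: "x \<in> K"
  shows "v x \<le> 0"
proof (rule ccontr)
  assume "\<not> v x \<le> 0"
  obtain y where y: "y \<in> K" "\<And>z. z \<in> K \<Longrightarrow> v z \<le> v y"
    using continuous_attains_sup[OF K(1) _ K(2)] x by blast
  have "v y > 0"
    using y(2)[OF x] \<open>\<not> v x \<le> 0\<close> by simp
  then have "y \<in> S"
    using bdry[of y] y(1) by force
  then obtain L where L: "L > 0" "has_laplacian v y L"
    using lap \<open>v y > 0\<close> by blast
  have "\<forall>\<^sub>F z in nhds y. z \<in> S"
    using S(1) \<open>y \<in> S\<close> by (rule eventually_nhds_in_open)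
  then have "\<forall>\<^sub>F z in nhds y. v z \<le> v y"
    by eventually_elim (use y(2) S(2) in auto)
  from has_laplacian_le_0_if_local_max[OF L(2) this] L(1) show False
    by simp
qed

definition reflect :: "'a::euclidean_space \<Rightarrow> 'a \<Rightarrow> 'a" where
  "reflect k x = x - (2 * (x \<bullet> k)) *\<^sub>R k"

lemma reflect_inner:
  assumes "k \<in> Basis" "i \<in> Basis"
  shows "reflect k x \<bullet> i = (if i = k then - (x \<bullet> i) else x \<bullet> i)"
  using assms by (simp add: reflect_def inner_diff_left inner_Basis)

lemma reflect_add_scaleR:
  assumes "k \<in> Basis" "i \<in> Basis"
  shows "reflect k (x + t *\<^sub>R i) = reflect k x + (if i = k then - t else t) *\<^sub>R i"
  by (rule euclidean_eqI) (use assms in \<open>simp add: reflect_inner inner_add_left inner_Basis\<close>)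

lemma continuous_on_reflect [continuous_intros]: "continuous_on S (reflect k)"
  unfolding reflect_def by (intro continuous_intros)

lemma has_laplacian_reflect:
  assumes k: "k \<in> Basis" and "has_laplacian v (reflect k x) L"
  shows "has_laplacian (\<lambda>x. v (reflect k x)) x L"
proof -
  obtain D where
    D: "\<And>i. i \<in> Basis \<Longrightarrow> has_second_deriv (\<lambda>t. v (reflect k x + t *\<^sub>R i)) (D i)"
      "L = sum D Basis"
    using assms(2) unfolding has_laplacian_def by auto
  have "has_second_deriv (\<lambda>t. v (reflect k (x + t *\<^sub>R i))) (D i)" if "i \<in> Basis" for i
    unfolding reflect_add_scaleR[OF k that]
    using D(1)[OF that] has_second_deriv_mirror[OF D(1)[OF that]]
    by (cases "i = k") simp_all
  then show ?thesis
    using D(2) by (intro has_laplacianI) auto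
qed

section \<open>Barriers\<close>

lemma has_second_deriv_quadratic_power:
  "has_second_deriv (\<lambda>t. (A - B * t - t\<^sup>2) ^ k)
     (real k * real (k - 1) * A ^ (k - 2) * B\<^sup>2 - 2 * real k * A ^ (k - 1))"
proof (rule has_second_derivI)
  show "\<forall>\<^sub>F t in nhds 0. ((\<lambda>t. (A - B * t - t\<^sup>2) ^ k) has_real_derivative
      real k * (A - B * t - t\<^sup>2) ^ (k - 1) * (- B - 2 * t)) (at t)"
    by (intro always_eventually allI) (auto intro!: derivative_eq_intros)
  show "((\<lambda>t. real k * (A - B * t - t\<^sup>2) ^ (k - 1) * (- B - 2 * t)) has_real_derivative
      real k * real (k - 1) * A ^ (k - 2) * B\<^sup>2 - 2 * real k * A ^ (k - 1)) (at 0)"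
    by (rule derivative_eq_intros refl | simp)+
      (simp add: power2_eq_square algebra_simps numeral_2_eq_2)
qed

lemma norm_add_scaleR_Basis_power2:
  fixes x :: "'a::euclidean_space"
  assumes "i \<in> Basis"
  shows "(norm (x + t *\<^sub>R i))\<^sup>2 = (norm x)\<^sup>2 + 2 * (x \<bullet> i) * t + t\<^sup>2"
  unfolding power2_norm_eq_inner using assms
  by (simp add: inner_add_left inner_add_right inner_commute power2_eq_square algebra_simps)

lemma norm_power2_eq_sum:
  fixes x :: "'a::euclidean_space"
  shows "(norm x)\<^sup>2 = (\<Sum>i\<in>Basis. (x \<bullet> i)\<^sup>2)"
  unfolding power2_norm_eq_inner by (simp add: power2_eq_square euclidean_inner[of x x])

lemma has_laplacian_paraboloid_power:
  fixes x a :: "'a::euclidean_space" and R :: real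
  defines "p \<equiv> R\<^sup>2 - (norm (x - a))\<^sup>2"
  shows "has_laplacian (\<lambda>x. (R\<^sup>2 - (norm (x - a))\<^sup>2) ^ k) x
    (4 * real k * real (k - 1) * p ^ (k - 2) * (norm (x - a))\<^sup>2
     - 2 * real k * real DIM('a) * p ^ (k - 1))"
proof (rule has_laplacianI)
  fix i :: 'a assume i: "i \<in> Basis"
  have "(norm (x + t *\<^sub>R i - a))\<^sup>2 = (norm (x - a))\<^sup>2 + 2 * ((x - a) \<bullet> i) * t + t\<^sup>2" for t
    unfolding norm_add_scaleR_Basis_power2[OF i, symmetric] by (simp add: diff_add_eq)
  then have "(R\<^sup>2 - (norm (x + t *\<^sub>R i - a))\<^sup>2) ^ k = (p - (2 * ((x - a) \<bullet> i)) * t - t\<^sup>2) ^ k" for t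
    by (simp add: p_def diff_diff_add add.assoc)
  moreover have "real k * real (k - 1) * p ^ (k - 2) * (2 * ((x - a) \<bullet> i))\<^sup>2
      = 4 * real k * real (k - 1) * p ^ (k - 2) * ((x - a) \<bullet> i)\<^sup>2"
    by (simp only: power_mult_distrib) simp
  ultimately show "has_second_deriv (\<lambda>t. (R\<^sup>2 - (norm (x + t *\<^sub>R i - a))\<^sup>2) ^ k)
      (4 * real k * real (k - 1) * p ^ (k - 2) * ((x - a) \<bullet> i)\<^sup>2 - 2 * real k * p ^ (k - 1))"
    using has_second_deriv_quadratic_power[of p "2 * ((x - a) \<bullet> i)" k] by (simp only:)
next
  have "(norm (x - a))\<^sup>2 = (\<Sum>i\<in>Basis. ((x - a) \<bullet> i)\<^sup>2)"
    by (rule norm_power2_eq_sum)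
  then show "4 * real k * real (k - 1) * p ^ (k - 2) * (norm (x - a))\<^sup>2
      - 2 * real k * real DIM('a) * p ^ (k - 1)
    = (\<Sum>i\<in>Basis. 4 * real k * real (k - 1) * p ^ (k - 2) * ((x - a) \<bullet> i)\<^sup>2
        - 2 * real k * p ^ (k - 1))"
    by (simp add: sum_subtractf sum_distrib_left)
qed

lemma has_laplacian_norm_power2:
  fixes x a :: "'a::euclidean_space"
  shows "has_laplacian (\<lambda>x. (norm (x - a))\<^sup>2) x (2 * real DIM('a))"
  using has_laplacian_minus[OF has_laplacian_paraboloid_power[of 0 a 1 x]] by simp

lemma paraboloid_barrier:
  fixes v :: "'a::euclidean_space \<Rightarrow> real" and a :: 'a
  assumes r: "0 < r" "r < R" and cont: "continuous_on (cball a R) v"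
    and nonneg: "\<And>x. x \<in> cball a R \<Longrightarrow> 0 \<le> v x"
    and \<theta>: "0 < \<theta>" "\<And>x. x \<in> cball a r \<Longrightarrow> \<theta> \<le> v x"
    and super: "\<And>x. x \<in> ball a R \<Longrightarrow> v x < \<theta> \<Longrightarrow> \<exists>L\<le>0. has_laplacian v x L"
    and k: "2 \<le> k" "real DIM('a) * R\<^sup>2 < 2 * real (k - 1) * r\<^sup>2"
    and x: "x \<in> cball a R"
  shows "\<theta> * ((R\<^sup>2 - (norm (x - a))\<^sup>2) / R\<^sup>2) ^ k \<le> v x"
proof -
  define C where "C = \<theta> / (R\<^sup>2) ^ k"
  define p where "p x = R\<^sup>2 - (norm (x - a))\<^sup>2" for x
  have C: "C > 0"
    using r \<theta>(1) by (simp add: C_def)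
  have p: "0 \<le> p x" "p x \<le> R\<^sup>2" if "x \<in> cball a R" for x
    using that r by (auto simp: p_def dist_norm norm_minus_commute intro: power_mono)
  have le: "C * p x ^ k \<le> \<theta>" if "x \<in> cball a R" for x
    using power_mono[OF p(2)[OF that] p(1)[OF that], of k] \<theta>(1) r
    by (simp add: C_def field_simps)
  have "C * p x ^ k - v x \<le> 0"
  proof (rule maximum_principle[OF compact_cball _ _ _ _ _ x])
    show "continuous_on (cball a R) (\<lambda>x. C * p x ^ k - v x)"
      unfolding p_def by (intro continuous_intros cont)
    show "open (ball a R - cball a r)"
      by (intro open_Diff open_ball closed_cball)
    show "ball a R - cball a r \<subseteq> cball a R"
      by auto
  next
    fix y assume y: "y \<in> cball a R - (ball a R - cball a r)"
    show "C * p y ^ k - v y \<le> 0"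
    proof (cases "y \<in> cball a r")
      case True
      then show ?thesis using le[of y] \<theta>(2)[of y] y by simp
    next
      case False
      then have "p y = 0"
        using y by (auto simp: p_def dist_norm norm_minus_commute)
      then show ?thesis using nonneg[of y] y k by (simp add: power_0_left)
    qed
  next
    fix y assume y: "y \<in> ball a R - cball a r" and pos: "C * p y ^ k - v y > 0"
    then obtain L where L: "L \<le> 0" "has_laplacian v y L"
      using super[of y] le[of y] by force
    define d where "d = norm (y - a)"
    have d: "r < d" "d < R"
      using y by (auto simp: d_def dist_norm norm_minus_commute)
    have py: "0 < p y" "p y \<le> R\<^sup>2"
      using d r by (auto simp: p_def simp flip: d_def intro!: power_strict_mono)
    have "real DIM('a) * p y \<le> real DIM('a) * R\<^sup>2"
      using py by (intro mult_left_mono) auto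
    also note k(2)
    also have "2 * real (k - 1) * r\<^sup>2 \<le> 2 * real (k - 1) * d\<^sup>2"
      using d r by (intro mult_left_mono power_mono) auto
    finally have "0 < 2 * real k * p y ^ (k - 2) * (2 * real (k - 1) * d\<^sup>2 - real DIM('a) * p y)"
      using py k by simp
    also have "\<dots> = 4 * real k * real (k - 1) * p y ^ (k - 2) * d\<^sup>2
        - 2 * real k * real DIM('a) * p y ^ (k - 1)"
    proof -
      have "p y ^ (k - 1) = p y ^ (k - 2) * p y"
        using k(1) by (metis Suc_1 Suc_diff_Suc Suc_le_lessD diff_Suc_1 power_Suc2 diff_Suc_eq_diff_pred)
      then show ?thesis by (simp add: algebra_simps)
    qed
    finally have "0 < \<dots>" .
    with C L have "0 < C * (4 * real k * real (k - 1) * p y ^ (k - 2) * d\<^sup>2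
        - 2 * real k * real DIM('a) * p y ^ (k - 1)) - L"
      by (smt (verit) mult_pos_pos)
    moreover have "has_laplacian (\<lambda>x. C * p x ^ k - v x) y (C * (4 * real k * real (k - 1) * p y ^ (k - 2) * d\<^sup>2
        - 2 * real k * real DIM('a) * p y ^ (k - 1)) - L)"
      using has_laplacian_diff[OF has_laplacian_cmult[OF has_laplacian_paraboloid_power] L(2)]
      unfolding p_def d_def .
    ultimately show "\<exists>L>0. has_laplacian (\<lambda>x. C * p x ^ k - v x) y L" by blast
  qed
  then show ?thesis
    by (simp add: C_def p_def power_divide)
qed

text \<open>Touching the supersolution \<open>v\<close> from below by the largest admissible multiple of the compactly
  supported strict subsolution \<open>(R\<^sup>2 - \<bar>x - a\<bar>\<^sup>2)\<^sup>2\<close>, i.e. looking at a maximum of the quotient.\<close>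

lemma supersolution_ge_on_large_ball:
  fixes v :: "'a::euclidean_space \<Rightarrow> real" and a :: 'a
  assumes R: "0 < R" and c: "(4 * real DIM('a) + 8)\<^sup>2 < 32 * c * R\<^sup>2"
    and cont: "continuous_on (cball a R) v"
    and pos: "\<And>x. x \<in> cball a R \<Longrightarrow> 0 < v x"
    and super: "\<And>x. x \<in> ball a R \<Longrightarrow> v x < s \<Longrightarrow> \<exists>L\<le>- (c * v x). has_laplacian v x L"
  shows "s \<le> v a"
proof (rule ccontr)
  assume "\<not> s \<le> v a"
  define p where "p x = R\<^sup>2 - (norm (x - a))\<^sup>2" for x
  define q where "q x = 1 / R ^ 4 * p x ^ 2" for x
  have p: "0 \<le> p x" "p x \<le> R\<^sup>2" if "x \<in> cball a R" for x
    using that R by (auto simp: p_def dist_norm norm_minus_commute intro: power_mono)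
  have q_le: "q x \<le> 1" if "x \<in> cball a R" for x
    using power_mono[OF p(2)[OF that] p(1)[OF that], of 2] R
    by (simp add: q_def field_simps)
  have "continuous_on (cball a R) (\<lambda>x. q x / v x)"
    unfolding q_def p_def using pos by (intro continuous_intros cont) (auto simp: less_imp_neq[symmetric] dest!: pos)
  then obtain y where y: "y \<in> cball a R" "\<And>x. x \<in> cball a R \<Longrightarrow> q x / v x \<le> q y / v y"
    using continuous_attains_sup[OF compact_cball, of a R "\<lambda>x. q x / v x"] R by auto
  define T where "T = q y / v y"
  have "q a = 1"
    using R by (simp add: q_def p_def)
  have va: "0 < v a" "0 < v y"
    using pos y(1) R by auto
  have T: "1 / v a \<le> T"
    using y(2)[of a] R \<open>q a = 1\<close> by (simp add: T_def)
  then have "T > 0"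
    using va by (smt (verit) divide_pos_pos)
  have Tv: "T * v y = q y"
    using va by (simp add: T_def)
  have "q y > 0"
    using Tv \<open>T > 0\<close> va by (metis mult_pos_pos)
  have "v y = q y / T"
    using Tv \<open>T > 0\<close> by (simp add: field_simps)
  also have "\<dots> \<le> 1 / T"
    using q_le[OF y(1)] \<open>T > 0\<close> by (simp add: divide_right_mono)
  also have "\<dots> \<le> v a"
    using T va \<open>T > 0\<close> by (simp add: field_simps)
  finally have "v y < s"
    using \<open>\<not> s \<le> v a\<close> by simp
  have "p y \<noteq> 0"
    using \<open>q y > 0\<close> by (auto simp: q_def)
  then have "y \<in> ball a R"
    using y(1) R by (auto simp: p_def dist_norm norm_minus_commute)
  then obtain L where L: "L \<le> - (c * v y)" "has_laplacian v y L"
    using super \<open>v y < s\<close> by blast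
  define d where "d = norm (y - a)"
  define l where "l = 1 / R ^ 4 * (4 * real 2 * real (2 - 1) * p y ^ (2 - 2) * d\<^sup>2
     - 2 * real 2 * real DIM('a) * p y ^ (2 - 1)) - T * L"
  have "has_laplacian (\<lambda>x. q x - T * v x) y l"
    using has_laplacian_diff[OF has_laplacian_cmult[OF has_laplacian_paraboloid_power[of R a 2 y]]
        has_laplacian_cmult[OF L(2)]]
    unfolding p_def q_def l_def d_def .
  moreover have "\<forall>\<^sub>F x in nhds y. q x - T * v x \<le> q y - T * v y"
  proof -
    have "\<forall>\<^sub>F x in nhds y. x \<in> ball a R"
      using \<open>y \<in> ball a R\<close> by (intro eventually_nhds_in_open) auto
    then show ?thesis
    proof eventually_elim
      fix x assume "x \<in> ball a R"
      then have "q x / v x \<le> T" "0 < v x"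
        using y(2)[of x] pos[of x] by (auto simp: T_def)
      then show "q x - T * v x \<le> q y - T * v y"
        by (simp add: Tv divide_le_eq)
    qed
  qed
  ultimately have "l \<le> 0"
    by (rule has_laplacian_le_0_if_local_max)
  moreover have "l > 0"
  proof -
    define P where "P = p y"
    define n where "n = real DIM('a)"
    have d2: "d\<^sup>2 = R\<^sup>2 - P"
      by (simp add: P_def p_def d_def)
    have "c > 0"
    proof (rule ccontr)
      assume "\<not> c > 0"
      then have "32 * c * R\<^sup>2 \<le> 0" by (simp add: mult_nonpos_nonneg)
      with c show False using zero_le_power2[of "4 * real DIM('a) + 8"] by linarith
    qed
    have "0 \<le> (2 * c * P - (4 * n + 8))\<^sup>2"
      by simp
    also have "\<dots> = 4 * c * (c * P\<^sup>2 - (4 * n + 8) * P) + (4 * n + 8)\<^sup>2"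
      by (simp add: power2_eq_square algebra_simps)
    also have "\<dots> < 4 * c * (c * P\<^sup>2 - (4 * n + 8) * P) + 32 * c * R\<^sup>2"
      using c by (simp add: n_def)
    also have "\<dots> = 4 * c * (c * P\<^sup>2 - (4 * n + 8) * P + 8 * R\<^sup>2)"
      by (simp add: algebra_simps)
    finally have *: "0 < c * P\<^sup>2 - (4 * n + 8) * P + 8 * R\<^sup>2"
      using \<open>c > 0\<close> by (simp add: zero_less_mult_iff)
    have "T * L \<le> T * (- (c * v y))"
      using L(1) \<open>T > 0\<close> by (intro mult_left_mono) auto
    also have "\<dots> = - (c * q y)"
      using Tv by (simp add: algebra_simps)
    also have "\<dots> = - (1 / R ^ 4 * (c * P\<^sup>2))"
      by (simp add: q_def P_def)
    finally have TL: "T * L \<le> - (1 / R ^ 4 * (c * P\<^sup>2))" .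
    have "0 < 1 / R ^ 4 * (c * P\<^sup>2 - (4 * n + 8) * P + 8 * R\<^sup>2)"
      using * R by simp
    also have "\<dots> = 1 / R ^ 4 * (4 * real 2 * real (2 - 1) * P ^ (2 - 2) * d\<^sup>2
        - 2 * real 2 * n * P ^ (2 - 1)) + 1 / R ^ 4 * (c * P\<^sup>2)"
      unfolding distrib_left[symmetric] by (simp add: d2 algebra_simps)
    also have "\<dots> \<le> l"
      using TL by (simp add: l_def P_def n_def)
    finally show ?thesis .
  qed
  ultimately show False by simp
qed

text \<open>A maximum principle at infinity: subtracting a small paraboloid turns an almost minimum
  into an interior minimum of the perturbed function.\<close>

lemma laplacian_at_liminf:
  fixes v l :: "'a::euclidean_space \<Rightarrow> real"
  assumes cont: "continuous_on {x. 0 < x \<bullet> e} v" and e: "e \<in> Basis"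
    and lap: "\<And>x. 0 < x \<bullet> e \<Longrightarrow> has_laplacian v x (l x)"
    and lower: "\<And>\<eta>. 0 < \<eta> \<Longrightarrow> \<exists>R. \<forall>x. R \<le> x \<bullet> e \<longrightarrow> m - \<eta> < v x"
    and freq: "\<And>\<eta> R. 0 < \<eta> \<Longrightarrow> \<exists>x. R \<le> x \<bullet> e \<and> v x < m + \<eta>"
    and \<eta>: "0 < \<eta>"
  shows "\<exists>x. R \<le> x \<bullet> e \<and> \<bar>v x - m\<bar> < \<eta> \<and> - \<eta> \<le> l x"
proof -
  define \<kappa> where "\<kappa> = \<eta> / (2 * real DIM('a))"
  define \<delta> where "\<delta> = min \<eta> \<kappa> / 2"
  have "\<kappa> > 0"
    using \<eta> by (simp add: \<kappa>_def DIM_positive)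
  then have \<delta>: "\<delta> > 0" "\<delta> < \<eta>" "2 * \<delta> \<le> \<kappa>"
    using \<eta> by (auto simp: \<delta>_def)
  obtain R' where R': "\<And>x. R' \<le> x \<bullet> e \<Longrightarrow> m - \<delta> < v x"
    using lower[OF \<delta>(1)] by blast
  obtain y where y: "max (max R R') 1 + 1 \<le> y \<bullet> e" "v y < m + \<delta>"
    using freq[OF \<delta>(1)] by blast
  have ball: "max (max R R') 1 \<le> x \<bullet> e" if "x \<in> cball y 1" for x
  proof -
    have "\<bar>(y - x) \<bullet> e\<bar> \<le> 1"
      using Basis_le_norm[OF e, of "y - x"] that by (simp add: dist_norm)
    with y(1) show ?thesis by (auto simp: inner_diff_left max_def split: if_splits)
  qed
  define w where "w x = v x + \<kappa> * (norm (x - y))\<^sup>2" for x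
  have "continuous_on (cball y 1) v"
    by (rule continuous_on_subset[OF cont]) (use ball in force)
  then have "continuous_on (cball y 1) w"
    unfolding w_def by (intro continuous_intros)
  then obtain z where z: "z \<in> cball y 1" "\<And>x. x \<in> cball y 1 \<Longrightarrow> w z \<le> w x"
    using continuous_attains_inf[OF compact_cball, of y 1 w] by auto
  have wz: "w z < m + \<delta>"
    using z(2)[of y] y(2) by (simp add: w_def)
  have vz: "m - \<delta> < v z"
    using R' ball[OF z(1)] by simp
  have "norm (z - y) < 1"
  proof (rule ccontr)
    assume "\<not> norm (z - y) < 1"
    then have "\<kappa> * 1 \<le> \<kappa> * (norm (z - y))\<^sup>2"
      using \<open>\<kappa> > 0\<close> by (intro mult_left_mono one_le_power) auto
    with wz vz \<delta> show False by (simp add: w_def)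
  qed
  then have "z \<in> ball y 1"
    by (simp add: dist_norm norm_minus_commute)
  then have "\<forall>\<^sub>F x in nhds z. x \<in> ball y 1"
    by (intro eventually_nhds_in_open) auto
  then have "\<forall>\<^sub>F x in nhds z. - w x \<le> - w z"
    by eventually_elim (use z(2) in force)
  moreover have "has_laplacian w z (l z + \<kappa> * (2 * real DIM('a)))"
    unfolding w_def using ball[OF z(1)]
    by (intro has_laplacian_add has_laplacian_cmult has_laplacian_norm_power2 lap) auto
  ultimately have "- (l z + \<kappa> * (2 * real DIM('a))) \<le> 0"
    by (metis has_laplacian_le_0_if_local_max has_laplacian_minus)
  then have "- \<eta> \<le> l z"
    using \<eta> by (simp add: \<kappa>_def DIM_positive)
  moreover have "v z \<le> w z"
    using \<open>\<kappa> > 0\<close> by (simp add: w_def)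
  ultimately show ?thesis
    using ball[OF z(1)] wz vz \<delta> by (intro exI[of _ z]) auto
qed

section \<open>Gradient estimate\<close>

lemma has_laplacian_affine:
  assumes "\<And>i t. i \<in> Basis \<Longrightarrow> v (x + t *\<^sub>R i) = A i + B i * t"
  shows "has_laplacian v x 0"
proof (rule has_laplacianI)
  fix i :: 'a assume "i \<in> Basis"
  show "has_second_deriv (\<lambda>t. v (x + t *\<^sub>R i)) 0"
    unfolding assms[OF \<open>i \<in> Basis\<close>]
    by (rule has_second_derivI[where g' = "\<lambda>t. B i"])
      (auto intro!: derivative_eq_intros always_eventually)
qed simp

lemma has_laplacian_inner_power2:
  assumes j: "j \<in> Basis"
  shows "has_laplacian (\<lambda>y. (y \<bullet> j)\<^sup>2) x 2"
proof (rule has_laplacianI)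
  fix i :: 'a assume i: "i \<in> Basis"
  show "has_second_deriv (\<lambda>t. ((x + t *\<^sub>R i) \<bullet> j)\<^sup>2) (if i = j then 2 else 0)"
  proof (cases "i = j")
    case True
    have "has_second_deriv (\<lambda>t. (x \<bullet> j + t)\<^sup>2) 2"
      by (rule has_second_derivI[where g' = "\<lambda>t. 2 * (x \<bullet> j + t)"])
        (auto intro!: derivative_eq_intros always_eventually)
    then show ?thesis using i True by (simp add: inner_add_left)
  qed (use i j in \<open>simp add: inner_add_left inner_Basis\<close>)
qed (use j in simp)

lemma mem_unit_cube: "y \<in> cbox (- One) One \<longleftrightarrow> (\<forall>i\<in>Basis. \<bar>y \<bullet> i\<bar> \<le> 1)"
  by (auto simp: mem_box abs_le_iff)

lemma mem_unit_box: "y \<in> box (- One) One \<longleftrightarrow> (\<forall>i\<in>Basis. \<bar>y \<bullet> i\<bar> < 1)"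
  by (auto simp: mem_box abs_less_iff)

lemma reflect_mem_cube:
  assumes "k \<in> Basis" "y \<in> cbox (- One) One"
  shows "reflect k y \<in> cbox (- One) One"
  using assms by (auto simp: mem_unit_cube reflect_inner)

lemma inner_power2_le_norm:
  assumes "finite J" "J \<subseteq> Basis"
  shows "(\<Sum>i\<in>J. (y \<bullet> i)\<^sup>2) \<le> (norm y)\<^sup>2"
  unfolding norm_power2_eq_sum
  by (rule sum_mono2) (use assms in auto)

lemma odd_difference_le:
  fixes v :: "'a::euclidean_space \<Rightarrow> real"
  assumes j: "j \<in> Basis" and F: "0 < F" and M: "0 \<le> M"
    and cont: "continuous_on (cbox (- One) One) v"
    and bound: "\<And>y. y \<in> cbox (- One) One \<Longrightarrow> \<bar>v y\<bar> \<le> M"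
    and lap: "\<And>y. y \<in> cbox (- One) One \<Longrightarrow> \<exists>L. \<bar>L\<bar> \<le> F \<and> has_laplacian v y L"
    and t: "0 \<le> t" "t \<le> 1"
  shows "v (t *\<^sub>R j) - v (- t *\<^sub>R j) \<le> 2 * t * (real DIM('a) * M + F)"
proof -
  define \<beta> where "\<beta> = (real DIM('a) - 1) * M + F"
  define \<psi> where "\<psi> y = M * (norm y)\<^sup>2 - (M + \<beta>) * (y \<bullet> j)\<^sup>2 + (M + \<beta>) * (y \<bullet> j)" for y :: 'a
  define W where "W y = 1 / 2 * (v y - v (reflect j y)) - \<psi> y" for y
  define K where "K = cbox (- One) One \<inter> {y. 0 \<le> y \<bullet> j}"
  define S where "S = box (- One) One \<inter> {y. 0 < y \<bullet> j}"
  have "1 \<le> real DIM('a)"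
    using DIM_positive[where 'a = 'a] by linarith
  then have \<beta>: "0 \<le> \<beta>"
    using M F by (simp add: \<beta>_def)
  have K_cube: "y \<in> cbox (- One) One" "0 \<le> y \<bullet> j" "y \<bullet> j \<le> 1" if "y \<in> K" for y
    using that j by (auto simp: K_def mem_unit_cube abs_le_iff)
  have \<psi>_ge: "M * (\<Sum>i\<in>J. (y \<bullet> i)\<^sup>2) + \<beta> * ((y \<bullet> j) - (y \<bullet> j)\<^sup>2) + M * (y \<bullet> j) \<le> \<psi> y"
    if "J \<subseteq> Basis - {j}" for J y
  proof -
    have "finite J"
      using that by (rule finite_subset) auto
    moreover have "j \<notin> J" "insert j J \<subseteq> Basis" using that j by auto
    ultimately have "M * ((\<Sum>i\<in>J. (y \<bullet> i)\<^sup>2) + (y \<bullet> j)\<^sup>2) \<le> M * (norm y)\<^sup>2"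
      using inner_power2_le_norm[of "insert j J" y] M by (intro mult_left_mono) auto
    then show ?thesis by (simp add: \<psi>_def algebra_simps)
  qed
  have sq: "0 \<le> (y \<bullet> j) - (y \<bullet> j)\<^sup>2" if "y \<in> K" for y
    using K_cube[OF that] by (simp add: power2_eq_square mult_left_le)
  have "t *\<^sub>R j \<in> K"
    using t j by (auto simp: K_def mem_unit_cube inner_Basis)
  have "W (t *\<^sub>R j) \<le> 0"
  proof (rule maximum_principle[OF _ _ _ _ _ _ \<open>t *\<^sub>R j \<in> K\<close>])
    show "compact K"
      unfolding K_def by (intro compact_Int_closed compact_cbox closed_halfspace_component_ge)
    show "continuous_on K W"
      unfolding W_def \<psi>_def
      by (intro continuous_intros continuous_on_compose2[OF cont])
        (auto simp: K_def intro: reflect_mem_cube[OF j])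
    show "open S"
      unfolding S_def by (intro open_Int open_box open_halfspace_component_gt)
    show "S \<subseteq> K"
      unfolding S_def K_def using box_subset_cbox by auto
  next
    fix y assume y: "y \<in> K - S"
    then have yK: "y \<in> K" by simp
    have half: "1 / 2 * (v y - v (reflect j y)) \<le> M"
      using bound[OF K_cube(1)[OF yK]] bound[OF reflect_mem_cube[OF j K_cube(1)[OF yK]]]
      by (simp add: abs_le_iff)
    have \<beta>': "0 \<le> \<beta> * ((y \<bullet> j) - (y \<bullet> j)\<^sup>2)"
      using \<beta> sq[OF yK] by simp
    consider "y \<bullet> j = 0" | "y \<bullet> j = 1" | i where "i \<in> Basis" "i \<noteq> j" "\<bar>y \<bullet> i\<bar> = 1"
      using y j unfolding K_def S_def Int_iff Diff_iff mem_unit_box mem_unit_cube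
      by (smt (verit) mem_Collect_eq)
    then show "W y \<le> 0"
    proof cases
      case 1
      then show ?thesis
        using \<psi>_ge[of "{}" y] by (simp add: W_def reflect_def)
    next
      case 2
      then show ?thesis
        using \<psi>_ge[of "{}" y] half by (simp add: W_def)
    next
      case 3
      have "1 = (y \<bullet> i)\<^sup>2"
        using 3(3) by (metis one_power2 power2_abs)
      moreover have "0 \<le> M * (y \<bullet> j)"
        using M K_cube[OF yK] by simp
      ultimately show ?thesis
        using \<psi>_ge[of "{i}" y] half \<beta>' 3 by (simp add: W_def)
    qed
  next
    fix y assume "y \<in> S"
    then have y: "y \<in> cbox (- One) One"
      using box_subset_cbox by (auto simp: S_def)
    obtain L1 L2 where L: "\<bar>L1\<bar> \<le> F" "has_laplacian v y L1"
        "\<bar>L2\<bar> \<le> F" "has_laplacian v (reflect j y) L2"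
      using lap[OF y] lap[OF reflect_mem_cube[OF j y]] by blast
    have lin: "has_laplacian (\<lambda>y. y \<bullet> j) y 0"
      by (rule has_laplacian_affine[where A = "\<lambda>i. y \<bullet> j" and B = "\<lambda>i. i \<bullet> j"])
        (simp add: inner_add_left)
    have nrm: "has_laplacian (\<lambda>y. (norm y)\<^sup>2) y (2 * real DIM('a))"
      using has_laplacian_norm_power2[of 0 y] by simp
    have "has_laplacian W y (1 / 2 * (L1 - L2) -
        (M * (2 * real DIM('a)) - (M + \<beta>) * 2 + (M + \<beta>) * 0))"
      unfolding W_def \<psi>_def
      by (intro has_laplacian_diff has_laplacian_add has_laplacian_cmult lin nrm
          has_laplacian_inner_power2 has_laplacian_reflect j L)
    moreover have "1 / 2 * (L1 - L2) -
        (M * (2 * real DIM('a)) - (M + \<beta>) * 2 + (M + \<beta>) * 0) = 1 / 2 * (L1 - L2) + 2 * F"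
      by (simp add: \<beta>_def algebra_simps)
    moreover have "0 < 1 / 2 * (L1 - L2) + 2 * F"
      using L(1,3) F by (simp add: abs_le_iff field_simps)
    ultimately show "\<exists>L>0. has_laplacian W y L"
      by metis
  qed
  moreover have "reflect j (t *\<^sub>R j) = - t *\<^sub>R j"
    by (rule euclidean_eqI) (use j in \<open>simp add: reflect_inner inner_Basis\<close>)
  moreover have "\<psi> (t *\<^sub>R j) \<le> t * (real DIM('a) * M + F)"
  proof -
    have "\<psi> (t *\<^sub>R j) = t * (M + \<beta>) - \<beta> * t\<^sup>2"
      using j by (simp add: \<psi>_def algebra_simps)
    also have "\<dots> \<le> t * (M + \<beta>)"
      using \<beta> by simp
    finally show ?thesis
      by (simp add: \<beta>_def algebra_simps)
  qed
  ultimately show ?thesis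
    by (simp add: W_def algebra_simps)
qed

lemma symmetric_difference_quotient:
  assumes "(g has_real_derivative d) (at (0::real))"
  shows "((\<lambda>t. (g t - g (- t)) / (2 * t)) \<longlongrightarrow> d) (at_right 0)"
proof -
  have "((\<lambda>t. (g t - g 0) / t) \<longlongrightarrow> d) (at 0)"
    using assms by (simp add: has_field_derivative_iff)
  moreover have "((\<lambda>t. g (- t)) has_real_derivative - d) (at 0)"
    by (rule DERIV_mirror[THEN iffD1]) (simp add: assms)
  then have "((\<lambda>t. (g (- t) - g 0) / t) \<longlongrightarrow> - d) (at 0)"
    by (simp add: has_field_derivative_iff)
  ultimately have "((\<lambda>t. ((g t - g 0) / t - (g (- t) - g 0) / t) / 2) \<longlongrightarrow> (d - - d) / 2) (at 0)"
    by (intro tendsto_intros) auto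
  then have "((\<lambda>t. (g t - g (- t)) / (2 * t)) \<longlongrightarrow> d) (at 0)"
    by (simp add: diff_divide_distrib[symmetric] mult.commute)
  then show ?thesis
    by (rule tendsto_within_subset) auto
qed

lemma gradient_estimate:
  fixes v :: "'a::euclidean_space \<Rightarrow> real"
  assumes j: "j \<in> Basis" and F: "0 < F" and M: "0 \<le> M"
    and cont: "continuous_on (cbox (x - One) (x + One)) v"
    and bound: "\<And>y. y \<in> cbox (x - One) (x + One) \<Longrightarrow> \<bar>v y\<bar> \<le> M"
    and lap: "\<And>y. y \<in> cbox (x - One) (x + One) \<Longrightarrow> \<exists>L. \<bar>L\<bar> \<le> F \<and> has_laplacian v y L"
    and d: "((\<lambda>t. v (x + t *\<^sub>R j)) has_real_derivative d) (at 0)"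
  shows "\<bar>d\<bar> \<le> real DIM('a) * M + F"
proof -
  define w where "w y = v (y + x)" for y
  have mem: "y + x \<in> cbox (x - One) (x + One)" if "y \<in> cbox (- One) One" for y
    using that by (auto simp: mem_box inner_diff_left inner_add_left)
  have w: "continuous_on (cbox (- One) One) w"
    unfolding w_def by (intro continuous_on_compose2[OF cont] continuous_intros) (use mem in auto)
  have wb: "\<bar>w y\<bar> \<le> M" if "y \<in> cbox (- One) One" for y
    using bound[OF mem[OF that]] by (simp add: w_def)
  have wl: "\<exists>L. \<bar>L\<bar> \<le> F \<and> has_laplacian w y L" if "y \<in> cbox (- One) One" for y
    using lap[OF mem[OF that]] unfolding w_def by (blast intro: has_laplacian_shift)
  have up: "w (t *\<^sub>R j) - w (- t *\<^sub>R j) \<le> 2 * t * (real DIM('a) * M + F)"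
    if "0 \<le> t" "t \<le> 1" for t
    by (rule odd_difference_le[OF j F M w wb wl that])
  have lo: "- w (t *\<^sub>R j) - - w (- t *\<^sub>R j) \<le> 2 * t * (real DIM('a) * M + F)"
    if "0 \<le> t" "t \<le> 1" for t
  proof (rule odd_difference_le[OF j F M _ _ _ that])
    show "continuous_on (cbox (- One) One) (\<lambda>y. - w y)"
      by (intro continuous_intros w)
    show "\<bar>- w y\<bar> \<le> M" if "y \<in> cbox (- One) One" for y
      using wb[OF that] by simp
    show "\<exists>L. \<bar>L\<bar> \<le> F \<and> has_laplacian (\<lambda>y. - w y) y L" if "y \<in> cbox (- One) One" for y
      using wl[OF that] has_laplacian_minus by (metis abs_minus_cancel)
  qed
  have "((\<lambda>t. (w (t *\<^sub>R j) - w (- t *\<^sub>R j)) / (2 * t)) \<longlongrightarrow> d) (at_right 0)"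
    using symmetric_difference_quotient[OF d] by (simp add: w_def add.commute)
  moreover have "\<forall>\<^sub>F t in at_right 0.
      \<bar>(w (t *\<^sub>R j) - w (- t *\<^sub>R j)) / (2 * t)\<bar> \<le> real DIM('a) * M + F"
  proof -
    have "\<forall>\<^sub>F t in at_right 0. t \<in> {0<..<1::real}"
      by (rule eventually_at_right_real) simp
    then show ?thesis
    proof eventually_elim
      case (elim t)
      then have "\<bar>w (t *\<^sub>R j) - w (- t *\<^sub>R j)\<bar> \<le> 2 * t * (real DIM('a) * M + F)"
        using up[of t] lo[of t] by auto
      with elim show ?case by (simp add: abs_divide divide_le_eq algebra_simps)
    qed
  qed
  ultimately show ?thesis
    by (intro tendsto_upperbound[OF tendsto_rabs]) auto
qed

section \<open>Logarithmic barrier for mixed differences\<close>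

text \<open>The product \<open>a b\<close> is harmonic and vanishes on both axes; the logarithm makes it strictly
  superharmonic. Its value at \<open>a = b = 0\<close> is \<open>0\<close>, although \<open>ln 0\<close> is a junk value there.\<close>

definition log_barrier :: "real \<Rightarrow> real \<Rightarrow> real" where
  "log_barrier a b = a * b * (ln 4 - ln (a + b))"

lemma log_barrier_nonneg:
  assumes "0 \<le> a" "0 \<le> b" "a + b \<le> 4"
  shows "0 \<le> log_barrier a b"
proof (cases "a + b = 0")
  case True
  then have "a = 0" using assms by simp
  then show ?thesis by (simp add: log_barrier_def)
next
  case False
  then have "ln (a + b) \<le> ln 4"
    using assms by simp
  then show ?thesis
    using assms by (simp add: log_barrier_def)
qed

lemma log_barrier_le:
  assumes "0 \<le> a" "0 \<le> b" "a + b \<le> 4"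
  shows "log_barrier a b \<le> 4 * b"
proof (cases "a + b = 0")
  case True
  then have "a = 0" using assms by simp
  then show ?thesis using assms by (simp add: log_barrier_def)
next
  case False
  then have s: "0 < a + b" using assms by simp
  have "ln 4 - ln (a + b) = ln (4 / (a + b))"
    using s by (simp add: ln_div)
  also have "\<dots> \<le> 4 / (a + b) - 1"
    using s by (intro ln_le_minus_one) simp
  also have "\<dots> \<le> 4 / (a + b)"
    by simp
  finally have "a * b * (ln 4 - ln (a + b)) \<le> a * b * (4 / (a + b))"
    using assms by (intro mult_left_mono) auto
  also have "\<dots> = 4 * b * (a / (a + b))"
    by simp
  also have "\<dots> \<le> 4 * b * 1"
    using assms s by (intro mult_left_mono) auto
  finally show ?thesis
    by (simp add: log_barrier_def)
qed

lemma continuous_on_log_barrier: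
  "continuous_on {p. 0 \<le> fst p \<and> 0 \<le> snd p \<and> fst p + snd p \<le> 4} (\<lambda>p. log_barrier (fst p) (snd p))"
  (is "continuous_on ?D _")
  unfolding continuous_on_eq_continuous_within
proof
  fix p assume p: "p \<in> ?D"
  show "continuous (at p within ?D) (\<lambda>p. log_barrier (fst p) (snd p))"
  proof (cases "fst p + snd p = 0")
    case False
    then show ?thesis
      unfolding log_barrier_def by (intro continuous_intros) auto
  next
    case True
    then have 0: "fst p = 0" "snd p = 0"
      using p by auto
    have "((\<lambda>p. log_barrier (fst p) (snd p)) \<longlongrightarrow> 0) (at p within ?D)"
    proof (rule Lim_null_comparison)
      show "\<forall>\<^sub>F q in at p within ?D. norm (log_barrier (fst q) (snd q)) \<le> 4 * snd q"
        using log_barrier_le log_barrier_nonneg by (auto simp: eventually_at_filter)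
      have "((\<lambda>q. 4 * snd q) \<longlongrightarrow> 4 * snd p) (at p within ?D)"
        by (intro tendsto_intros)
      then show "((\<lambda>q. 4 * snd q) \<longlongrightarrow> 0) (at p within ?D)"
        using 0 by simp
    qed
    then show ?thesis
      using 0 by (simp add: continuous_within log_barrier_def)
  qed
qed

lemma has_second_deriv_log_barrier:
  assumes "0 < a + b"
  shows "has_second_deriv (\<lambda>t. log_barrier (a + t) b)
    (- 2 * b / (a + b) + a * b / (a + b)\<^sup>2)"
proof (rule has_second_derivI)
  have "\<forall>\<^sub>F t in nhds 0. t \<in> {- (a + b)<..}"
    using assms by (intro eventually_nhds_in_open) auto
  then show "\<forall>\<^sub>F t in nhds 0. ((\<lambda>t. log_barrier (a + t) b) has_real_derivative
      b * (ln 4 - ln (a + t + b)) - (a + t) * b / (a + t + b)) (at t)"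
    unfolding log_barrier_def
    by eventually_elim (auto intro!: derivative_eq_intros simp: algebra_simps add_divide_distrib)
  define s where "s = a + b"
  have "((\<lambda>t. b * (ln 4 - ln (s + t)) - (a + t) * b / (s + t)) has_real_derivative
      - 2 * b / s + a * b / s\<^sup>2) (at 0)"
    using assms
    by (auto intro!: derivative_eq_intros simp: power2_eq_square field_simps simp flip: s_def)
  then show "((\<lambda>t. b * (ln 4 - ln (a + t + b)) - (a + t) * b / (a + t + b)) has_real_derivative
      - 2 * b / (a + b) + a * b / (a + b)\<^sup>2) (at 0)"
    by (simp add: s_def ac_simps)
qed

lemma has_second_deriv_log_barrier':
  assumes "0 < a + b"
  shows "has_second_deriv (\<lambda>t. log_barrier a (b + t))
    (- 2 * a / (a + b) + a * b / (a + b)\<^sup>2)"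
proof -
  have "log_barrier a (b + t) = log_barrier (b + t) a" for t
    by (simp add: log_barrier_def algebra_simps)
  then show ?thesis
    using has_second_deriv_log_barrier[of b a] assms by (simp add: add.commute mult.commute)
qed

lemma has_laplacian_log_barrier:
  assumes jk: "j \<in> Basis" "k \<in> Basis" "j \<noteq> k" and s: "0 < y \<bullet> j" "0 < y \<bullet> k"
  shows "\<exists>L\<le>- (3 / 2). has_laplacian (\<lambda>y. log_barrier (y \<bullet> j) (y \<bullet> k)) y L"
proof -
  define a b where "a = y \<bullet> j" and "b = y \<bullet> k"
  define Dj Dk where "Dj = - 2 * b / (a + b) + a * b / (a + b)\<^sup>2"
    and "Dk = - 2 * a / (a + b) + a * b / (a + b)\<^sup>2"
  have ab: "0 < a" "0 < b" using s by (auto simp: a_def b_def)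
  have "has_laplacian (\<lambda>y. log_barrier (y \<bullet> j) (y \<bullet> k)) y (Dj + Dk)"
  proof (rule has_laplacianI)
    fix i :: 'a assume i: "i \<in> Basis"
    consider "i = j" | "i = k" | "i \<noteq> j" "i \<noteq> k" by blast
    then show "has_second_deriv (\<lambda>t. log_barrier ((y + t *\<^sub>R i) \<bullet> j) ((y + t *\<^sub>R i) \<bullet> k))
        ((if i = j then Dj else 0) + (if i = k then Dk else 0))"
      using jk i ab has_second_deriv_log_barrier[of a b] has_second_deriv_log_barrier'[of a b]
      by cases (auto simp: inner_add_left inner_Basis Dj_def Dk_def simp flip: a_def b_def)
  qed (use jk in \<open>simp add: sum.distrib\<close>)
  moreover have "Dj + Dk \<le> - (3 / 2)"
  proof -
    have "b / (a + b) + a / (a + b) = 1"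
      using ab by (simp add: add_divide_distrib[symmetric] add.commute)
    moreover have "Dj = - 2 * (b / (a + b)) + a * b / (a + b)\<^sup>2"
        "Dk = - 2 * (a / (a + b)) + a * b / (a + b)\<^sup>2"
      by (simp_all add: Dj_def Dk_def)
    moreover have "a * b / (a + b)\<^sup>2 \<le> 1 / 4"
    proof -
      have "4 * (a * b) \<le> (a + b)\<^sup>2"
        using zero_le_power2[of "a - b"] by (simp add: power2_eq_square algebra_simps)
      moreover have "0 < (a + b)\<^sup>2"
        using ab by simp
      ultimately show ?thesis by (simp add: divide_le_eq)
    qed
    ultimately show ?thesis by argo
  qed
  ultimately show ?thesis by blast
qed

lemma reflect_commute:
  assumes "j \<in> Basis" "k \<in> Basis"
  shows "reflect j (reflect k y) = reflect k (reflect j y)"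
  by (rule euclidean_eqI) (use assms in \<open>simp add: reflect_inner\<close>)

lemma reflect_eq_self:
  assumes "y \<bullet> k = 0"
  shows "reflect k y = y"
  using assms by (simp add: reflect_def)

text \<open>The antisymmetrisation of \<open>v\<close> in two coordinates vanishes on two faces of a quarter cube, where
  it is compared with a logarithmic barrier; this replaces potential estimates.\<close>

lemma doubly_odd_difference_le:
  fixes v :: "'a::euclidean_space \<Rightarrow> real"
  assumes jk: "j \<in> Basis" "k \<in> Basis" "j \<noteq> k" and F: "0 < F" and M: "0 \<le> M"
    and cont: "continuous_on (cbox (- One) One) v"
    and bound: "\<And>y. y \<in> cbox (- One) One \<Longrightarrow> \<bar>v y\<bar> \<le> M"
    and lip: "\<And>y i. y \<in> cbox (- One) One \<Longrightarrow> i \<in> {j, k} \<Longrightarrow>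
      \<bar>v y - v (reflect i y)\<bar> \<le> 2 * M * \<bar>y \<bullet> i\<bar>"
    and lap: "\<And>y. y \<in> cbox (- One) One \<Longrightarrow> \<exists>L. \<bar>L\<bar> \<le> F \<and> has_laplacian v y L"
    and a: "0 < a" "a \<le> 1" and b: "0 < b" "b \<le> 1"
  shows "(v (a *\<^sub>R j + b *\<^sub>R k) - v (- a *\<^sub>R j + b *\<^sub>R k))
      - (v (a *\<^sub>R j - b *\<^sub>R k) - v (- a *\<^sub>R j - b *\<^sub>R k))
    \<le> 4 * a * b * (2 * (real DIM('a) * M + F) * (ln 4 - ln b) + M)"
proof -
  define B where "B = 2 * (real DIM('a) * M + F)"
  define \<phi> where "\<phi> y = 1 / 4 * ((v y - v (reflect j y)) - (v (reflect k y) - v (reflect j (reflect k y))))" for y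
  define \<psi> where "\<psi> y = M * ((norm y)\<^sup>2 - (y \<bullet> j)\<^sup>2 - (y \<bullet> k)\<^sup>2)
    + B * log_barrier (y \<bullet> j) (y \<bullet> k) + M * ((y \<bullet> j) * (y \<bullet> k))" for y
  define K where "K = cbox (- One) One \<inter> {y. 0 \<le> y \<bullet> j} \<inter> {y. 0 \<le> y \<bullet> k}"
  define S where "S = box (- One) One \<inter> {y. 0 < y \<bullet> j} \<inter> {y. 0 < y \<bullet> k}"
  have B: "0 \<le> B"
    using M F by (simp add: B_def)
  have K_cube: "y \<in> cbox (- One) One" "0 \<le> y \<bullet> j" "y \<bullet> j \<le> 1" "0 \<le> y \<bullet> k" "y \<bullet> k \<le> 1"
    if "y \<in> K" for y
    using that jk by (auto simp: K_def mem_unit_cube abs_le_iff)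
  have \<psi>_ge: "M * (\<Sum>i\<in>J. (y \<bullet> i)\<^sup>2) + M * ((y \<bullet> j) * (y \<bullet> k)) \<le> \<psi> y"
    if "J \<subseteq> Basis - {j, k}" "y \<in> K" for J y
  proof -
    have "finite J"
      using that by (meson finite_Basis finite_Diff finite_subset)
    moreover have "j \<notin> J" "k \<notin> J" "insert j (insert k J) \<subseteq> Basis" using that jk by auto
    ultimately have "M * (\<Sum>i\<in>J. (y \<bullet> i)\<^sup>2) \<le> M * ((norm y)\<^sup>2 - (y \<bullet> j)\<^sup>2 - (y \<bullet> k)\<^sup>2)"
      using inner_power2_le_norm[of "insert j (insert k J)" y] M jk by (intro mult_left_mono) auto
    moreover have "0 \<le> B * log_barrier (y \<bullet> j) (y \<bullet> k)"
      using K_cube[OF that(2)] B by (intro mult_nonneg_nonneg log_barrier_nonneg) auto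
    ultimately show ?thesis by (simp add: \<psi>_def)
  qed
  define x where "x = a *\<^sub>R j + b *\<^sub>R k"
  have x_inner: "x \<bullet> i = (if i = j then a else if i = k then b else 0)" if "i \<in> Basis" for i
    using that jk by (auto simp: x_def inner_add_left inner_Basis)
  then have "x \<in> K"
    using a b jk by (auto simp: K_def mem_unit_cube)
  have "\<phi> x - \<psi> x \<le> 0"
  proof (rule maximum_principle[OF _ _ _ _ _ _ \<open>x \<in> K\<close>])
    show "compact K"
      unfolding K_def
      by (intro compact_Int_closed compact_cbox closed_halfspace_component_ge)
    have "y \<bullet> j + y \<bullet> k \<le> 4" if "y \<in> K" for y
      using K_cube[OF that] by linarith
    then have "continuous_on K (\<lambda>y. log_barrier (fst (y \<bullet> j, y \<bullet> k)) (snd (y \<bullet> j, y \<bullet> k)))"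
      by (intro continuous_on_compose2[OF continuous_on_log_barrier])
        (auto intro!: continuous_intros dest: K_cube)
    moreover have "continuous_on K v" "continuous_on K (\<lambda>y. v (reflect j y))"
        "continuous_on K (\<lambda>y. v (reflect k y))" "continuous_on K (\<lambda>y. v (reflect j (reflect k y)))"
      by (auto intro!: continuous_intros continuous_on_compose2[OF cont]
          continuous_on_compose2[OF continuous_on_reflect] reflect_mem_cube jk dest: K_cube)
    ultimately show "continuous_on K (\<lambda>y. \<phi> y - \<psi> y)"
      unfolding \<phi>_def \<psi>_def by (intro continuous_intros) auto
    show "open S"
      unfolding S_def by (intro open_Int open_box open_halfspace_component_gt)
    show "S \<subseteq> K"
      unfolding S_def K_def using box_subset_cbox by auto
  next
    fix y assume y: "y \<in> K - S"
    then have yK: "y \<in> K" by simp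
    note yc = K_cube(1)[OF yK]
    have M': "0 \<le> M * ((y \<bullet> j) * (y \<bullet> k))"
      using M K_cube[OF yK] by simp
    consider "y \<bullet> j = 0" | "y \<bullet> k = 0" | "y \<bullet> j = 1" | "y \<bullet> k = 1"
      | i where "i \<in> Basis" "i \<noteq> j" "i \<noteq> k" "\<bar>y \<bullet> i\<bar> = 1"
      using y jk unfolding K_def S_def Int_iff Diff_iff mem_unit_box mem_unit_cube
      by (smt (verit) mem_Collect_eq)
    then show "\<phi> y - \<psi> y \<le> 0"
    proof cases
      case 1
      then have "\<phi> y = 0"
        using jk by (simp add: \<phi>_def reflect_commute[of j k] reflect_eq_self)
      then show ?thesis
        using \<psi>_ge[of "{}" y] yK M' by simp
    next
      case 2
      then have "\<phi> y = 0"
        using jk by (simp add: \<phi>_def reflect_eq_self)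
      then show ?thesis
        using \<psi>_ge[of "{}" y] yK M' by simp
    next
      case 3
      have "\<bar>v y - v (reflect k y)\<bar> \<le> 2 * M * (y \<bullet> k)"
        "\<bar>v (reflect j y) - v (reflect k (reflect j y))\<bar> \<le> 2 * M * (y \<bullet> k)"
        using lip[OF yc, of k] lip[OF reflect_mem_cube[OF jk(1) yc], of k] K_cube[OF yK] jk
        by (simp_all add: reflect_inner)
      then have "\<phi> y \<le> M * (y \<bullet> k)"
        unfolding \<phi>_def reflect_commute[OF jk(1,2)] by (simp add: abs_le_iff)
      then show ?thesis
        using \<psi>_ge[of "{}" y] yK 3 by simp
    next
      case 4
      have "\<bar>v y - v (reflect j y)\<bar> \<le> 2 * M * (y \<bullet> j)"
        "\<bar>v (reflect k y) - v (reflect j (reflect k y))\<bar> \<le> 2 * M * (y \<bullet> j)"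
        using lip[OF yc, of j] lip[OF reflect_mem_cube[OF jk(2) yc], of j] K_cube[OF yK] jk
        by (simp_all add: reflect_inner)
      then have "\<phi> y \<le> M * (y \<bullet> j)"
        unfolding \<phi>_def by (simp add: abs_le_iff)
      then show ?thesis
        using \<psi>_ge[of "{}" y] yK 4 by simp
    next
      case 5
      have "1 = (y \<bullet> i)\<^sup>2"
        using 5 by (metis one_power2 power2_abs)
      moreover have "\<phi> y \<le> M"
        using bound[OF yc] bound[OF reflect_mem_cube[OF jk(1) yc]]
          bound[OF reflect_mem_cube[OF jk(2) yc]]
          bound[OF reflect_mem_cube[OF jk(1) reflect_mem_cube[OF jk(2) yc]]]
        unfolding \<phi>_def by (simp add: abs_le_iff)
      ultimately show ?thesis
        using \<psi>_ge[of "{i}" y] yK M' 5 by simp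
    qed
  next
    fix y assume yS: "y \<in> S"
    then have y: "y \<in> cbox (- One) One"
      using box_subset_cbox by (auto simp: S_def)
    obtain L1 L2 L3 L4 where L: "has_laplacian v y L1" "has_laplacian v (reflect j y) L2"
        "has_laplacian v (reflect k y) L3" "has_laplacian v (reflect j (reflect k y)) L4"
      and L_le: "\<bar>L1\<bar> \<le> F" "\<bar>L2\<bar> \<le> F" "\<bar>L3\<bar> \<le> F" "\<bar>L4\<bar> \<le> F"
      using lap[OF y] lap[OF reflect_mem_cube[OF jk(1) y]] lap[OF reflect_mem_cube[OF jk(2) y]]
        lap[OF reflect_mem_cube[OF jk(1) reflect_mem_cube[OF jk(2) y]]] by metis
    obtain l where l: "l \<le> - (3 / 2)" "has_laplacian (\<lambda>y. log_barrier (y \<bullet> j) (y \<bullet> k)) y l"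
      using has_laplacian_log_barrier[OF jk] yS by (auto simp: S_def)
    have nrm: "has_laplacian (\<lambda>y. (norm y)\<^sup>2) y (2 * real DIM('a))"
      using has_laplacian_norm_power2[of 0 y] by simp
    have prod: "has_laplacian (\<lambda>y. (y \<bullet> j) * (y \<bullet> k)) y 0"
      using jk
      by (intro has_laplacian_affine[where A = "\<lambda>i. (y \<bullet> j) * (y \<bullet> k)"
            and B = "\<lambda>i. if i = j then y \<bullet> k else if i = k then y \<bullet> j else 0"])
        (auto simp: inner_add_left inner_Basis algebra_simps)
    have "has_laplacian (\<lambda>y. \<phi> y - \<psi> y) y (1 / 4 * ((L1 - L2) - (L3 - L4)) -
        (M * (2 * real DIM('a) - 2 - 2) + B * l + M * 0))"
      unfolding \<phi>_def \<psi>_def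
      by (intro has_laplacian_diff has_laplacian_add has_laplacian_cmult prod nrm l
          has_laplacian_inner_power2 jk L has_laplacian_reflect[OF jk(1)] has_laplacian_reflect[OF jk(2)]
          has_laplacian_reflect[OF jk(2), of "\<lambda>y. v (reflect j y)"])
    moreover have "0 < 1 / 4 * ((L1 - L2) - (L3 - L4)) -
        (M * (2 * real DIM('a) - 2 - 2) + B * l + M * 0)"
    proof -
      have "B * l \<le> B * (- (3 / 2))"
        using l B by (intro mult_left_mono) auto
      also have "\<dots> = - 3 * (real DIM('a) * M) - 3 * F"
        by (simp add: B_def algebra_simps)
      finally have 1: "B * l \<le> - 3 * (real DIM('a) * M) - 3 * F" .
      have 2: "- F \<le> 1 / 4 * ((L1 - L2) - (L3 - L4))"
        using L_le by (simp add: abs_le_iff)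
      have 3: "M * (2 * real DIM('a) - 2 - 2) \<le> 2 * (real DIM('a) * M)"
        using M by (simp add: algebra_simps)
      have "0 \<le> real DIM('a) * M" using M by simp
      with 1 2 3 F show ?thesis by linarith
    qed
    ultimately show "\<exists>L>0. has_laplacian (\<lambda>y. \<phi> y - \<psi> y) y L"
      by blast
  qed
  moreover have "\<psi> x \<le> a * b * (B * (ln 4 - ln b) + M)"
  proof -
    have "(norm x)\<^sup>2 = a\<^sup>2 + b\<^sup>2"
    proof -
      have "(norm x)\<^sup>2 = (\<Sum>i\<in>Basis. (if i = j then a\<^sup>2 else 0) + (if i = k then b\<^sup>2 else 0))"
        unfolding norm_power2_eq_sum
        by (intro sum.cong refl) (use jk in \<open>auto simp: x_inner\<close>)
      then show ?thesis
        using jk by (simp add: sum.distrib)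
    qed
    then have "\<psi> x = a * b * (B * (ln 4 - ln (a + b)) + M)"
      using jk by (simp add: \<psi>_def x_inner log_barrier_def algebra_simps)
    also have "\<dots> \<le> a * b * (B * (ln 4 - ln b) + M)"
      using a b B by (intro mult_left_mono add_right_mono diff_left_mono) auto
    finally show ?thesis .
  qed
  ultimately have "\<phi> x \<le> a * b * (B * (ln 4 - ln b) + M)"
    by simp
  moreover have "reflect j x = - a *\<^sub>R j + b *\<^sub>R k" "reflect k x = a *\<^sub>R j - b *\<^sub>R k"
      "reflect j (reflect k x) = - a *\<^sub>R j - b *\<^sub>R k"
    using jk by (auto intro!: euclidean_eqI[where 'a = 'a]
        simp: reflect_inner x_inner inner_add_left inner_diff_left inner_Basis)
  ultimately have "1 / 4 * ((v x - v (- a *\<^sub>R j + b *\<^sub>R k))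
      - (v (a *\<^sub>R j - b *\<^sub>R k) - v (- a *\<^sub>R j - b *\<^sub>R k))) \<le> a * b * (B * (ln 4 - ln b) + M)"
    by (simp only: \<phi>_def)
  moreover have "X \<le> 4 * a * b * Y" if "1 / 4 * X \<le> a * b * Y" for X Y :: real
    using that by linarith
  ultimately show ?thesis
    unfolding x_def B_def by blast
qed

section \<open>Mixed derivatives\<close>

lemma mixed_derivative_estimate:
  fixes v :: "'a::euclidean_space \<Rightarrow> real"
  assumes jk: "j \<in> Basis" "k \<in> Basis" "j \<noteq> k" and F: "0 < F" and M: "0 \<le> M"
    and cont: "continuous_on (cbox (x - One) (x + One)) v"
    and bound: "\<And>y. y \<in> cbox (x - One) (x + One) \<Longrightarrow> \<bar>v y\<bar> \<le> M"
    and lip: "\<And>y i t. y \<in> cbox (x - One) (x + One) \<Longrightarrow> i \<in> {j, k} \<Longrightarrow>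
      y + t *\<^sub>R i \<in> cbox (x - One) (x + One) \<Longrightarrow> \<bar>v y - v (y + t *\<^sub>R i)\<bar> \<le> M * \<bar>t\<bar>"
    and lap: "\<And>y. y \<in> cbox (x - One) (x + One) \<Longrightarrow> \<exists>L. \<bar>L\<bar> \<le> F \<and> has_laplacian v y L"
    and b: "0 < b" "b \<le> 1"
    and d1: "((\<lambda>t. v (x + b *\<^sub>R k + t *\<^sub>R j)) has_real_derivative d1) (at 0)"
    and d2: "((\<lambda>t. v (x - b *\<^sub>R k + t *\<^sub>R j)) has_real_derivative d2) (at 0)"
  shows "\<bar>d1 - d2\<bar> \<le> 2 * b * (2 * (real DIM('a) * M + F) * (ln 4 - ln b) + M)"
proof -
  define w where "w y = v (y + x)" for y
  define C where "C = 2 * (real DIM('a) * M + F) * (ln 4 - ln b) + M"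
  have mem: "y + x \<in> cbox (x - One) (x + One)" if "y \<in> cbox (- One) One" for y
    using that by (auto simp: mem_box inner_diff_left inner_add_left)
  have w: "continuous_on (cbox (- One) One) w"
    unfolding w_def by (intro continuous_on_compose2[OF cont] continuous_intros) (use mem in auto)
  have wb: "\<bar>w y\<bar> \<le> M" if "y \<in> cbox (- One) One" for y
    using bound[OF mem[OF that]] by (simp add: w_def)
  have wl: "\<exists>L. \<bar>L\<bar> \<le> F \<and> has_laplacian w y L" if "y \<in> cbox (- One) One" for y
    using lap[OF mem[OF that]] unfolding w_def by (blast intro: has_laplacian_shift)
  have wlip: "\<bar>w y - w (reflect i y)\<bar> \<le> 2 * M * \<bar>y \<bullet> i\<bar>"
    if "y \<in> cbox (- One) One" "i \<in> {j, k}" for y i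
  proof -
    have "i \<in> Basis" using that jk by auto
    have eq: "y + x + (- (2 * (y \<bullet> i))) *\<^sub>R i = reflect i y + x"
      by (simp add: reflect_def)
    show ?thesis
      using lip[OF mem[OF that(1)] that(2), of "- (2 * (y \<bullet> i))", unfolded eq,
          OF mem[OF reflect_mem_cube[OF \<open>i \<in> Basis\<close> that(1)]]]
      by (simp add: w_def abs_mult)
  qed
  define Q where "Q a = (w (a *\<^sub>R j + b *\<^sub>R k) - w (- a *\<^sub>R j + b *\<^sub>R k))
      - (w (a *\<^sub>R j - b *\<^sub>R k) - w (- a *\<^sub>R j - b *\<^sub>R k))" for a
  have up: "Q a \<le> 4 * a * b * C" if "0 < a" "a \<le> 1" for a
    unfolding Q_def C_def
    by (rule doubly_odd_difference_le[OF jk F M w wb wlip wl that b])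
  have neg: "(- w (a *\<^sub>R j + b *\<^sub>R k) - - w (- a *\<^sub>R j + b *\<^sub>R k))
      - (- w (a *\<^sub>R j - b *\<^sub>R k) - - w (- a *\<^sub>R j - b *\<^sub>R k)) \<le> 4 * a * b * C"
    if "0 < a" "a \<le> 1" for a
    unfolding C_def
  proof (rule doubly_odd_difference_le[OF jk F M _ _ _ _ that b, of "\<lambda>y. - w y"])
    show "continuous_on (cbox (- One) One) (\<lambda>y. - w y)"
      by (intro continuous_intros w)
    show "\<bar>- w y\<bar> \<le> M" if "y \<in> cbox (- One) One" for y
      using wb[OF that] by simp
    show "\<bar>- w y - - w (reflect i y)\<bar> \<le> 2 * M * \<bar>y \<bullet> i\<bar>"
      if "y \<in> cbox (- One) One" "i \<in> {j, k}" for y i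
      using wlip[OF that] by (simp add: abs_minus_commute)
    show "\<exists>L. \<bar>L\<bar> \<le> F \<and> has_laplacian (\<lambda>y. - w y) y L" if "y \<in> cbox (- One) One" for y
      using wl[OF that] has_laplacian_minus by (metis abs_minus_cancel)
  qed
  have lo: "- Q a \<le> 4 * a * b * C" if "0 < a" "a \<le> 1" for a
    unfolding Q_def using neg[OF that] by linarith
  have "((\<lambda>a. (v (x + b *\<^sub>R k + a *\<^sub>R j) - v (x + b *\<^sub>R k + (- a) *\<^sub>R j)) / (2 * a)
      - (v (x - b *\<^sub>R k + a *\<^sub>R j) - v (x - b *\<^sub>R k + (- a) *\<^sub>R j)) / (2 * a)) \<longlongrightarrow> d1 - d2)
      (at_right 0)"
    by (intro tendsto_diff symmetric_difference_quotient[OF d1] symmetric_difference_quotient[OF d2])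
  moreover have "(v (x + b *\<^sub>R k + a *\<^sub>R j) - v (x + b *\<^sub>R k + (- a) *\<^sub>R j)) / (2 * a)
      - (v (x - b *\<^sub>R k + a *\<^sub>R j) - v (x - b *\<^sub>R k + (- a) *\<^sub>R j)) / (2 * a) = Q a / (2 * a)" for a
    unfolding Q_def w_def diff_divide_distrib[symmetric] by (simp add: algebra_simps)
  ultimately have "((\<lambda>a. Q a / (2 * a)) \<longlongrightarrow> d1 - d2) (at_right 0)"
    by simp
  moreover have "\<forall>\<^sub>F a in at_right 0. \<bar>Q a / (2 * a)\<bar> \<le> 2 * b * C"
  proof -
    have "\<forall>\<^sub>F a in at_right 0. a \<in> {0<..<1::real}"
      by (rule eventually_at_right_real) simp
    then show ?thesis
    proof eventually_elim
      case (elim a)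
      then have "\<bar>Q a\<bar> \<le> 4 * a * b * C"
        using up[of a] lo[of a] by auto
      with elim show ?case by (simp add: abs_divide divide_le_eq algebra_simps)
    qed
  qed
  ultimately show ?thesis
    unfolding C_def[symmetric] by (intro tendsto_upperbound[OF tendsto_rabs]) auto
qed

lemma log_modulus_le_powr:
  fixes b \<beta> :: real
  assumes b: "0 < b" "b \<le> 1" and \<beta>: "\<beta> < 1"
  shows "b * (ln 4 - ln b) \<le> 4 powr (1 - \<beta>) / (1 - \<beta>) * b powr \<beta>"
proof -
  have "ln 4 - ln b = ln (4 / b)"
    using b by (simp add: ln_div)
  also have "\<dots> \<le> (4 / b) powr (1 - \<beta>) / (1 - \<beta>)"
    using b \<beta> by (intro ln_powr_bound) (auto simp: field_simps)
  also have "\<dots> = 4 powr (1 - \<beta>) / (1 - \<beta>) * b powr (\<beta> - 1)"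
    using b powr_minus_divide[of b "1 - \<beta>"] by (simp add: powr_divide)
  finally have "b * (ln 4 - ln b) \<le> b * (4 powr (1 - \<beta>) / (1 - \<beta>) * b powr (\<beta> - 1))"
    using b by (intro mult_left_mono) auto
  also have "\<dots> = 4 powr (1 - \<beta>) / (1 - \<beta>) * (b powr 1 * b powr (\<beta> - 1))"
    using b by simp
  also have "\<dots> = 4 powr (1 - \<beta>) / (1 - \<beta>) * b powr \<beta>"
    unfolding powr_add[symmetric] by simp
  finally show ?thesis .
qed

lemma coordinatewise_oscillation:
  fixes g :: "'a::euclidean_space \<Rightarrow> real"
  assumes step: "\<And>p t k. k \<in> Basis \<Longrightarrow> c \<le> p \<bullet> e \<Longrightarrow> c \<le> (p + t *\<^sub>R k) \<bullet> e \<Longrightarrow> \<bar>t\<bar> \<le> r \<Longrightarrow>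
      \<bar>g (p + t *\<^sub>R k) - g p\<bar> \<le> W"
    and e: "e \<in> Basis" and p: "c \<le> p \<bullet> e" and q: "c \<le> q \<bullet> e" and r: "norm (q - p) \<le> r"
  shows "\<bar>g q - g p\<bar> \<le> real DIM('a) * W"
proof -
  define m where "m J = p + (\<Sum>i\<in>J. ((q - p) \<bullet> i) *\<^sub>R i)" for J
  have m_e: "c \<le> m J \<bullet> e" if "finite J" "J \<subseteq> Basis" for J
  proof -
    have "(\<Sum>i\<in>J. ((q - p) \<bullet> i) *\<^sub>R i) \<bullet> e = (\<Sum>i\<in>J. if i = e then (q - p) \<bullet> e else 0)"
      unfolding inner_sum_left
      by (intro sum.cong refl) (use that e in \<open>auto simp: inner_Basis subset_iff\<close>)
    also have "\<dots> = (if e \<in> J then (q - p) \<bullet> e else 0)"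
      using that by simp
    finally show ?thesis
      using p q by (simp add: m_def inner_add_left inner_diff_left)
  qed
  have "\<bar>g (m J) - g p\<bar> \<le> real (card J) * W" if "finite J" "J \<subseteq> Basis" for J
    using that
  proof (induction J rule: finite_induct)
    case (insert k J)
    have m: "m (insert k J) = m J + ((q - p) \<bullet> k) *\<^sub>R k"
      using insert.hyps by (simp add: m_def algebra_simps)
    have "\<bar>(q - p) \<bullet> k\<bar> \<le> r"
      using Basis_le_norm[of k "q - p"] insert.prems r by auto
    then have "\<bar>g (m (insert k J)) - g (m J)\<bar> \<le> W"
      using step[of k "m J" "(q - p) \<bullet> k"] m_e[of J] m_e[of "insert k J"] insert m by simp
    moreover have "real (card (insert k J)) * W = real (card J) * W + W"
      using insert.hyps by (simp add: algebra_simps)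
    ultimately show ?case
      using insert.IH insert.prems by auto
  qed (simp add: m_def)
  from this[of Basis] have "\<bar>g (m Basis) - g p\<bar> \<le> real DIM('a) * W"
    by simp
  moreover have "m Basis = q"
    by (simp add: m_def euclidean_representation)
  ultimately show ?thesis by simp
qed

lemma differentiable_on_line_derivative:
  fixes w :: "'a::euclidean_space \<Rightarrow> real"
  assumes "w differentiable_on S" "open S" "x + t *\<^sub>R i \<in> S"
  shows "((\<lambda>s. w (x + s *\<^sub>R i)) has_real_derivative partial_deriv i w (x + t *\<^sub>R i)) (at t)"
proof -
  have diff: "w differentiable at (x + t *\<^sub>R i)"
    using assms by (meson differentiable_on_eq_differentiable_at)
  then have "(w has_derivative frechet_derivative w (at (x + t *\<^sub>R i))) (at (x + t *\<^sub>R i))"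
    by (simp add: frechet_derivative_works)
  then have D: "((\<lambda>s. w (x + s *\<^sub>R i)) has_derivative
      (\<lambda>s. frechet_derivative w (at (x + t *\<^sub>R i)) (s *\<^sub>R i))) (at t)"
    by (intro has_derivative_compose[of "\<lambda>s. x + s *\<^sub>R i" _ _ _ w])
      (auto intro!: derivative_eq_intros)
  interpret linear "frechet_derivative w (at (x + t *\<^sub>R i))"
    using diff by (rule linear_frechet_derivative)
  show ?thesis
    using D by (simp add: has_field_derivative_def scaleR partial_deriv_def
        mult.commute[of _ "frechet_derivative _ _ _"])
qed

lemma C2_on_line_derivative:
  assumes "C2_on S u" "open S" "x + t *\<^sub>R i \<in> S"
  shows "((\<lambda>s. u (x + s *\<^sub>R i)) has_real_derivative partial_deriv i u (x + t *\<^sub>R i)) (at t)"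
  using assms by (intro differentiable_on_line_derivative) (auto simp: C2_on_def)

lemma C2_on_second_line_derivative:
  assumes "C2_on S u" "open S" "i \<in> Basis" "x + t *\<^sub>R j \<in> S"
  shows "((\<lambda>s. partial_deriv i u (x + s *\<^sub>R j)) has_real_derivative
      partial_deriv j (partial_deriv i u) (x + t *\<^sub>R j)) (at t)"
  using assms by (intro differentiable_on_line_derivative) (auto simp: C2_on_def)

lemma C2_on_has_laplacian:
  assumes u: "C2_on S u" and S: "open S" "x \<in> S"
  shows "has_laplacian u x (laplacian u x)"
proof (rule has_laplacianI)
  fix i :: 'a assume i: "i \<in> Basis"
  have "filterlim (\<lambda>t. x + t *\<^sub>R i) (nhds (x + 0 *\<^sub>R i)) (nhds 0)"
    by (intro tendsto_intros filterlim_ident)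
  then have lim: "filterlim (\<lambda>t. x + t *\<^sub>R i) (nhds x) (nhds 0)"
    by simp
  have "\<forall>\<^sub>F t in nhds 0. x + t *\<^sub>R i \<in> S"
    using eventually_compose_filterlim[OF eventually_nhds_in_open[OF S] lim] .
  then have "\<forall>\<^sub>F t in nhds 0. ((\<lambda>t. u (x + t *\<^sub>R i)) has_real_derivative
      partial_deriv i u (x + t *\<^sub>R i)) (at t)"
    by eventually_elim (rule C2_on_line_derivative[OF u S(1)])
  moreover have "((\<lambda>t. partial_deriv i u (x + t *\<^sub>R i)) has_real_derivative
      partial_deriv i (partial_deriv i u) x) (at 0)"
    using C2_on_second_line_derivative[OF u S(1) i, of x 0 i] S(2) by simp
  ultimately show "has_second_deriv (\<lambda>t. u (x + t *\<^sub>R i)) (partial_deriv i (partial_deriv i u) x)"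
    by (rule has_second_derivI)
qed (simp add: laplacian_def)

lemma C2_on_second_difference:
  assumes u: "C2_on S u" "open S" and ij: "i \<in> Basis" "j \<in> Basis"
    and r: "ball x r \<subseteq> S" and h: "0 < h" "2 * h < r"
  shows "\<exists>y\<in>ball x r. u (x + h *\<^sub>R i + h *\<^sub>R j) - u (x + h *\<^sub>R i) - u (x + h *\<^sub>R j) + u x
    = h * h * partial_deriv j (partial_deriv i u) y"
proof -
  have mem: "x + s *\<^sub>R i + t *\<^sub>R j \<in> ball x r" if "0 \<le> s" "s \<le> h" "0 \<le> t" "t \<le> h" for s t
  proof -
    have "norm (s *\<^sub>R i + t *\<^sub>R j) \<le> \<bar>s\<bar> + \<bar>t\<bar>"
      using norm_triangle_ineq[of "s *\<^sub>R i" "t *\<^sub>R j"] ij by simp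
    also have "\<dots> < r" using that h by simp
    finally have "dist x (x + (s *\<^sub>R i + t *\<^sub>R j)) < r"
      by (simp only: dist_norm norm_minus_commute[of x] add_diff_cancel_left')
    then show ?thesis by (simp add: add.assoc)
  qed
  then have memS: "x + s *\<^sub>R i + t *\<^sub>R j \<in> S" if "0 \<le> s" "s \<le> h" "0 \<le> t" "t \<le> h" for s t
    using that r by blast
  define f where "f s = u (x + h *\<^sub>R j + s *\<^sub>R i) - u (x + s *\<^sub>R i)" for s
  have "(f has_real_derivative partial_deriv i u (x + h *\<^sub>R j + s *\<^sub>R i) - partial_deriv i u (x + s *\<^sub>R i)) (at s)"
    if "0 \<le> s" "s \<le> h" for s
    unfolding f_def using memS[of s h] memS[of s 0] that h
    by (intro DERIV_diff C2_on_line_derivative[OF u]) (simp_all add: ac_simps)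
  then obtain s where s: "0 < s" "s < h"
      "f h - f 0 = (h - 0) * (partial_deriv i u (x + h *\<^sub>R j + s *\<^sub>R i) - partial_deriv i u (x + s *\<^sub>R i))"
    using MVT2[OF h(1), of f "\<lambda>s. partial_deriv i u (x + h *\<^sub>R j + s *\<^sub>R i) - partial_deriv i u (x + s *\<^sub>R i)"] by metis
  have "((\<lambda>t. partial_deriv i u (x + s *\<^sub>R i + t *\<^sub>R j)) has_real_derivative
      partial_deriv j (partial_deriv i u) (x + s *\<^sub>R i + t *\<^sub>R j)) (at t)"
    if "0 \<le> t" "t \<le> h" for t
    using memS[of s t] s that ij by (intro C2_on_second_line_derivative[OF u]) auto
  then obtain t where t: "0 < t" "t < h"
      "partial_deriv i u (x + s *\<^sub>R i + h *\<^sub>R j) - partial_deriv i u (x + s *\<^sub>R i + 0 *\<^sub>R j)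
       = (h - 0) * partial_deriv j (partial_deriv i u) (x + s *\<^sub>R i + t *\<^sub>R j)"
    using MVT2[OF h(1), of "\<lambda>t. partial_deriv i u (x + s *\<^sub>R i + t *\<^sub>R j)"
        "\<lambda>t. partial_deriv j (partial_deriv i u) (x + s *\<^sub>R i + t *\<^sub>R j)"] by metis
  have eq1: "x + h *\<^sub>R j + s *\<^sub>R i = x + s *\<^sub>R i + h *\<^sub>R j"
    and eq2: "x + h *\<^sub>R j + h *\<^sub>R i = x + h *\<^sub>R i + h *\<^sub>R j"
    by (simp_all add: ac_simps)
  have "u (x + h *\<^sub>R i + h *\<^sub>R j) - u (x + h *\<^sub>R i) - u (x + h *\<^sub>R j) + u x
      = h * h * partial_deriv j (partial_deriv i u) (x + s *\<^sub>R i + t *\<^sub>R j)"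
    using s(3)[unfolded f_def eq1 eq2] t(3) by (simp add: mult.assoc)
  then show ?thesis
    using mem[of s t] s t by auto
qed

lemma C2_on_symmetric:
  assumes u: "C2_on S u" and S: "open S" "x \<in> S" and ij: "i \<in> Basis" "j \<in> Basis"
  shows "partial_deriv j (partial_deriv i u) x = partial_deriv i (partial_deriv j u) x"
proof (rule ccontr)
  define A B where "A = partial_deriv j (partial_deriv i u)" and "B = partial_deriv i (partial_deriv j u)"
  assume neq: "\<not> ?thesis"
  define \<delta> where "\<delta> = \<bar>A x - B x\<bar> / 2"
  have \<delta>: "\<delta> > 0"
    using neq by (simp add: \<delta>_def A_def B_def)
  have "isCont A x" "isCont B x"
    using u ij S continuous_on_eq_continuous_at[OF S(1)] by (auto simp: C2_on_def A_def B_def)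
  then obtain r1 r2 where r12: "r1 > 0" "\<And>y. dist y x < r1 \<Longrightarrow> dist (A y) (A x) < \<delta>"
      "r2 > 0" "\<And>y. dist y x < r2 \<Longrightarrow> dist (B y) (B x) < \<delta>"
    using \<delta> unfolding continuous_at_eps_delta by metis
  obtain r3 where r3: "r3 > 0" "ball x r3 \<subseteq> S"
    using S open_contains_ball by blast
  define r where "r = min r1 (min r2 r3)"
  have r: "r > 0" "ball x r \<subseteq> S" "r \<le> r1" "r \<le> r2"
    using r12 r3 by (auto simp: r_def)
  define h where "h = r / 3"
  have h: "0 < h" "2 * h < r"
    using r by (auto simp: h_def)
  obtain y where y: "y \<in> ball x r"
      "u (x + h *\<^sub>R i + h *\<^sub>R j) - u (x + h *\<^sub>R i) - u (x + h *\<^sub>R j) + u x = h * h * A y"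
    using C2_on_second_difference[OF u S(1) ij r(2) h] unfolding A_def by blast
  obtain y' where y': "y' \<in> ball x r"
      "u (x + h *\<^sub>R j + h *\<^sub>R i) - u (x + h *\<^sub>R j) - u (x + h *\<^sub>R i) + u x = h * h * B y'"
    using C2_on_second_difference[OF u S(1) ij(2,1) r(2) h] unfolding B_def by blast
  have eq: "x + h *\<^sub>R j + h *\<^sub>R i = x + h *\<^sub>R i + h *\<^sub>R j"
    by (simp add: ac_simps)
  have "h * h * A y = h * h * B y'"
    using y(2) y'(2)[unfolded eq] by linarith
  then have "A y = B y'"
    using h by simp
  moreover have "dist (A y) (A x) < \<delta>" "dist (B y') (B x) < \<delta>"
    using r12(2)[of y] r12(4)[of y'] y(1) y'(1) r(3,4) by (simp_all add: dist_commute)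
  ultimately show False
    unfolding \<delta>_def dist_real_def by (simp add: abs_if split: if_splits)
qed

lemma line_lipschitz:
  fixes w :: "'a::euclidean_space \<Rightarrow> real"
  assumes D: "\<And>x. c \<le> x \<bullet> e \<Longrightarrow> ((\<lambda>t. w (x + t *\<^sub>R i)) has_real_derivative g x) (at 0)"
    and B: "\<And>x. c \<le> x \<bullet> e \<Longrightarrow> \<bar>g x\<bar> \<le> B"
    and y: "c \<le> y \<bullet> e" "c \<le> (y + t *\<^sub>R i) \<bullet> e"
  shows "\<bar>w (y + t *\<^sub>R i) - w y\<bar> \<le> B * \<bar>t\<bar>"
proof -
  have "norm (w (y + t *\<^sub>R i) - w (y + 0 *\<^sub>R i)) \<le> B * norm (t - 0)"
  proof (rule field_differentiable_bound[of "closed_segment 0 t" "\<lambda>s. w (y + s *\<^sub>R i)" "\<lambda>s. g (y + s *\<^sub>R i)"])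
    fix s assume "s \<in> closed_segment 0 t"
    then obtain \<theta> where \<theta>: "0 \<le> \<theta>" "\<theta> \<le> 1" "s = \<theta> * t"
      by (auto simp: in_segment)
    have "c = (1 - \<theta>) * c + \<theta> * c"
      by (simp add: algebra_simps)
    also have "\<dots> \<le> (1 - \<theta>) * (y \<bullet> e) + \<theta> * ((y + t *\<^sub>R i) \<bullet> e)"
      using \<theta> y by (intro add_mono mult_left_mono) auto
    also have "\<dots> = (y + s *\<^sub>R i) \<bullet> e"
      by (simp add: \<theta>(3) inner_add_left algebra_simps)
    finally have s: "c \<le> (y + s *\<^sub>R i) \<bullet> e" .
    show "norm (g (y + s *\<^sub>R i)) \<le> B"
      using B[OF s] by simp
    have "((\<lambda>r. w (y + s *\<^sub>R i + r *\<^sub>R i)) has_real_derivative g (y + s *\<^sub>R i)) (at (s + - s))"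
      using D[OF s] by simp
    then have "((\<lambda>r. w (y + s *\<^sub>R i + (r + - s) *\<^sub>R i)) has_real_derivative g (y + s *\<^sub>R i)) (at s)"
      by (rule DERIV_shift[THEN iffD1])
    moreover have "(\<lambda>r. w (y + s *\<^sub>R i + (r + - s) *\<^sub>R i)) = (\<lambda>r. w (y + r *\<^sub>R i))"
      by (simp add: scaleR_left_diff_distrib)
    ultimately show "((\<lambda>s. w (y + s *\<^sub>R i)) has_real_derivative g (y + s *\<^sub>R i)) (at s within closed_segment 0 t)"
      by (simp only: has_field_derivative_at_within)
  qed auto
  then show ?thesis by simp
qed

section \<open>Schauder estimates in a half space\<close>

lemma inner_cube_ge:
  fixes x :: "'a::euclidean_space"
  assumes "e \<in> Basis" "y \<in> cbox (x - One) (x + One)" "c + 1 \<le> x \<bullet> e"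
  shows "c \<le> y \<bullet> e"
proof -
  have "(x - One) \<bullet> e \<le> y \<bullet> e"
    using assms(1,2) unfolding mem_box by blast
  then show ?thesis
    using assms by (simp add: inner_diff_left)
qed

text \<open>Only the Lipschitz dependence of the Laplacian on \<open>u\<close> itself is assumed, so that the estimates
  below are linear in the smallness parameter \<open>\<epsilon>\<close>.\<close>

locale half_space_poisson =
  fixes e :: "'a::euclidean_space" and u :: "'a \<Rightarrow> real" and z c \<epsilon> L :: real
  assumes e: "e \<in> Basis"
    and C2: "C2_on {x. 0 < x \<bullet> e} u"
    and pos: "0 < c" "0 < \<epsilon>" "0 < L"
    and u_near: "\<And>x. c \<le> x \<bullet> e \<Longrightarrow> \<bar>u x - z\<bar> \<le> \<epsilon>"
    and lap_le: "\<And>x. c \<le> x \<bullet> e \<Longrightarrow> \<bar>laplacian u x\<bar> \<le> L * \<epsilon>"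
    and lap_lipschitz: "\<And>x y. c \<le> x \<bullet> e \<Longrightarrow> c \<le> y \<bullet> e \<Longrightarrow>
      \<bar>laplacian u x - laplacian u y\<bar> \<le> L * \<bar>u x - u y\<bar>"
begin

abbreviation "D i \<equiv> partial_deriv i u"

abbreviation "DD i j \<equiv> partial_deriv j (partial_deriv i u)"

definition C :: real where "C = real DIM('a) + L"

lemma C_ge: "1 \<le> C" "real DIM('a) \<le> C" "L \<le> C"
  using pos DIM_positive[where 'a = 'a] unfolding C_def by linarith+

lemma open_half: "open {x. 0 < x \<bullet> e}"
  by (rule open_halfspace_component_gt)

lemma u_line_derivative:
  assumes "0 < x \<bullet> e"
  shows "((\<lambda>t. u (x + t *\<^sub>R i)) has_real_derivative D i x) (at 0)"
  using C2_on_line_derivative[OF C2 open_half, of x 0 i] assms by simp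

lemma D_line_derivative:
  assumes "0 < x \<bullet> e" "i \<in> Basis"
  shows "((\<lambda>t. D i (x + t *\<^sub>R j)) has_real_derivative DD i j x) (at 0)"
  using C2_on_second_line_derivative[OF C2 open_half assms(2), of x 0 j] assms by simp

lemma u_laplacian: "0 < x \<bullet> e \<Longrightarrow> has_laplacian u x (laplacian u x)"
  by (rule C2_on_has_laplacian[OF C2 open_half]) simp

lemma continuous_u: "continuous_on {x. 0 < x \<bullet> e} u"
  using C2 by (simp add: C2_on_def differentiable_imp_continuous_on)

lemma D_bound:
  assumes i: "i \<in> Basis" and x: "c + 1 \<le> x \<bullet> e"
  shows "\<bar>D i x\<bar> \<le> C * \<epsilon>"
proof -
  have cube: "c \<le> y \<bullet> e" if "y \<in> cbox (x - One) (x + One)" for y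
    using inner_cube_ge[OF e that x] .
  have "\<bar>D i x\<bar> \<le> real DIM('a) * \<epsilon> + L * \<epsilon>"
  proof (rule gradient_estimate[OF i, of _ _ x "\<lambda>y. u y - z"])
    show "continuous_on (cbox (x - One) (x + One)) (\<lambda>y. u y - z)"
      by (intro continuous_intros continuous_on_subset[OF continuous_u]) (use cube pos in force)
    show "\<bar>u y - z\<bar> \<le> \<epsilon>" if "y \<in> cbox (x - One) (x + One)" for y
      using u_near[OF cube[OF that]] .
    show "\<exists>l. \<bar>l\<bar> \<le> L * \<epsilon> \<and> has_laplacian (\<lambda>y. u y - z) y l"
      if "y \<in> cbox (x - One) (x + One)" for y
      using has_laplacian_diff[OF u_laplacian has_laplacian_const, of y z] lap_le[OF cube[OF that]]
        cube[OF that] pos by auto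
    have "((\<lambda>t. u (x + t *\<^sub>R i) - z) has_real_derivative D i x - 0) (at 0)"
      using x pos by (intro DERIV_diff u_line_derivative DERIV_const) auto
    then show "((\<lambda>t. u (x + t *\<^sub>R i) - z) has_real_derivative D i x) (at 0)"
      by simp
  qed (use pos in auto)
  then show ?thesis by (simp add: C_def algebra_simps)
qed

lemma u_lipschitz:
  assumes "i \<in> Basis" "c + 1 \<le> y \<bullet> e" "c + 1 \<le> (y + t *\<^sub>R i) \<bullet> e"
  shows "\<bar>u (y + t *\<^sub>R i) - u y\<bar> \<le> C * \<epsilon> * \<bar>t\<bar>"
  by (rule line_lipschitz[of "c + 1" e u i "D i"])
    (use assms D_bound u_line_derivative pos in auto)

definition diff_quot :: "real \<Rightarrow> 'a \<Rightarrow> 'a \<Rightarrow> real" where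
  "diff_quot h i x = (u (x + h *\<^sub>R i) - u x) / h"

lemma inner_step_ge:
  assumes "i \<in> Basis" "0 < h" "d \<le> x \<bullet> e"
  shows "d \<le> (x + h *\<^sub>R i) \<bullet> e"
  using assms e by (simp add: inner_add_left inner_Basis)

context
  fixes h :: real and i :: 'a
  assumes h: "0 < h" and i: "i \<in> Basis"
begin

lemma diff_quot_bound:
  assumes "c + 1 \<le> x \<bullet> e"
  shows "\<bar>diff_quot h i x\<bar> \<le> C * \<epsilon>"
  using u_lipschitz[OF i assms inner_step_ge[OF i h assms]] h
  by (simp add: diff_quot_def abs_divide divide_le_eq)

lemma diff_quot_laplacian:
  assumes x: "c + 1 \<le> x \<bullet> e"
  shows "\<exists>l. \<bar>l\<bar> \<le> L * (C * \<epsilon>) \<and> has_laplacian (diff_quot h i) x l"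
proof -
  note xh = inner_step_ge[OF i h x]
  define l where "l = 1 / h * (laplacian u (x + h *\<^sub>R i) - laplacian u x)"
  have "has_laplacian (\<lambda>x. 1 / h * (u (x + h *\<^sub>R i) - u x)) x l"
    unfolding l_def using x xh pos
    by (intro has_laplacian_cmult has_laplacian_diff has_laplacian_shift u_laplacian) auto
  then have "has_laplacian (diff_quot h i) x l"
    by (simp add: diff_quot_def[abs_def])
  moreover have "\<bar>l\<bar> \<le> L * (C * \<epsilon>)"
  proof -
    have "\<bar>laplacian u (x + h *\<^sub>R i) - laplacian u x\<bar> \<le> L * \<bar>u (x + h *\<^sub>R i) - u x\<bar>"
      using x xh by (intro lap_lipschitz) auto
    also have "\<dots> \<le> L * (C * \<epsilon> * \<bar>h\<bar>)"
      using u_lipschitz[OF i x xh] pos by (intro mult_left_mono) auto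
    finally show ?thesis
      using h by (simp add: l_def abs_mult abs_divide divide_le_eq mult.assoc)
  qed
  ultimately show ?thesis by blast
qed

lemma diff_quot_continuous: "continuous_on {x. 0 < x \<bullet> e} (diff_quot h i)"
  unfolding diff_quot_def
  by (intro continuous_intros continuous_u continuous_on_compose2[OF continuous_u])
    (use h i e in \<open>auto simp: inner_add_left inner_Basis\<close>)

lemma diff_quot_line_derivative:
  assumes "0 < x \<bullet> e"
  shows "((\<lambda>t. diff_quot h i (x + t *\<^sub>R j)) has_real_derivative (D j (x + h *\<^sub>R i) - D j x) / h) (at 0)"
proof -
  have "0 < (x + h *\<^sub>R i) \<bullet> e"
    using assms h i e by (simp add: inner_add_left inner_Basis)
  then have 1: "((\<lambda>t. u (x + h *\<^sub>R i + t *\<^sub>R j)) has_real_derivative D j (x + h *\<^sub>R i)) (at 0)"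
    by (rule u_line_derivative)
  have eq: "x + h *\<^sub>R i + t *\<^sub>R j = x + t *\<^sub>R j + h *\<^sub>R i" for t
    by (simp add: ac_simps)
  show ?thesis
    unfolding diff_quot_def
    using 1[unfolded eq] assms by (intro DERIV_cdivide DERIV_diff u_line_derivative)
qed

lemma D_diff_quot_bound:
  assumes j: "j \<in> Basis" and x: "c + 2 \<le> x \<bullet> e"
  shows "\<bar>(D j (x + h *\<^sub>R i) - D j x) / h\<bar> \<le> C\<^sup>2 * \<epsilon>"
proof -
  have cube: "c + 1 \<le> y \<bullet> e" if "y \<in> cbox (x - One) (x + One)" for y
    using inner_cube_ge[OF e that, of "c + 1"] x by simp
  have "\<bar>(D j (x + h *\<^sub>R i) - D j x) / h\<bar> \<le> real DIM('a) * (C * \<epsilon>) + L * (C * \<epsilon>)"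
  proof (rule gradient_estimate[OF j, of _ _ x "diff_quot h i"])
    show "continuous_on (cbox (x - One) (x + One)) (diff_quot h i)"
      by (rule continuous_on_subset[OF diff_quot_continuous]) (use cube pos in force)
    show "\<exists>l. \<bar>l\<bar> \<le> L * (C * \<epsilon>) \<and> has_laplacian (diff_quot h i) y l"
      if "y \<in> cbox (x - One) (x + One)" for y
      using diff_quot_laplacian[OF cube[OF that]] .
    show "((\<lambda>t. diff_quot h i (x + t *\<^sub>R j)) has_real_derivative (D j (x + h *\<^sub>R i) - D j x) / h) (at 0)"
      using x pos by (intro diff_quot_line_derivative) auto
  qed (use pos C_ge cube diff_quot_bound in auto)
  also have "\<dots> = C\<^sup>2 * \<epsilon>"
    by (simp add: C_def power2_eq_square algebra_simps)
  finally show ?thesis .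
qed

lemma D_diff_quot_oscillation:
  assumes jk: "j \<in> Basis" "k \<in> Basis" "j \<noteq> k" and x: "c + 3 \<le> x \<bullet> e" and b: "0 < b" "b \<le> 1"
  shows "\<bar>(D j (x + b *\<^sub>R k + h *\<^sub>R i) - D j (x + b *\<^sub>R k)) / h
      - (D j (x - b *\<^sub>R k + h *\<^sub>R i) - D j (x - b *\<^sub>R k)) / h\<bar>
    \<le> 2 * b * (2 * (real DIM('a) * (C\<^sup>2 * \<epsilon>) + C\<^sup>2 * \<epsilon>) * (ln 4 - ln b) + C\<^sup>2 * \<epsilon>)"
proof (rule mixed_derivative_estimate[OF jk, of _ _ x "diff_quot h i"])
  have cube: "c + 2 \<le> y \<bullet> e" if "y \<in> cbox (x - One) (x + One)" for y
    using inner_cube_ge[OF e that, of "c + 2"] x by simp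
  have CC: "C * \<epsilon> \<le> C\<^sup>2 * \<epsilon>" "L * (C * \<epsilon>) \<le> C\<^sup>2 * \<epsilon>"
    using C_ge pos mult_right_mono[of 1 C "C * \<epsilon>"] mult_right_mono[of L C "C * \<epsilon>"]
    by (simp_all add: power2_eq_square mult.assoc)
  show "continuous_on (cbox (x - One) (x + One)) (diff_quot h i)"
    by (rule continuous_on_subset[OF diff_quot_continuous]) (use cube pos in force)
  show "\<bar>diff_quot h i y\<bar> \<le> C\<^sup>2 * \<epsilon>" if "y \<in> cbox (x - One) (x + One)" for y
    using diff_quot_bound[of y] cube[OF that] CC by simp
  show "\<exists>l. \<bar>l\<bar> \<le> C\<^sup>2 * \<epsilon> \<and> has_laplacian (diff_quot h i) y l"
    if "y \<in> cbox (x - One) (x + One)" for y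
    using diff_quot_laplacian[of y] cube[OF that] CC by force
  show "\<bar>diff_quot h i y - diff_quot h i (y + t *\<^sub>R l)\<bar> \<le> C\<^sup>2 * \<epsilon> * \<bar>t\<bar>"
    if "y \<in> cbox (x - One) (x + One)" "l \<in> {j, k}" "y + t *\<^sub>R l \<in> cbox (x - One) (x + One)" for y l t
  proof -
    have "\<bar>diff_quot h i (y + t *\<^sub>R l) - diff_quot h i y\<bar> \<le> C\<^sup>2 * \<epsilon> * \<bar>t\<bar>"
    proof (rule line_lipschitz[of "c + 2" e])
      show "((\<lambda>t. diff_quot h i (x + t *\<^sub>R l)) has_real_derivative (D l (x + h *\<^sub>R i) - D l x) / h) (at 0)"
        if "c + 2 \<le> x \<bullet> e" for x
        using that pos by (intro diff_quot_line_derivative) auto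
      show "\<bar>(D l (x + h *\<^sub>R i) - D l x) / h\<bar> \<le> C\<^sup>2 * \<epsilon>" if "c + 2 \<le> x \<bullet> e" for x
        using that D_diff_quot_bound \<open>l \<in> {j, k}\<close> jk by auto
    qed (use cube that in auto)
    then show ?thesis by (simp add: abs_minus_commute)
  qed
  have "\<bar>k \<bullet> e\<bar> \<le> 1"
    using jk e by (simp add: inner_Basis)
  then have "\<bar>b * (k \<bullet> e)\<bar> \<le> 1 * 1"
    unfolding abs_mult using b by (intro mult_mono) auto
  then have p: "0 < (x + b *\<^sub>R k) \<bullet> e" "0 < (x - b *\<^sub>R k) \<bullet> e"
    using x pos by (simp_all add: inner_add_left inner_diff_left abs_le_iff)
  show "((\<lambda>t. diff_quot h i (x + b *\<^sub>R k + t *\<^sub>R j)) has_real_derivative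
      (D j (x + b *\<^sub>R k + h *\<^sub>R i) - D j (x + b *\<^sub>R k)) / h) (at 0)"
    "((\<lambda>t. diff_quot h i (x - b *\<^sub>R k + t *\<^sub>R j)) has_real_derivative
      (D j (x - b *\<^sub>R k + h *\<^sub>R i) - D j (x - b *\<^sub>R k)) / h) (at 0)"
    using diff_quot_line_derivative[OF p(1)] diff_quot_line_derivative[OF p(2)] by blast+
qed (use pos C_ge b in auto)

end

lemma D_diff_quot_tendsto:
  assumes "0 < x \<bullet> e" "j \<in> Basis"
  shows "((\<lambda>h. (D j (x + h *\<^sub>R i) - D j x) / h) \<longlongrightarrow> DD j i x) (at_right 0)"
  using D_line_derivative[OF assms, of i]
  by (auto simp: has_field_derivative_iff intro: tendsto_within_subset)

lemma DD_bound:
  assumes ij: "i \<in> Basis" "j \<in> Basis" and x: "c + 2 \<le> x \<bullet> e"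
  shows "\<bar>DD j i x\<bar> \<le> C\<^sup>2 * \<epsilon>"
proof (rule tendsto_upperbound[OF tendsto_rabs[OF D_diff_quot_tendsto]])
  show "\<forall>\<^sub>F h in at_right 0. \<bar>(D j (x + h *\<^sub>R i) - D j x) / h\<bar> \<le> C\<^sup>2 * \<epsilon>"
    using eventually_at_right_less[of "0::real"]
    by eventually_elim (use D_diff_quot_bound ij x in blast)
qed (use x pos ij in auto)

definition H :: "real \<Rightarrow> real" where
  "H \<beta> = C\<^sup>2 * (4 * (real DIM('a) + 1) * (4 powr (1 - \<beta>) / (1 - \<beta>)) + 2)"

lemma H_nonneg: "\<beta> < 1 \<Longrightarrow> 0 \<le> H \<beta>"
  by (simp add: H_def)

lemma DD_symmetric_oscillation:
  assumes ijk: "i \<in> Basis" "j \<in> Basis" "k \<in> Basis" "j \<noteq> k" and x: "c + 3 \<le> x \<bullet> e"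
    and b: "0 < b" "b \<le> 1" and \<beta>: "\<beta> < 1"
  shows "\<bar>DD j i (x + b *\<^sub>R k) - DD j i (x - b *\<^sub>R k)\<bar> \<le> H \<beta> * \<epsilon> * b powr \<beta>"
proof -
  have "\<bar>k \<bullet> e\<bar> \<le> 1"
    using ijk e by (simp add: inner_Basis)
  then have "\<bar>b * (k \<bullet> e)\<bar> \<le> 1 * 1"
    unfolding abs_mult using b by (intro mult_mono) auto
  then have p: "0 < (x + b *\<^sub>R k) \<bullet> e" "0 < (x - b *\<^sub>R k) \<bullet> e"
    using x pos by (simp_all add: inner_add_left inner_diff_left abs_le_iff)
  have "\<bar>DD j i (x + b *\<^sub>R k) - DD j i (x - b *\<^sub>R k)\<bar> \<le>
      2 * b * (2 * (real DIM('a) * (C\<^sup>2 * \<epsilon>) + C\<^sup>2 * \<epsilon>) * (ln 4 - ln b) + C\<^sup>2 * \<epsilon>)"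
  proof (rule tendsto_upperbound[OF tendsto_rabs[OF tendsto_diff[OF D_diff_quot_tendsto[OF p(1)] D_diff_quot_tendsto[OF p(2)]]]])
    show "\<forall>\<^sub>F h in at_right 0. \<bar>(D j (x + b *\<^sub>R k + h *\<^sub>R i) - D j (x + b *\<^sub>R k)) / h
      - (D j (x - b *\<^sub>R k + h *\<^sub>R i) - D j (x - b *\<^sub>R k)) / h\<bar> \<le>
        2 * b * (2 * (real DIM('a) * (C\<^sup>2 * \<epsilon>) + C\<^sup>2 * \<epsilon>) * (ln 4 - ln b) + C\<^sup>2 * \<epsilon>)"
      using eventually_at_right_less[of "0::real"]
      by eventually_elim (use D_diff_quot_oscillation ijk x b in blast)
  qed (use ijk in auto)
  also have "\<dots> = 4 * (real DIM('a) + 1) * (C\<^sup>2 * \<epsilon>) * (b * (ln 4 - ln b)) + 2 * (C\<^sup>2 * \<epsilon>) * b"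
    by (simp add: algebra_simps)
  also have "\<dots> \<le> 4 * (real DIM('a) + 1) * (C\<^sup>2 * \<epsilon>) * (4 powr (1 - \<beta>) / (1 - \<beta>) * b powr \<beta>)
      + 2 * (C\<^sup>2 * \<epsilon>) * b powr \<beta>"
  proof (intro add_mono mult_left_mono log_modulus_le_powr b \<beta>)
    show "b \<le> b powr \<beta>"
      using powr_mono'[of \<beta> 1 b] b \<beta> by simp
  qed (use pos in auto)
  also have "\<dots> = H \<beta> * \<epsilon> * b powr \<beta>"
    by (simp add: H_def algebra_simps)
  finally show ?thesis .
qed

lemma DD_step_neq:
  assumes ijk: "i \<in> Basis" "j \<in> Basis" "k \<in> Basis" "j \<noteq> k"
    and p: "c + 4 \<le> p \<bullet> e" "c + 4 \<le> (p + t *\<^sub>R k) \<bullet> e"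
    and t: "\<bar>t\<bar> \<le> 2" and \<beta>: "\<beta> < 1"
  shows "\<bar>DD j i (p + t *\<^sub>R k) - DD j i p\<bar> \<le> H \<beta> * \<epsilon> * (\<bar>t\<bar> / 2) powr \<beta>"
proof (cases "t = 0")
  case False
  define x where "x = p + (t / 2) *\<^sub>R k"
  have "x \<bullet> e = (p \<bullet> e + (p + t *\<^sub>R k) \<bullet> e) / 2"
    by (simp add: x_def inner_add_left field_simps)
  then have x: "c + 3 \<le> x \<bullet> e"
    using p by simp
  have 1: "p = x - (t / 2) *\<^sub>R k" and 2: "p + t *\<^sub>R k = x + (t / 2) *\<^sub>R k"
    using scaleR_half_double[of "t *\<^sub>R k"] by (simp_all add: x_def scaleR_add_right add.assoc)
  show ?thesis
  proof (cases "t > 0")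
    case True
    then show ?thesis
      unfolding 2 using DD_symmetric_oscillation[OF ijk x, of "t / 2" \<beta>] t \<beta> 1 by simp
  next
    case neg: False
    then have "\<bar>DD j i (x + (- t / 2) *\<^sub>R k) - DD j i (x - (- t / 2) *\<^sub>R k)\<bar> \<le> H \<beta> * \<epsilon> * (- t / 2) powr \<beta>"
      using False t \<beta> by (intro DD_symmetric_oscillation[OF ijk x]) auto
    moreover have "x + (- t / 2) *\<^sub>R k = p" "x - (- t / 2) *\<^sub>R k = p + t *\<^sub>R k"
      unfolding 2 by (simp_all add: x_def)
    ultimately show ?thesis
      using neg False by (simp add: abs_minus_commute)
  qed
qed simp

lemma DD_step:
  assumes ijk: "i \<in> Basis" "j \<in> Basis" "k \<in> Basis"
    and p: "c + 4 \<le> p \<bullet> e" "c + 4 \<le> (p + t *\<^sub>R k) \<bullet> e"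
    and t: "\<bar>t\<bar> \<le> 2" and \<beta>: "0 \<le> \<beta>" "\<beta> < 1"
  shows "\<bar>DD j i (p + t *\<^sub>R k) - DD j i p\<bar>
    \<le> (real DIM('a) * H \<beta> + 2 * L * C) * \<epsilon> * (\<bar>t\<bar> / 2) powr \<beta>"
proof (cases "t = 0")
  case False
  define \<omega> where "\<omega> = \<epsilon> * (\<bar>t\<bar> / 2) powr \<beta>"
  have \<omega>: "0 \<le> \<omega>" using pos by (simp add: \<omega>_def)
  have N: "1 \<le> real DIM('a)"
    using DIM_positive[where 'a = 'a] by linarith
  have LC: "0 \<le> 2 * L * C"
    using pos C_ge by simp
  have H1: "H \<beta> * \<omega> \<le> real DIM('a) * H \<beta> * \<omega>"
    using N H_nonneg[OF \<beta>(2)] \<omega> mult_right_mono[of 1 "real DIM('a)" "H \<beta> * \<omega>"] by simp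
  have "\<bar>DD j i (p + t *\<^sub>R k) - DD j i p\<bar> \<le> real DIM('a) * H \<beta> * \<omega> + 2 * L * C * \<omega>"
  proof -
    consider "j \<noteq> k" | "j = k" "i \<noteq> k" | "j = k" "i = k" by blast
    then show ?thesis
    proof cases
      case 1
      then have "\<bar>DD j i (p + t *\<^sub>R k) - DD j i p\<bar> \<le> H \<beta> * \<omega>"
        using DD_step_neq[OF ijk _ p t \<beta>(2)] by (simp add: \<omega>_def mult.assoc)
      also have "\<dots> \<le> real DIM('a) * H \<beta> * \<omega> + 2 * L * C * \<omega>"
        using H1 mult_nonneg_nonneg[OF LC \<omega>] by linarith
      finally show ?thesis .
    next
      case 2
      have "DD j i y = DD i j y" if "0 < y \<bullet> e" for y
        by (rule C2_on_symmetric[OF C2 open_half _ ijk(2,1)]) (use that in simp)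
      then have "\<bar>DD j i (p + t *\<^sub>R k) - DD j i p\<bar> \<le> H \<beta> * \<omega>"
        using DD_step_neq[OF ijk(2,1,3) _ p t \<beta>(2)] 2 p pos by (simp add: \<omega>_def mult.assoc)
      also have "\<dots> \<le> real DIM('a) * H \<beta> * \<omega> + 2 * L * C * \<omega>"
        using H1 mult_nonneg_nonneg[OF LC \<omega>] by linarith
      finally show ?thesis .
    next
      case 3
      \<comment> \<open>The barrier needs two distinct directions; here the equation expresses the missing derivative
        through the others.\<close>
      have split: "DD k k y = laplacian u y - (\<Sum>l\<in>Basis - {k}. DD l l y)" for y
        using sum.remove[OF finite_Basis ijk(3), of "\<lambda>l. DD l l y"] by (simp add: laplacian_def)
      have "\<bar>DD k k (p + t *\<^sub>R k) - DD k k p\<bar> = \<bar>(laplacian u (p + t *\<^sub>R k) - laplacian u p)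
          - (\<Sum>l\<in>Basis - {k}. DD l l (p + t *\<^sub>R k) - DD l l p)\<bar>"
        unfolding split sum_subtractf by (simp add: algebra_simps)
      also have "\<dots> \<le> \<bar>laplacian u (p + t *\<^sub>R k) - laplacian u p\<bar>
          + \<bar>\<Sum>l\<in>Basis - {k}. DD l l (p + t *\<^sub>R k) - DD l l p\<bar>"
        by (rule abs_triangle_ineq4)
      also have "\<bar>\<Sum>l\<in>Basis - {k}. DD l l (p + t *\<^sub>R k) - DD l l p\<bar> \<le> (\<Sum>l\<in>Basis - {k}. H \<beta> * \<omega>)"
      proof (rule order_trans[OF sum_abs sum_mono])
        fix l :: 'a assume "l \<in> Basis - {k}"
        then show "\<bar>DD l l (p + t *\<^sub>R k) - DD l l p\<bar> \<le> H \<beta> * \<omega>"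
          using DD_step_neq[of l l k p t \<beta>] ijk p t \<beta> by (simp add: \<omega>_def mult.assoc)
      qed
      also have "(\<Sum>l\<in>Basis - {k}. H \<beta> * \<omega>) \<le> real DIM('a) * H \<beta> * \<omega>"
        using ijk(3) \<omega> H_nonneg[OF \<beta>(2)] by (simp add: card_Diff_singleton mult.assoc mult_right_mono)
      also have "\<bar>laplacian u (p + t *\<^sub>R k) - laplacian u p\<bar> \<le> 2 * L * C * \<omega>"
      proof -
        have "\<bar>laplacian u (p + t *\<^sub>R k) - laplacian u p\<bar> \<le> L * \<bar>u (p + t *\<^sub>R k) - u p\<bar>"
          using p by (intro lap_lipschitz) auto
        also have "\<dots> \<le> L * (C * \<epsilon> * \<bar>t\<bar>)"
          using p pos by (intro mult_left_mono u_lipschitz ijk) auto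
        also have "\<dots> = 2 * L * C * (\<epsilon> * (\<bar>t\<bar> / 2))"
          by simp
        also have "\<dots> \<le> 2 * L * C * \<omega>"
        proof -
          have "\<bar>t\<bar> / 2 \<le> (\<bar>t\<bar> / 2) powr \<beta>"
            using powr_mono'[of \<beta> 1 "\<bar>t\<bar> / 2"] t \<beta> by simp
          then show ?thesis
            unfolding \<omega>_def using LC pos by (intro mult_left_mono) auto
        qed
        finally show ?thesis .
      qed
      finally show ?thesis
        using 3 by (simp add: algebra_simps)
    qed
  qed
  then show ?thesis
    by (simp add: \<omega>_def algebra_simps)
qed simp

lemma DD_holder:
  assumes ij: "i \<in> Basis" "j \<in> Basis" and p: "c + 4 \<le> p \<bullet> e" and q: "c + 4 \<le> q \<bullet> e"
    and d: "dist p q \<le> 2" and \<beta>: "0 \<le> \<beta>" "\<beta> < 1"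
  shows "\<bar>DD j i q - DD j i p\<bar>
    \<le> real DIM('a) * (real DIM('a) * H \<beta> + 2 * L * C) * \<epsilon> * dist p q powr \<beta>"
proof -
  define K where "K = (real DIM('a) * H \<beta> + 2 * L * C) * \<epsilon>"
  have K: "0 \<le> K"
    using pos C_ge H_nonneg[OF \<beta>(2)] by (simp add: K_def)
  have "\<bar>DD j i q - DD j i p\<bar> \<le> real DIM('a) * (K * dist p q powr \<beta>)"
  proof (rule coordinatewise_oscillation[OF _ e p q])
    fix p' t k assume k: "k \<in> Basis" and p': "c + 4 \<le> p' \<bullet> e" "c + 4 \<le> (p' + t *\<^sub>R k) \<bullet> e"
      and t: "\<bar>t\<bar> \<le> dist p q"
    then have "\<bar>DD j i (p' + t *\<^sub>R k) - DD j i p'\<bar> \<le> K * (\<bar>t\<bar> / 2) powr \<beta>"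
      unfolding K_def using d by (intro DD_step ij \<beta>) auto
    also have "\<dots> \<le> K * dist p q powr \<beta>"
      using t K \<beta> by (intro mult_left_mono powr_mono2) auto
    finally show "\<bar>DD j i (p' + t *\<^sub>R k) - DD j i p'\<bar> \<le> K * dist p q powr \<beta>" .
  qed (simp add: dist_norm norm_minus_commute)
  then show ?thesis by (simp add: K_def mult.assoc)
qed

end

section \<open>Uniform convergence far from the boundary\<close>

lemma asymptotic_infimum:
  fixes v :: "'a::euclidean_space \<Rightarrow> real"
  assumes e: "e \<in> Basis" and B: "\<And>x. 0 < x \<bullet> e \<Longrightarrow> \<bar>v x\<bar> \<le> B"
  obtains m where "\<And>\<eta>. 0 < \<eta> \<Longrightarrow> \<exists>R. \<forall>x. R \<le> x \<bullet> e \<longrightarrow> m - \<eta> < v x"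
    and "\<And>\<eta> R. 0 < \<eta> \<Longrightarrow> \<exists>x. R \<le> x \<bullet> e \<and> v x < m + \<eta>"
proof -
  define T where "T = {t. \<exists>R. \<forall>x. R \<le> x \<bullet> e \<longrightarrow> t \<le> v x}"
  have "- B \<le> v x" if "1 \<le> x \<bullet> e" for x
    using B[of x] that by simp
  then have "- B \<in> T"
    unfolding T_def by blast
  have bdd: "bdd_above T"
  proof (rule bdd_aboveI)
    fix t assume "t \<in> T"
    then obtain R where R: "\<And>x. R \<le> x \<bullet> e \<Longrightarrow> t \<le> v x"
      unfolding T_def by blast
    define x where "x = max R 1 *\<^sub>R e"
    have "x \<bullet> e = max R 1"
      using e by (simp add: x_def)
    then have "R \<le> x \<bullet> e" "0 < x \<bullet> e"
      by (auto simp: less_max_iff_disj)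
    then show "t \<le> B"
      using R[of x] B[of x] by simp
  qed
  show thesis
  proof (rule that[of "Sup T"])
    fix \<eta> :: real assume "0 < \<eta>"
    then obtain t where "t \<in> T" "Sup T - \<eta> < t"
      using less_cSupD[of T "Sup T - \<eta>"] \<open>- B \<in> T\<close> by auto
    then show "\<exists>R. \<forall>x. R \<le> x \<bullet> e \<longrightarrow> Sup T - \<eta> < v x"
      unfolding T_def by fastforce
  next
    fix \<eta> R :: real assume "0 < \<eta>"
    show "\<exists>x. R \<le> x \<bullet> e \<and> v x < Sup T + \<eta>"
    proof (rule ccontr)
      assume "\<not> ?thesis"
      then have "Sup T + \<eta> \<in> T"
        unfolding T_def by force
      then have "Sup T + \<eta> \<le> Sup T"
        using bdd by (rule cSup_upper)
      with \<open>0 < \<eta>\<close> show False by simp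
    qed
  qed
qed

lemma inner_cball_ge:
  fixes a :: "'a::euclidean_space"
  assumes "e \<in> Basis" "x \<in> cball a R" "d + R \<le> a \<bullet> e"
  shows "d \<le> x \<bullet> e"
proof -
  have "\<bar>(a - x) \<bullet> e\<bar> \<le> R"
    using Basis_le_norm[OF assms(1), of "a - x"] assms(2) by (simp add: dist_norm)
  then show ?thesis
    using assms(3) by (simp add: inner_diff_left)
qed

lemma large_exponent:
  assumes "0 < r"
  obtains k where "2 \<le> k" "A < 2 * real (k - 1) * r\<^sup>2"
proof -
  obtain n where n: "A / (2 * r\<^sup>2) < real n"
    using reals_Archimedean2 by blast
  have "A < 2 * real n * r\<^sup>2"
    using n assms by (simp add: field_simps)
  also have "\<dots> \<le> 2 * real (n + 2 - 1) * r\<^sup>2"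
    by (intro mult_right_mono) auto
  finally show thesis
    using that[of "n + 2"] by simp
qed

lemma large_radius:
  assumes "0 < (c::real)"
  obtains R where "0 < R" "A < 32 * c * R\<^sup>2"
proof -
  obtain n where n: "A / (32 * c) < real n"
    using reals_Archimedean2 by blast
  have "A < 32 * c * real n"
    using n assms by (simp add: field_simps)
  also have "\<dots> \<le> 32 * c * (real n + 1)\<^sup>2"
    using assms by (intro mult_left_mono) (auto simp: power2_eq_square algebra_simps)
  finally show thesis
    using that[of "real n + 1"] by simp
qed

locale half_space_semilinear =
  fixes e :: "'a::euclidean_space" and u :: "'a \<Rightarrow> real" and f :: "real \<Rightarrow> real"
    and \<mu> K L :: real
  assumes e: "e \<in> Basis"
    and C2: "C2_on {x. 0 < x \<bullet> e} u"
    and u_range: "\<And>x. 0 < x \<bullet> e \<Longrightarrow> 0 \<le> u x \<and> u x \<le> K"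
    and eq: "\<And>x. 0 < x \<bullet> e \<Longrightarrow> laplacian u x = - f (u x)"
    and u_nonzero: "\<exists>x. 0 < x \<bullet> e \<and> 0 < u x"
    and \<mu>: "0 < \<mu>"
    and f_pos: "\<And>s. 0 < s \<Longrightarrow> s < \<mu> \<Longrightarrow> 0 < f s"
    and f_nonpos: "\<And>s. \<mu> \<le> s \<Longrightarrow> f s \<le> 0"
    and L: "0 < L"
    and f_lipschitz: "\<And>s t. 0 \<le> s \<Longrightarrow> s \<le> K \<Longrightarrow> 0 \<le> t \<Longrightarrow> t \<le> K \<Longrightarrow> \<bar>f s - f t\<bar> \<le> L * \<bar>s - t\<bar>"
    and f_cont: "continuous_on {0..} f"
    and f_linear_0: "\<exists>c>0. \<exists>s>0. \<forall>r. 0 \<le> r \<and> r < s \<longrightarrow> c * r \<le> f r"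
    and f_linear_zero: "\<And>z. \<mu> < z \<Longrightarrow> f z = 0 \<Longrightarrow> \<exists>c>0. \<exists>s>0. \<forall>r. z - s < r \<and> r < z \<longrightarrow> f r \<le> c * (r - z)"
begin

lemma u_laplacian: "0 < x \<bullet> e \<Longrightarrow> has_laplacian u x (- f (u x))"
  using C2_on_has_laplacian[OF C2 open_halfspace_component_gt, of x] eq[of x] by simp

lemma continuous_u: "continuous_on {x. 0 < x \<bullet> e} u"
  using C2 by (simp add: C2_on_def differentiable_imp_continuous_on)

lemma f_nonneg: "0 \<le> s \<Longrightarrow> s < \<mu> \<Longrightarrow> 0 \<le> f s"
proof (cases "s = 0")
  case True
  obtain c s where "c > 0" "s > 0" "\<And>r. 0 \<le> r \<Longrightarrow> r < s \<Longrightarrow> c * r \<le> f r"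
    using f_linear_0 by blast
  from this(3)[of 0] this(2) True show ?thesis by simp
qed (use f_pos[of s] in auto)

lemma u_positive:
  assumes "0 < x \<bullet> e"
  shows "0 < u x"
proof -
  let ?U = "{x. 0 < x \<bullet> e}"
  define P where "P = {x \<in> ?U. 0 < u x}"
  define Z where "Z = {x \<in> ?U. u x \<le> 0}"
  have "open ?U"
    by (rule open_halfspace_component_gt)
  have "open P"
  proof -
    have "open (?U \<inter> u -` {0<..})"
      by (rule continuous_open_preimage[OF continuous_u \<open>open ?U\<close>]) simp
    moreover have "?U \<inter> u -` {0<..} = P"
      by (auto simp: P_def)
    ultimately show ?thesis by simp
  qed
  have "open Z"
    unfolding open_contains_ball
  proof
    fix y assume y: "y \<in> Z"
    define \<rho> where "\<rho> = (y \<bullet> e) / 4"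
    have \<rho>: "0 < \<rho>" "y \<bullet> e = 4 * \<rho>"
      using y by (auto simp: \<rho>_def Z_def)
    have "ball y \<rho> \<subseteq> Z"
    proof
      fix a assume a: "a \<in> ball y \<rho>"
      have a_e: "3 * \<rho> \<le> a \<bullet> e"
        using inner_cball_ge[OF e, of a y \<rho> "3 * \<rho>"] a \<rho> by auto
      have "\<not> 0 < u a"
      proof
        assume pos: "0 < u a"
        define \<theta> where "\<theta> = min \<mu> (u a / 2)"
        have \<theta>: "0 < \<theta>" "\<theta> \<le> \<mu>" "\<theta> < u a"
          using pos \<mu> by (auto simp: \<theta>_def)
        have cball_U: "0 < x \<bullet> e" if "x \<in> cball a (2 * \<rho>)" for x
          using inner_cball_ge[OF e that, of \<rho>] a_e \<rho> by simp
        have "isCont u a"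
          using continuous_u a_e \<rho> by (intro continuous_on_interior[of ?U u]) (auto simp: interior_open[OF \<open>open ?U\<close>])
        then obtain d where d: "0 < d" "\<And>x. dist x a < d \<Longrightarrow> dist (u x) (u a) < u a - \<theta>"
          using \<theta> unfolding continuous_at_eps_delta by (metis diff_gt_0_iff_gt)
        define r where "r = min \<rho> (d / 2)"
        have r: "0 < r" "r < 2 * \<rho>" "r < d"
          using d(1) \<rho> by (auto simp: r_def)
        obtain k where k: "2 \<le> k" "real DIM('a) * (2 * \<rho>)\<^sup>2 < 2 * real (k - 1) * r\<^sup>2"
          using large_exponent[OF r(1)] by blast
        have ya: "norm (y - a) < \<rho>"
          using a by (simp add: dist_norm)
        have "\<theta> * (((2 * \<rho>)\<^sup>2 - (norm (y - a))\<^sup>2) / (2 * \<rho>)\<^sup>2) ^ k \<le> u y"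
        proof (rule paraboloid_barrier[OF r(1,2) _ _ \<theta>(1) _ _ k])
          show "continuous_on (cball a (2 * \<rho>)) u"
            by (rule continuous_on_subset[OF continuous_u]) (use cball_U in auto)
          show "0 \<le> u x" if "x \<in> cball a (2 * \<rho>)" for x
            using u_range[OF cball_U[OF that]] by simp
          show "\<theta> \<le> u x" if "x \<in> cball a r" for x
            using d(2)[of x] that r by (auto simp: dist_real_def dist_commute abs_less_iff)
          show "\<exists>l\<le>0. has_laplacian u x l" if "x \<in> ball a (2 * \<rho>)" "u x < \<theta>" for x
          proof -
            have "0 < x \<bullet> e" using cball_U that by auto
            then show ?thesis
              using u_laplacian[of x] f_nonneg[of "u x"] u_range[of x] that \<theta>
              by (intro exI[of _ "- f (u x)"]) auto
          qed
          show "y \<in> cball a (2 * \<rho>)"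
            using ya \<rho> by (simp add: dist_norm norm_minus_commute)
        qed
        moreover have "(norm (y - a))\<^sup>2 < (2 * \<rho>)\<^sup>2"
          using ya \<rho> by (intro power_strict_mono) auto
        then have "0 < \<theta> * (((2 * \<rho>)\<^sup>2 - (norm (y - a))\<^sup>2) / (2 * \<rho>)\<^sup>2) ^ k"
          using \<theta> \<rho> by (intro mult_pos_pos zero_less_power divide_pos_pos) auto
        ultimately show False
          using y by (simp add: Z_def)
      qed
      with a_e \<rho> show "a \<in> Z"
        by (simp add: Z_def)
    qed
    with \<rho> show "\<exists>\<epsilon>>0. ball y \<epsilon> \<subseteq> Z" by blast
  qed
  have "connected ?U"
    using convex_connected[OF convex_halfspace_gt[of 0 e]] by (simp add: inner_commute)
  moreover have "?U \<subseteq> P \<union> Z" "P \<inter> Z \<inter> ?U = {}" "P \<inter> ?U \<noteq> {}"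
    using u_nonzero by (auto simp: P_def Z_def)
  ultimately have "Z \<inter> ?U = {}"
    using connectedD[of ?U P Z] \<open>open P\<close> \<open>open Z\<close> by auto
  with assms show ?thesis
    by (auto simp: Z_def)
qed

lemma u_lower_bound:
  obtains s R where "0 < s" "0 < R" "\<And>x. R \<le> x \<bullet> e \<Longrightarrow> s \<le> u x"
proof -
  obtain c s where cs: "c > 0" "s > 0" "\<And>r. 0 \<le> r \<Longrightarrow> r < s \<Longrightarrow> c * r \<le> f r"
    using f_linear_0 by blast
  obtain R where R: "0 < R" "(4 * real DIM('a) + 8)\<^sup>2 < 32 * c * R\<^sup>2"
    using large_radius[OF cs(1)] by blast
  have "s \<le> u a" if a: "1 + R \<le> a \<bullet> e" for a
  proof (rule supersolution_ge_on_large_ball[OF R])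
    have U: "0 < x \<bullet> e" if "x \<in> cball a R" for x
      using inner_cball_ge[OF e that a] by simp
    show "continuous_on (cball a R) u"
      by (rule continuous_on_subset[OF continuous_u]) (use U in auto)
    show "0 < u x" if "x \<in> cball a R" for x
      using u_positive[OF U[OF that]] .
    show "\<exists>l\<le>- (c * u x). has_laplacian u x l" if "x \<in> ball a R" "u x < s" for x
    proof -
      have "0 < x \<bullet> e" using U that by auto
      then show ?thesis
        using u_laplacian[of x] cs(3)[of "u x"] u_range[of x] that
        by (intro exI[of _ "- f (u x)"]) auto
    qed
  qed
  with that[of s "1 + R"] cs R show thesis by simp
qed

lemma u_lipschitz:
  obtains \<Gamma> where "0 < \<Gamma>"
    and "\<And>p q. 2 \<le> p \<bullet> e \<Longrightarrow> 2 \<le> q \<bullet> e \<Longrightarrow> \<bar>u q - u p\<bar> \<le> \<Gamma> * dist p q"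
proof -
  define \<epsilon> where "\<epsilon> = \<bar>K\<bar> + \<bar>f 0\<bar> / L + 1"
  have \<epsilon>: "0 < \<epsilon>" "\<bar>K\<bar> \<le> \<epsilon>"
    using L by (auto simp: \<epsilon>_def add_nonneg_pos)
  interpret half_space_poisson e u 0 1 \<epsilon> L
  proof
    fix x assume x: "1 \<le> x \<bullet> e"
    show "\<bar>u x - 0\<bar> \<le> \<epsilon>"
      using u_range[of x] x \<epsilon> by simp
    have "\<bar>f (u x)\<bar> \<le> \<bar>f (u x) - f 0\<bar> + \<bar>f 0\<bar>"
      by simp
    also have "\<bar>f (u x) - f 0\<bar> \<le> L * \<bar>u x - 0\<bar>"
      using u_range[of x] x by (intro f_lipschitz) auto
    also have "\<dots> \<le> L * \<bar>K\<bar>"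
      using u_range[of x] x L by (intro mult_left_mono) auto
    finally have "\<bar>f (u x)\<bar> \<le> L * \<bar>K\<bar> + \<bar>f 0\<bar>"
      by simp
    also have "\<dots> \<le> L * \<epsilon>"
      using L by (simp add: \<epsilon>_def algebra_simps)
    finally show "\<bar>laplacian u x\<bar> \<le> L * \<epsilon>"
      using eq[of x] x by simp
  next
    fix x y assume "1 \<le> x \<bullet> e" "1 \<le> y \<bullet> e"
    then show "\<bar>laplacian u x - laplacian u y\<bar> \<le> L * \<bar>u x - u y\<bar>"
      using f_lipschitz[of "u x" "u y"] u_range[of x] u_range[of y] eq[of x] eq[of y]
      by simp
  qed (use e C2 L \<epsilon> in auto)
  show thesis
  proof (rule that[of "real DIM('a) * (C * \<epsilon>)"])
    show "0 < real DIM('a) * (C * \<epsilon>)"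
      using C_ge \<epsilon> by (intro mult_pos_pos) auto
    fix p q assume pq: "2 \<le> p \<bullet> e" "2 \<le> q \<bullet> e"
    have "\<bar>u q - u p\<bar> \<le> real DIM('a) * (C * \<epsilon> * dist p q)"
    proof (rule coordinatewise_oscillation[OF _ e pq])
      fix p' t k assume "k \<in> Basis" "2 \<le> p' \<bullet> e" "2 \<le> (p' + t *\<^sub>R k) \<bullet> e" "\<bar>t\<bar> \<le> dist p q"
      then have "\<bar>u (p' + t *\<^sub>R k) - u p'\<bar> \<le> C * \<epsilon> * \<bar>t\<bar>"
        by (intro u_lipschitz) auto
      also have "\<dots> \<le> C * \<epsilon> * dist p q"
        using \<open>\<bar>t\<bar> \<le> dist p q\<close> C_ge \<epsilon> by (intro mult_left_mono) auto
      finally show "\<bar>u (p' + t *\<^sub>R k) - u p'\<bar> \<le> C * \<epsilon> * dist p q" .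
    qed (simp add: dist_norm norm_minus_commute)
    then show "\<bar>u q - u p\<bar> \<le> real DIM('a) * (C * \<epsilon>) * dist p q"
      by (simp add: mult.assoc)
  qed
qed

text \<open>By the strong maximum principle and the comparison with compactly supported subsolutions,
  \<open>S - u\<close> cannot take a value in \<open>[\<theta>, s)\<close> far from the boundary.\<close>

lemma gap_below_zero_of_f:
  assumes S: "\<mu> < S" and upper: "\<And>\<eta>. 0 < \<eta> \<Longrightarrow> \<exists>R. \<forall>x. R \<le> x \<bullet> e \<longrightarrow> u x < S + \<eta>"
    and c: "0 < c" and fS: "\<And>r. S - s < r \<Longrightarrow> r < S \<Longrightarrow> f r \<le> c * (r - S)"
    and s: "s \<le> S - \<mu>" and \<theta>: "0 < \<theta>" "\<theta> < s"
  shows "\<exists>R. \<forall>y. R \<le> y \<bullet> e \<longrightarrow> \<theta> \<le> S - u y \<longrightarrow> s \<le> S - u y"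
proof -
  define w where "w x = S - u x" for x
  obtain \<Gamma> where \<Gamma>: "0 < \<Gamma>" "\<And>p q. 2 \<le> p \<bullet> e \<Longrightarrow> 2 \<le> q \<bullet> e \<Longrightarrow> \<bar>u q - u p\<bar> \<le> \<Gamma> * dist p q"
    using u_lipschitz by blast
  obtain \<rho> where \<rho>: "0 < \<rho>" "(4 * real DIM('a) + 8)\<^sup>2 < 32 * c * \<rho>\<^sup>2"
    using large_radius[OF c] by blast
  define r where "r = min \<rho> (\<theta> / (2 * \<Gamma>))"
  have r: "0 < r" "r < 2 * \<rho>" "r \<le> \<theta> / (2 * \<Gamma>)"
    using \<rho> \<theta> \<Gamma> by (auto simp: r_def)
  obtain k where k: "2 \<le> k" "real DIM('a) * (2 * \<rho>)\<^sup>2 < 2 * real (k - 1) * r\<^sup>2"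
    using large_exponent[OF r(1)] by blast
  define \<eta> where "\<eta> = \<theta> / 4 * (3 / 4) ^ k"
  have \<eta>: "0 < \<eta>"
    using \<theta> by (simp add: \<eta>_def)
  obtain R where R: "\<And>x. R \<le> x \<bullet> e \<Longrightarrow> u x < S + \<eta>"
    using upper[OF \<eta>] by blast
  have lap_w: "has_laplacian w x (f (u x))" if "0 < x \<bullet> e" for x
    using has_laplacian_diff[OF has_laplacian_const u_laplacian[OF that], of S] by (simp add: w_def[abs_def])
  have "s \<le> w y" if y: "max R 2 + 2 * \<rho> \<le> y \<bullet> e" and wy: "\<theta> \<le> w y" for y
  proof -
    have U: "R \<le> x \<bullet> e" "2 \<le> x \<bullet> e" if "x \<in> cball y (2 * \<rho>)" for x
      using inner_cball_ge[OF e that, of "max R 2"] y by auto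
    have cont: "continuous_on (cball y (2 * \<rho>)) w"
      unfolding w_def
      by (intro continuous_intros continuous_on_subset[OF continuous_u]) (use U in force)
    have w_low: "\<eta> \<le> w x" if x: "x \<in> cball y \<rho>" for x
    proof -
      have "\<theta> / 2 * (((2 * \<rho>)\<^sup>2 - (norm (x - y))\<^sup>2) / (2 * \<rho>)\<^sup>2) ^ k \<le> w x + \<eta>"
      proof (rule paraboloid_barrier[OF r(1,2) _ _ _ _ _ k])
        show "continuous_on (cball y (2 * \<rho>)) (\<lambda>x. w x + \<eta>)"
          by (intro continuous_intros cont)
        show "0 \<le> w x + \<eta>" if "x \<in> cball y (2 * \<rho>)" for x
          using R[OF U(1)[OF that]] by (simp add: w_def)
        show "0 < \<theta> / 2" using \<theta> by simp
        show "\<theta> / 2 \<le> w x + \<eta>" if x: "x \<in> cball y r" for x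
        proof -
          have "x \<in> cball y (2 * \<rho>)" "y \<in> cball y (2 * \<rho>)"
            using x r \<rho> by auto
          then have "\<bar>u x - u y\<bar> \<le> \<Gamma> * dist y x"
            using U by (intro \<Gamma>(2)) auto
          also have "\<dots> \<le> \<Gamma> * (\<theta> / (2 * \<Gamma>))"
            using x r \<Gamma> by (intro mult_left_mono) auto
          also have "\<dots> = \<theta> / 2"
            using \<Gamma> by simp
          finally show ?thesis
            using wy \<eta> abs_ge_self[of "u x - u y"] unfolding w_def by linarith
        qed
        show "\<exists>l\<le>0. has_laplacian (\<lambda>x. w x + \<eta>) x l"
          if x: "x \<in> ball y (2 * \<rho>)" and small: "w x + \<eta> < \<theta> / 2" for x
        proof -
          have "2 \<le> x \<bullet> e" using U x by auto
          then have "has_laplacian (\<lambda>x. w x + \<eta>) x (f (u x) + 0)"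
            by (intro has_laplacian_add has_laplacian_const lap_w) auto
          moreover have "f (u x) \<le> 0"
            using small \<eta> \<theta> s by (intro f_nonpos) (simp add: w_def)
          ultimately show ?thesis by auto
        qed
        show "x \<in> cball y (2 * \<rho>)" using x \<rho> by simp
      qed
      moreover have "3 / 4 \<le> ((2 * \<rho>)\<^sup>2 - (norm (x - y))\<^sup>2) / (2 * \<rho>)\<^sup>2"
      proof -
        have "(norm (x - y))\<^sup>2 \<le> \<rho>\<^sup>2"
          using x by (intro power_mono) (auto simp: dist_norm norm_minus_commute)
        then show ?thesis
          using \<rho> by (simp add: field_simps)
      qed
      then have "\<theta> / 2 * (3 / 4) ^ k \<le> \<theta> / 2 * (((2 * \<rho>)\<^sup>2 - (norm (x - y))\<^sup>2) / (2 * \<rho>)\<^sup>2) ^ k"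
        using \<theta> by (intro mult_left_mono power_mono) auto
      ultimately show ?thesis
        unfolding \<eta>_def by simp
    qed
    show "s \<le> w y"
    proof (rule supersolution_ge_on_large_ball[OF \<rho>])
      show "continuous_on (cball y \<rho>) w"
        by (rule continuous_on_subset[OF cont]) (use \<rho> in auto)
      show "0 < w x" if "x \<in> cball y \<rho>" for x
        using w_low[OF that] \<eta> by simp
      show "\<exists>l\<le>- (c * w x). has_laplacian w x l" if x: "x \<in> ball y \<rho>" "w x < s" for x
      proof -
        have "2 \<le> x \<bullet> e" using U(2)[of x] x \<rho> by auto
        moreover have "0 < w x" using w_low[of x] x \<eta> by force
        then have "f (u x) \<le> c * (u x - S)"
          using x by (intro fS) (auto simp: w_def)
        then have "f (u x) \<le> - (c * w x)"
          by (simp add: w_def algebra_simps)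
        ultimately show ?thesis
          using lap_w[of x] by auto
      qed
    qed
  qed
  then show ?thesis
    unfolding w_def by blast
qed

theorem uniform_convergence:
  "\<exists>z\<ge>\<mu>. f z = 0 \<and> (\<forall>\<eta>>0. \<exists>R. \<forall>x. R \<le> x \<bullet> e \<longrightarrow> \<bar>u x - z\<bar> < \<eta>)"
proof -
  have bound: "\<bar>u x\<bar> \<le> K" if "0 < x \<bullet> e" for x
    using u_range[OF that] by simp
  then have bound': "\<bar>- u x\<bar> \<le> K" if "0 < x \<bullet> e" for x
    using that by simp
  obtain m where m: "\<And>\<eta>. 0 < \<eta> \<Longrightarrow> \<exists>R. \<forall>x. R \<le> x \<bullet> e \<longrightarrow> m - \<eta> < u x"
      "\<And>\<eta> R. 0 < \<eta> \<Longrightarrow> \<exists>x. R \<le> x \<bullet> e \<and> u x < m + \<eta>"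
    using asymptotic_infimum[of e u K, OF e bound] by blast
  obtain S' where S': "\<And>\<eta>. 0 < \<eta> \<Longrightarrow> \<exists>R. \<forall>x. R \<le> x \<bullet> e \<longrightarrow> S' - \<eta> < - u x"
      "\<And>\<eta> R. 0 < \<eta> \<Longrightarrow> \<exists>x. R \<le> x \<bullet> e \<and> - u x < S' + \<eta>"
    using asymptotic_infimum[of e "\<lambda>x. - u x" K, OF e bound'] by blast
  define S where "S = - S'"
  have upper: "\<exists>R. \<forall>x. R \<le> x \<bullet> e \<longrightarrow> u x < S + \<eta>" if "0 < \<eta>" for \<eta>
    using S'(1)[OF that] unfolding S_def by (force simp: algebra_simps)
  have freq: "\<exists>x. R \<le> x \<bullet> e \<and> S - \<eta> < u x" if "0 < \<eta>" for \<eta> R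
    using S'(2)[OF that, of R] unfolding S_def by (force simp: algebra_simps)
  obtain s R where sR: "0 < s" "0 < R" "\<And>x. R \<le> x \<bullet> e \<Longrightarrow> s \<le> u x"
    using u_lower_bound by blast
  have "0 < m"
  proof (rule ccontr)
    assume "\<not> 0 < m"
    then obtain x where "R \<le> x \<bullet> e" "u x < m + s"
      using m(2)[of s R] sR by auto
    with sR(3)[of x] \<open>\<not> 0 < m\<close> show False by simp
  qed
  have near: "\<exists>\<delta>>0. \<forall>r. 0 \<le> r \<and> \<bar>r - t\<bar> < \<delta> \<longrightarrow> \<bar>f r - f t\<bar> < d" if "0 \<le> t" "0 < d" for t d
    using f_cont that unfolding continuous_on_iff dist_real_def by fastforce
  have "\<not> 0 < f m"
  proof
    assume pos: "0 < f m"
    obtain \<delta> where \<delta>: "\<delta> > 0" "\<And>r. 0 \<le> r \<Longrightarrow> \<bar>r - m\<bar> < \<delta> \<Longrightarrow> \<bar>f r - f m\<bar> < f m / 2"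
      using near[of m "f m / 2"] pos \<open>0 < m\<close> by auto
    define \<eta> where "\<eta> = min \<delta> (f m / 2)"
    have \<eta>: "0 < \<eta>" "\<eta> \<le> \<delta>" "\<eta> \<le> f m / 2"
      using \<delta> pos by (auto simp: \<eta>_def)
    obtain x where x: "1 \<le> x \<bullet> e" "\<bar>u x - m\<bar> < \<eta>" "- \<eta> \<le> - f (u x)"
      using laplacian_at_liminf[OF continuous_u e u_laplacian m \<eta>(1), of 1] by blast
    then have "\<bar>f (u x) - f m\<bar> < f m / 2"
      using u_range[of x] \<eta> by (intro \<delta>(2)) auto
    with x \<eta> show False by (simp add: abs_less_iff)
  qed
  then have "\<mu> \<le> m"
    using f_pos[of m] \<open>0 < m\<close> by force
  have "m \<le> S"
  proof (rule ccontr)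
    assume "\<not> m \<le> S"
    define \<eta> where "\<eta> = (m - S) / 2"
    have \<eta>: "0 < \<eta>" "S + \<eta> = m - \<eta>"
      using \<open>\<not> m \<le> S\<close> by (auto simp: \<eta>_def field_simps)
    obtain R1 where R1: "\<And>x. R1 \<le> x \<bullet> e \<Longrightarrow> u x < S + \<eta>"
      using upper[OF \<eta>(1)] by blast
    obtain R2 where R2: "\<And>x. R2 \<le> x \<bullet> e \<Longrightarrow> m - \<eta> < u x"
      using m(1)[OF \<eta>(1)] by blast
    define x where "x = max R1 R2 *\<^sub>R e"
    have "x \<bullet> e = max R1 R2"
      using e by (simp add: x_def)
    with R1[of x] R2[of x] \<eta> show False by simp
  qed
  have "f S = 0"
  proof (rule ccontr)
    assume "f S \<noteq> 0"
    then have neg: "f S < 0"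
      using f_nonpos[of S] \<open>\<mu> \<le> m\<close> \<open>m \<le> S\<close> by simp
    obtain \<delta> where \<delta>: "\<delta> > 0" "\<And>r. 0 \<le> r \<Longrightarrow> \<bar>r - S\<bar> < \<delta> \<Longrightarrow> \<bar>f r - f S\<bar> < - f S / 2"
      using near[of S "- f S / 2"] neg \<open>0 < m\<close> \<open>m \<le> S\<close> by auto
    define \<eta> where "\<eta> = min \<delta> (- f S / 2)"
    have \<eta>: "0 < \<eta>" "\<eta> \<le> \<delta>" "\<eta> \<le> - f S / 2"
      using \<delta> neg by (auto simp: \<eta>_def)
    have "has_laplacian (\<lambda>x. - u x) x (f (u x))" if "0 < x \<bullet> e" for x
      using has_laplacian_minus[OF u_laplacian[OF that]] by simp
    then obtain x where x: "1 \<le> x \<bullet> e" "\<bar>- u x - S'\<bar> < \<eta>" "- \<eta> \<le> f (u x)"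
      using laplacian_at_liminf[OF continuous_on_minus[OF continuous_u] e _ S' \<eta>(1), of "\<lambda>x. f (u x)" 1] by blast
    then have "\<bar>f (u x) - f S\<bar> < - f S / 2"
      using u_range[of x] \<eta> unfolding S_def by (intro \<delta>(2)[unfolded S_def]) auto
    with x \<eta> show False by (simp add: abs_less_iff)
  qed
  have lower: "\<exists>R. \<forall>x. R \<le> x \<bullet> e \<longrightarrow> S - \<theta> < u x" if \<theta>: "0 < \<theta>" for \<theta>
  proof (cases "S = \<mu>")
    case True
    then show ?thesis
      using m(1)[OF \<theta>] \<open>\<mu> \<le> m\<close> \<open>m \<le> S\<close> by simp
  next
    case False
    then have "\<mu> < S"
      using \<open>\<mu> \<le> m\<close> \<open>m \<le> S\<close> by simp
    then obtain c s' where cs': "c > 0" "s' > 0" "\<And>r. S - s' < r \<Longrightarrow> r < S \<Longrightarrow> f r \<le> c * (r - S)"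
      using f_linear_zero[of S] \<open>f S = 0\<close> by blast
    define s where "s = min s' (S - \<mu>)"
    define \<theta>' where "\<theta>' = min \<theta> (s / 2)"
    have s: "0 < s" "s \<le> s'" "s \<le> S - \<mu>"
      using cs' \<open>\<mu> < S\<close> by (auto simp: s_def)
    have \<theta>': "0 < \<theta>'" "\<theta>' < s" "\<theta>' \<le> \<theta>"
      using s \<theta> by (auto simp: \<theta>'_def)
    have fS: "f r \<le> c * (r - S)" if "S - s < r" "r < S" for r
      using cs'(3)[of r] that s by simp
    obtain R where R: "\<And>y. R \<le> y \<bullet> e \<Longrightarrow> \<theta>' \<le> S - u y \<Longrightarrow> s \<le> S - u y"
      using gap_below_zero_of_f[OF \<open>\<mu> < S\<close> upper cs'(1) fS s(3) \<theta>'(1,2)] by blast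
    define H where "H = {y. max R 1 \<le> y \<bullet> e}"
    have "connected ((\<lambda>y. S - u y) ` H)"
    proof (rule connected_continuous_image)
      show "continuous_on H (\<lambda>y. S - u y)"
        by (intro continuous_intros continuous_on_subset[OF continuous_u]) (auto simp: H_def)
      have "convex H"
        using convex_halfspace_ge[of "max R 1" e] by (simp add: H_def inner_commute)
      then show "connected H" by (rule convex_connected)
    qed
    note ivt = connectedD_interval[OF this]
    obtain x where x: "x \<in> H" "S - u x < \<theta>'"
      using freq[OF \<theta>'(1), of "max R 1"] by (auto simp: H_def)
    have "S - u y < \<theta>'" if y: "y \<in> H" for y
    proof (rule ccontr)
      assume "\<not> S - u y < \<theta>'"
      then have "\<theta>' \<in> (\<lambda>y. S - u y) ` H"
        using ivt[of "S - u x" "S - u y" \<theta>'] x y by auto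
      then obtain y' where "y' \<in> H" "\<theta>' = S - u y'" by auto
      with R[of y'] \<theta>' show False by (simp add: H_def)
    qed
    then have "S - \<theta> < u y" if "max R 1 \<le> y \<bullet> e" for y
      using that \<theta>' unfolding H_def by force
    then show ?thesis by blast
  qed
  have "\<exists>R. \<forall>x. R \<le> x \<bullet> e \<longrightarrow> \<bar>u x - S\<bar> < \<eta>" if \<eta>: "0 < \<eta>" for \<eta>
  proof -
    obtain R1 R2 where "\<And>x. R1 \<le> x \<bullet> e \<Longrightarrow> u x < S + \<eta>" "\<And>x. R2 \<le> x \<bullet> e \<Longrightarrow> S - \<eta> < u x"
      using upper[OF \<eta>] lower[OF \<eta>] by blast
    then have "\<bar>u x - S\<bar> < \<eta>" if "max R1 R2 \<le> x \<bullet> e" for x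
      using that by (fastforce simp: abs_less_iff)
    then show ?thesis by blast
  qed
  then show ?thesis
    using \<open>f S = 0\<close> \<open>\<mu> \<le> m\<close> \<open>m \<le> S\<close> by (intro exI[of _ S]) auto
qed

end

section \<open>Convergence in Hoelder norms\<close>

lemma schauder_estimate:
  fixes e :: "'a::euclidean_space"
  assumes "0 < L" and \<beta>: "0 \<le> \<beta>" "\<beta> < 1"
  obtains B where "1 \<le> B"
    and "\<And>u z c \<epsilon> i x. half_space_poisson e u z c \<epsilon> L \<Longrightarrow> i \<in> Basis \<Longrightarrow> c + 4 \<le> x \<bullet> e \<Longrightarrow>
      \<bar>partial_deriv i u x\<bar> \<le> B * \<epsilon>"
    and "\<And>u z c \<epsilon> i j x. half_space_poisson e u z c \<epsilon> L \<Longrightarrow> i \<in> Basis \<Longrightarrow> j \<in> Basis \<Longrightarrow>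
      c + 4 \<le> x \<bullet> e \<Longrightarrow> \<bar>partial_deriv j (partial_deriv i u) x\<bar> \<le> B * \<epsilon>"
    and "\<And>u z c \<epsilon> i j x y. half_space_poisson e u z c \<epsilon> L \<Longrightarrow> i \<in> Basis \<Longrightarrow> j \<in> Basis \<Longrightarrow>
      c + 4 \<le> x \<bullet> e \<Longrightarrow> c + 4 \<le> y \<bullet> e \<Longrightarrow> dist x y \<le> 2 \<Longrightarrow>
      \<bar>partial_deriv j (partial_deriv i u) x - partial_deriv j (partial_deriv i u) y\<bar>
        \<le> B * \<epsilon> * dist x y powr \<beta>"
proof -
  define N where "N = real DIM('a)"
  define C where "C = N + L"
  define H where "H = C\<^sup>2 * (4 * (N + 1) * (4 powr (1 - \<beta>) / (1 - \<beta>)) + 2)"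
  define B where "B = 1 + C + C\<^sup>2 + N * (N * H + 2 * L * C)"
  have "0 \<le> N" by (simp add: N_def)
  then have C: "0 \<le> C" and H: "0 \<le> H"
    using \<open>0 < L\<close> \<beta> by (auto simp: C_def H_def)
  have "0 \<le> N * (N * H + 2 * L * C)"
    using \<open>0 \<le> N\<close> C H \<open>0 < L\<close> by simp
  then have B: "1 \<le> B" "C \<le> B" "C\<^sup>2 \<le> B" "N * (N * H + 2 * L * C) \<le> B"
    using C zero_le_power2[of C] unfolding B_def by linarith+
  show thesis
  proof (rule that[OF B(1)])
    fix u :: "'a \<Rightarrow> real" and z c \<epsilon> and x y i j :: 'a
    assume "half_space_poisson e u z c \<epsilon> L"
    then interpret P: half_space_poisson e u z c \<epsilon> L .
    have PC: "P.C = C" and PH: "P.H \<beta> = H"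
      by (simp_all add: P.C_def P.H_def C_def H_def N_def)
    assume i: "i \<in> Basis" and x: "c + 4 \<le> x \<bullet> e"
    have "\<bar>partial_deriv i u x\<bar> \<le> C * \<epsilon>"
      using P.D_bound[OF i, of x] x by (simp add: PC)
    also have "\<dots> \<le> B * \<epsilon>"
      using B P.pos by (intro mult_right_mono) auto
    finally show "\<bar>partial_deriv i u x\<bar> \<le> B * \<epsilon>" .
    assume j: "j \<in> Basis"
    have "\<bar>partial_deriv j (partial_deriv i u) x\<bar> \<le> C\<^sup>2 * \<epsilon>"
      using P.DD_bound[OF j i, of x] x by (simp add: PC)
    also have "\<dots> \<le> B * \<epsilon>"
      using B P.pos by (intro mult_right_mono) auto
    finally show "\<bar>partial_deriv j (partial_deriv i u) x\<bar> \<le> B * \<epsilon>" .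
    assume y: "c + 4 \<le> y \<bullet> e" and d: "dist x y \<le> 2"
    have "\<bar>partial_deriv j (partial_deriv i u) x - partial_deriv j (partial_deriv i u) y\<bar>
        \<le> N * (N * H + 2 * L * C) * \<epsilon> * dist x y powr \<beta>"
      using P.DD_holder[OF j i y x _ \<beta>] d by (simp add: PC PH N_def dist_commute)
    also have "\<dots> \<le> B * \<epsilon> * dist x y powr \<beta>"
      using B P.pos by (intro mult_right_mono) auto
    finally show "\<bar>partial_deriv j (partial_deriv i u) x - partial_deriv j (partial_deriv i u) y\<bar>
        \<le> B * \<epsilon> * dist x y powr \<beta>" .
  qed
qed

lemma has_derivative_shift_iff:
  fixes w :: "'a::euclidean_space \<Rightarrow> real"
  shows "((\<lambda>x. w (x + a) - k) has_derivative D) (at x) \<longleftrightarrow> (w has_derivative D) (at (x + a))"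
proof -
  have *: "((\<lambda>x. w (x + a) - k) has_derivative D) (at x)"
    if "(w has_derivative D) (at (x + a))" for w :: "'a \<Rightarrow> real" and a k x
  proof -
    have "((\<lambda>x. w (x + a)) has_derivative (\<lambda>y. D y)) (at x)"
      by (rule has_derivative_compose[of "\<lambda>x. x + a" "\<lambda>x. x" x UNIV w])
        (use that in \<open>auto intro!: derivative_eq_intros\<close>)
    then show ?thesis
      by (auto intro!: derivative_eq_intros)
  qed
  show ?thesis
  proof
    assume "((\<lambda>x. w (x + a) - k) has_derivative D) (at x)"
    then show "(w has_derivative D) (at (x + a))"
      using *[of "\<lambda>x. w (x + a) - k" "x + a" "- a" "- k"] by simp
  qed (rule *)
qed

lemma partial_deriv_shift:
  "partial_deriv i (\<lambda>x. w (x + a) - k) = (\<lambda>x. partial_deriv i w (x + a))"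
  by (rule ext) (simp add: partial_deriv_def frechet_derivative_def has_derivative_shift_iff)

lemma partial_deriv_shift0:
  "partial_deriv i (\<lambda>x. w (x + a)) = (\<lambda>x. partial_deriv i w (x + a))"
  using partial_deriv_shift[of i w a 0] by simp

lemma differentiable_on_shift:
  fixes w :: "'a::euclidean_space \<Rightarrow> real"
  assumes "w differentiable_on S" "open S" "\<And>x. x \<in> T \<Longrightarrow> x + a \<in> S"
  shows "(\<lambda>x. w (x + a)) differentiable_on T"
  unfolding differentiable_on_def
proof
  fix x assume "x \<in> T"
  then have "w differentiable at (x + a)"
    using assms by (meson differentiable_on_eq_differentiable_at)
  then have "(\<lambda>x. w (x + a)) differentiable at x"
    using has_derivative_shift_iff[of w a 0] by (auto simp: differentiable_def)
  then show "(\<lambda>x. w (x + a)) differentiable at x within T"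
    by (rule differentiable_at_withinI)
qed

lemma C2_on_shift:
  assumes "C2_on S w" "open S" "\<And>x. x \<in> T \<Longrightarrow> x + a \<in> S"
  shows "C2_on T (\<lambda>x. w (x + a))"
  using assms unfolding C2_on_def partial_deriv_shift0
  by (auto intro!: differentiable_on_shift[of _ S] continuous_on_compose2[of S _ T "\<lambda>x. x + a"] continuous_intros)

lemma C2_on_imp_C2_closed:
  assumes "C2_on S w" "K \<subseteq> S"
  shows "C2_closed K w"
proof -
  have "interior K \<subseteq> S"
    using assms(2) interior_subset by blast
  then have "C2_on (interior K) w"
    using assms(1) unfolding C2_on_def
    by (meson continuous_on_subset differentiable_on_subset)
  moreover have "continuous_on K w" "\<And>i. i \<in> Basis \<Longrightarrow> continuous_on K (partial_deriv i w)"
      "\<And>i j. i \<in> Basis \<Longrightarrow> j \<in> Basis \<Longrightarrow> continuous_on K (partial_deriv j (partial_deriv i w))"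
    using assms unfolding C2_on_def
    by (meson continuous_on_subset differentiable_imp_continuous_on)+
  ultimately show ?thesis
    unfolding C2_closed_def extends_continuously_def by blast
qed

lemma partial_deriv_const: "partial_deriv i (\<lambda>x. k) = (\<lambda>x. 0)"
  by (rule ext) (simp add: partial_deriv_def)

lemma C2_on_const: "C2_on S (\<lambda>x. k)"
  by (simp add: C2_on_def partial_deriv_const)

lemma sum_Basis_ennreal_le:
  assumes "\<And>i. i \<in> (Basis :: 'a::euclidean_space set) \<Longrightarrow> g i \<le> ennreal b" "0 \<le> b"
  shows "(\<Sum>i\<in>(Basis :: 'a set). g i) \<le> ennreal (real DIM('a) * b)"
proof -
  have "(\<Sum>i\<in>(Basis :: 'a set). g i) \<le> (\<Sum>i\<in>(Basis :: 'a set). ennreal b)"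
    using assms(1) by (rule sum_mono)
  also have "\<dots> = ennreal (real DIM('a) * b)"
    using assms(2) by (simp add: ennreal_mult ennreal_of_nat_eq_real_of_nat)
  finally show ?thesis .
qed

lemma C2_holder_norm_le:
  fixes w :: "'a::euclidean_space \<Rightarrow> real"
  assumes b: "0 \<le> b" and w: "\<And>x. x \<in> K \<Longrightarrow> \<bar>w x\<bar> \<le> b"
    and D: "\<And>i x. i \<in> Basis \<Longrightarrow> x \<in> interior K \<Longrightarrow> \<bar>partial_deriv i w x\<bar> \<le> b"
    and DD: "\<And>i j x. i \<in> Basis \<Longrightarrow> j \<in> Basis \<Longrightarrow> x \<in> interior K \<Longrightarrow>
      \<bar>partial_deriv j (partial_deriv i w) x\<bar> \<le> b"
    and H: "\<And>i j x y. i \<in> Basis \<Longrightarrow> j \<in> Basis \<Longrightarrow> x \<in> interior K \<Longrightarrow> y \<in> interior K \<Longrightarrow>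
      \<bar>partial_deriv j (partial_deriv i w) x - partial_deriv j (partial_deriv i w) y\<bar>
        \<le> b * dist x y powr \<beta>"
  shows "C2_holder_norm \<beta> K w \<le> ennreal ((1 + real DIM('a) + 2 * (real DIM('a))\<^sup>2) * b)"
proof -
  let ?N = "real DIM('a)"
  have "sup_norm K w \<le> ennreal b"
    unfolding sup_norm_def by (intro SUP_least ennreal_leI w)
  moreover have "(\<Sum>i\<in>Basis. sup_norm (interior K) (partial_deriv i w)) \<le> ennreal (?N * b)"
    unfolding sup_norm_def by (intro sum_Basis_ennreal_le SUP_least ennreal_leI D b)
  moreover have "(\<Sum>i\<in>Basis. \<Sum>j\<in>Basis. sup_norm (interior K) (partial_deriv j (partial_deriv i w)))
      \<le> ennreal (?N * (?N * b))"
    unfolding sup_norm_def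
    by (intro sum_Basis_ennreal_le SUP_least ennreal_leI DD mult_nonneg_nonneg b) auto
  moreover have "(\<Sum>i\<in>Basis. \<Sum>j\<in>Basis. holder_seminorm \<beta> (interior K) (partial_deriv j (partial_deriv i w)))
      \<le> ennreal (?N * (?N * b))"
    unfolding holder_seminorm_def
  proof (intro sum_Basis_ennreal_le SUP_least ennreal_leI mult_nonneg_nonneg b)
    fix i j x y :: 'a assume *: "i \<in> Basis" "j \<in> Basis" "x \<in> interior K" "y \<in> interior K"
    show "\<bar>partial_deriv j (partial_deriv i w) x - partial_deriv j (partial_deriv i w) y\<bar>
        / dist x y powr \<beta> \<le> b"
    proof (cases "x = y")
      case False
      then show ?thesis using H[OF *] by (simp add: divide_le_eq)
    qed (use b in simp)
  qed auto
  ultimately have "C2_holder_norm \<beta> K w \<le> ennreal b + ennreal (?N * b) + ennreal (?N * (?N * b)) + ennreal (?N * (?N * b))"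
    unfolding C2_holder_norm_def by (intro add_mono) auto
  also have "\<dots> = ennreal ((1 + ?N + 2 * ?N\<^sup>2) * b)"
    using b by (simp add: ennreal_plus[symmetric] algebra_simps power2_eq_square del: ennreal_plus)
  finally show ?thesis .
qed

lemma C2b_norm_le:
  fixes w :: "'a::euclidean_space \<Rightarrow> real"
  assumes b: "0 \<le> b" and w: "\<And>x. x \<in> F \<Longrightarrow> \<bar>w x\<bar> \<le> b"
    and D: "\<And>i x. i \<in> Basis \<Longrightarrow> x \<in> F \<Longrightarrow> \<bar>partial_deriv i w x\<bar> \<le> b"
    and DD: "\<And>i j x. i \<in> Basis \<Longrightarrow> j \<in> Basis \<Longrightarrow> x \<in> F \<Longrightarrow>
      \<bar>partial_deriv j (partial_deriv i w) x\<bar> \<le> b"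
    and H: "\<And>i j x y. i \<in> Basis \<Longrightarrow> j \<in> Basis \<Longrightarrow> x \<in> F \<Longrightarrow> y \<in> F \<Longrightarrow> dist x y \<le> 2 \<Longrightarrow>
      \<bar>partial_deriv j (partial_deriv i w) x - partial_deriv j (partial_deriv i w) y\<bar>
        \<le> b * dist x y powr \<beta>"
  shows "C2b_norm \<beta> F w \<le> ennreal ((1 + real DIM('a) + 2 * (real DIM('a))\<^sup>2) * b)"
  unfolding C2b_norm_def
proof (rule SUP_least)
  fix a assume "a \<in> F"
  have sub: "interior (cball a 1 \<inter> F) \<subseteq> cball a 1 \<inter> F"
    by (rule interior_subset)
  have "dist x y \<le> 2" if "x \<in> interior (cball a 1 \<inter> F)" "y \<in> interior (cball a 1 \<inter> F)" for x y
    using sub that dist_triangle2[of x y a] by (auto simp: subset_iff dist_commute)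
  then show "C2_holder_norm \<beta> (cball a 1 \<inter> F) w
      \<le> ennreal ((1 + real DIM('a) + 2 * (real DIM('a))\<^sup>2) * b)"
    using sub by (intro C2_holder_norm_le b w D DD H) auto
qed

lemmas C2b_norm_shift_le =
  C2b_norm_le[of b F "\<lambda>x. w (x + a) - k" for b F w a k,
    unfolded partial_deriv_shift partial_deriv_shift0]

lemma const_mem_C2b:
  fixes F :: "'a::euclidean_space set"
  shows "(\<lambda>x. k) \<in> C2b \<beta> F"
proof -
  have "C2b_norm \<beta> F (\<lambda>x. k) \<le> ennreal ((1 + real DIM('a) + 2 * (real DIM('a))\<^sup>2) * \<bar>k\<bar>)"
    by (rule C2b_norm_le) (auto simp: partial_deriv_const)
  then have "C2b_norm \<beta> F (\<lambda>x. k) < \<infinity>"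
    by (rule order.strict_trans1) simp
  then show ?thesis
    by (auto simp: C2b_def intro: C2_on_imp_C2_closed[OF C2_on_const[of UNIV]])
qed

lemma tendsto_0_ennrealI:
  fixes g :: "'b \<Rightarrow> ennreal"
  assumes "\<And>\<epsilon>. 0 < \<epsilon> \<Longrightarrow> \<forall>\<^sub>F x in F. g x \<le> ennreal (B * \<epsilon>)" and B: "0 < B"
  shows "(g \<longlongrightarrow> 0) F"
proof (rule order_tendstoI)
  fix a :: ennreal assume "0 < a"
  then obtain y where y: "0 < y" "y < a"
    using dense by blast
  obtain r where r: "0 \<le> r" "y = ennreal r"
    by (cases y) (use y in auto)
  then have "0 < r"
    using y by simp
  then have "\<forall>\<^sub>F x in F. g x \<le> ennreal (B * (r / B))"
    using B by (intro assms) simp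
  then show "\<forall>\<^sub>F x in F. g x < a"
    by eventually_elim (use r y B in auto)
qed simp

lemma (in half_space_semilinear) converges_in_C2b:
  assumes z: "f z = 0" "0 \<le> z" and lim: "\<And>\<eta>. 0 < \<eta> \<Longrightarrow> \<exists>R. \<forall>x. R \<le> x \<bullet> e \<longrightarrow> \<bar>u x - z\<bar> < \<eta>"
    and \<beta>: "0 \<le> \<beta>" "\<beta> < 1" and F: "\<And>x. x \<in> F \<Longrightarrow> A \<le> x \<bullet> e"
  shows "converges_in_C2b \<beta> F (\<lambda>h x. u (x + h *\<^sub>R e)) (\<lambda>x. z) at_top"
proof -
  obtain B where B: "1 \<le> B"
    and BD: "\<And>u z c \<epsilon> i x. half_space_poisson e u z c \<epsilon> L \<Longrightarrow> i \<in> Basis \<Longrightarrow> c + 4 \<le> x \<bullet> e \<Longrightarrow>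
      \<bar>partial_deriv i u x\<bar> \<le> B * \<epsilon>"
    and BDD: "\<And>u z c \<epsilon> i j x. half_space_poisson e u z c \<epsilon> L \<Longrightarrow> i \<in> Basis \<Longrightarrow> j \<in> Basis \<Longrightarrow>
      c + 4 \<le> x \<bullet> e \<Longrightarrow> \<bar>partial_deriv j (partial_deriv i u) x\<bar> \<le> B * \<epsilon>"
    and BH: "\<And>u z c \<epsilon> i j x y. half_space_poisson e u z c \<epsilon> L \<Longrightarrow> i \<in> Basis \<Longrightarrow> j \<in> Basis \<Longrightarrow>
      c + 4 \<le> x \<bullet> e \<Longrightarrow> c + 4 \<le> y \<bullet> e \<Longrightarrow> dist x y \<le> 2 \<Longrightarrow>
      \<bar>partial_deriv j (partial_deriv i u) x - partial_deriv j (partial_deriv i u) y\<bar>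
        \<le> B * \<epsilon> * dist x y powr \<beta>"
    using schauder_estimate[OF L \<beta>, of e] by blast
  have "z \<le> K"
  proof (rule ccontr)
    assume "\<not> z \<le> K"
    then obtain R where R: "\<And>x. R \<le> x \<bullet> e \<Longrightarrow> \<bar>u x - z\<bar> < z - K"
      using lim[of "z - K"] by auto
    define x where "x = max R 1 *\<^sub>R e"
    have "x \<bullet> e = max R 1"
      using e by (simp add: x_def)
    then have "R \<le> x \<bullet> e" "0 < x \<bullet> e"
      by (auto simp: less_max_iff_disj)
    with R[of x] u_range[of x] show False by (auto simp: abs_less_iff)
  qed
  have poisson: "\<exists>c. half_space_poisson e u z c \<epsilon> L" if \<epsilon>: "0 < \<epsilon>" for \<epsilon>
  proof -
    obtain R where R: "\<And>x. R \<le> x \<bullet> e \<Longrightarrow> \<bar>u x - z\<bar> < \<epsilon>"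
      using lim[OF \<epsilon>] by blast
    have "half_space_poisson e u z (max R 1) \<epsilon> L"
    proof
      fix x assume x: "max R 1 \<le> x \<bullet> e"
      then show *: "\<bar>u x - z\<bar> \<le> \<epsilon>"
        using R[of x] by simp
      have "\<bar>f (u x) - f z\<bar> \<le> L * \<bar>u x - z\<bar>"
        using u_range[of x] x z \<open>z \<le> K\<close> by (intro f_lipschitz) auto
      also have "\<dots> \<le> L * \<epsilon>"
        using * L by (intro mult_left_mono) auto
      finally show "\<bar>laplacian u x\<bar> \<le> L * \<epsilon>"
        using eq[of x] x z by simp
    next
      fix x y assume "max R 1 \<le> x \<bullet> e" "max R 1 \<le> y \<bullet> e"
      then show "\<bar>laplacian u x - laplacian u y\<bar> \<le> L * \<bar>u x - u y\<bar>"
        using f_lipschitz[of "u x" "u y"] u_range[of x] u_range[of y] eq[of x] eq[of y]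
        by (simp add: abs_minus_commute)
    qed (use e C2 L \<epsilon> in auto)
    then show ?thesis by blast
  qed
  have shift: "c \<le> (x + h *\<^sub>R e) \<bullet> e" if "c - A \<le> h" "x \<in> F" for c h x
    using F[OF that(2)] that(1) e by (simp add: inner_add_left)
  define N where "N = 1 + real DIM('a) + 2 * (real DIM('a))\<^sup>2"
  have N: "0 < N"
    unfolding N_def by (intro add_pos_nonneg) auto
  have close: "\<forall>\<^sub>F h in at_top. C2b_norm \<beta> F (\<lambda>x. u (x + h *\<^sub>R e) - z) \<le> ennreal ((N * B) * \<epsilon>)"
    if \<epsilon>: "0 < \<epsilon>" for \<epsilon>
  proof -
    obtain c where P: "half_space_poisson e u z c \<epsilon> L"
      using poisson[OF \<epsilon>] by blast
    interpret P: half_space_poisson e u z c \<epsilon> L by (rule P)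
    show ?thesis
      using eventually_ge_at_top[of "c + 4 - A"]
    proof eventually_elim
      case (elim h)
      note sh = shift[OF elim]
      have "\<bar>u (x + h *\<^sub>R e) - z\<bar> \<le> B * \<epsilon>" if "x \<in> F" for x
      proof -
        have "\<bar>u (x + h *\<^sub>R e) - z\<bar> \<le> 1 * \<epsilon>"
          using P.u_near[of "x + h *\<^sub>R e"] sh[OF that] by simp
        also have "\<dots> \<le> B * \<epsilon>"
          using B \<epsilon> by (intro mult_right_mono) auto
        finally show ?thesis .
      qed
      moreover have "\<bar>partial_deriv j (partial_deriv i u) (x + h *\<^sub>R e) - partial_deriv j (partial_deriv i u) (y + h *\<^sub>R e)\<bar>
          \<le> B * \<epsilon> * dist x y powr \<beta>"
        if "i \<in> Basis" "j \<in> Basis" "x \<in> F" "y \<in> F" "dist x y \<le> 2" for i j x y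
        using BH[OF P that(1,2) sh[OF that(3)] sh[OF that(4)]] that(5) by simp
      ultimately have "C2b_norm \<beta> F (\<lambda>x. u (x + h *\<^sub>R e) - z) \<le> ennreal (N * (B * \<epsilon>))"
        unfolding N_def using B \<epsilon>
        by (intro C2b_norm_shift_le) (auto intro: BD[OF P _ sh] BDD[OF P _ _ sh])
      then show ?case by (simp add: mult.assoc)
    qed
  qed
  have "\<forall>\<^sub>F h in at_top. (\<lambda>x. u (x + h *\<^sub>R e)) \<in> C2b \<beta> F"
  proof -
    obtain c where P: "half_space_poisson e u z c 1 L"
      using poisson[of 1] by auto
    interpret P: half_space_poisson e u z c 1 L by (rule P)
    show ?thesis
      using eventually_ge_at_top[of "c + 4 - A"]
    proof eventually_elim
      case (elim h)
      note sh = shift[OF elim]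
      have 0: "0 \<le> B + z"
        using B z by simp
      have 1: "\<bar>u (x + h *\<^sub>R e) - 0\<bar> \<le> B + z" if "x \<in> F" for x
        using P.u_near[of "x + h *\<^sub>R e"] sh[OF that] B z by simp
      have 2: "\<bar>partial_deriv i u (x + h *\<^sub>R e)\<bar> \<le> B + z"
        if "i \<in> Basis" "x \<in> F" for i x
        using BD[OF P that(1) sh[OF that(2)]] z by simp
      have 3: "\<bar>partial_deriv j (partial_deriv i u) (x + h *\<^sub>R e)\<bar> \<le> B + z"
        if "i \<in> Basis" "j \<in> Basis" "x \<in> F" for i j x
        using BDD[OF P that(1,2) sh[OF that(3)]] z by simp
      have 4: "\<bar>partial_deriv j (partial_deriv i u) (x + h *\<^sub>R e) - partial_deriv j (partial_deriv i u) (y + h *\<^sub>R e)\<bar>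
          \<le> (B + z) * dist x y powr \<beta>"
        if "i \<in> Basis" "j \<in> Basis" "x \<in> F" "y \<in> F" "dist x y \<le> 2" for i j x y
      proof -
        have "B * dist x y powr \<beta> \<le> (B + z) * dist x y powr \<beta>"
          using z by (intro mult_right_mono) auto
        then show ?thesis
          using BH[OF P that(1,2) sh[OF that(3)] sh[OF that(4)]] that(5) by simp
      qed
      have "C2b_norm \<beta> F (\<lambda>x. u (x + h *\<^sub>R e) - 0) \<le> ennreal (N * (B + z))"
        unfolding N_def by (rule C2b_norm_shift_le[OF 0 1 2 3 4])
      then have "C2b_norm \<beta> F (\<lambda>x. u (x + h *\<^sub>R e)) < \<infinity>"
        unfolding diff_0_right infinity_ennreal_def by (rule order.strict_trans1[OF _ ennreal_less_top])
      moreover have "C2_closed (cball x 1 \<inter> F) (\<lambda>x. u (x + h *\<^sub>R e))" for x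
      proof (rule C2_on_imp_C2_closed)
        show "C2_on F (\<lambda>x. u (x + h *\<^sub>R e))"
          by (rule C2_on_shift[OF C2 open_halfspace_component_gt]) (use sh P.pos in force)
      qed simp
      ultimately show ?case
        by (simp add: C2b_def)
    qed
  qed
  moreover have "((\<lambda>h. C2b_norm \<beta> F (\<lambda>x. u (x + h *\<^sub>R e) - z)) \<longlongrightarrow> 0) at_top"
    by (rule tendsto_0_ennrealI[OF close]) (use N B in auto)
  ultimately show ?thesis
    by (simp add: converges_in_C2b_def const_mem_C2b)
qed

lemma linear_lower_bound_at_0:
  fixes f :: "real \<Rightarrow> real"
  assumes cont: "continuous_on {0..} f"
    and f0: "f 0 > 0 \<or> (f 0 = 0 \<and> Liminf (at_right 0) (\<lambda>s. ereal (f s / s)) > 0)"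
  shows "\<exists>c>0. \<exists>s>0. \<forall>r. 0 \<le> r \<and> r < s \<longrightarrow> c * r \<le> f r"
  using f0
proof
  assume pos: "f 0 > 0"
  then obtain d where d: "0 < d" "\<And>r. 0 \<le> r \<Longrightarrow> \<bar>r\<bar> < d \<Longrightarrow> \<bar>f r - f 0\<bar> < f 0 / 2"
    using cont unfolding continuous_on_iff dist_real_def
    by (metis atLeast_iff diff_zero half_gt_zero order_refl)
  have "f 0 / 2 * r \<le> f r" if "0 \<le> r \<and> r < min d 1" for r
  proof -
    have "f 0 / 2 * r \<le> f 0 / 2 * 1"
      using pos that by (intro mult_left_mono) auto
    also have "\<dots> \<le> f r"
      using d(2)[of r] that abs_ge_minus_self[of "f r - f 0"] by simp
    finally show ?thesis .
  qed
  then show ?thesis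
    using pos d(1) by (intro exI[of _ "f 0 / 2"] conjI exI[of _ "min d 1"]) auto
next
  assume *: "f 0 = 0 \<and> Liminf (at_right 0) (\<lambda>s. ereal (f s / s)) > 0"
  then obtain c where c: "0 < ereal c" "ereal c < Liminf (at_right 0) (\<lambda>s. ereal (f s / s))"
    using ereal_dense2 by blast
  from less_LiminfD[OF c(2)] obtain s where s: "0 < s" "\<And>r. 0 < r \<Longrightarrow> r < s \<Longrightarrow> c < f r / r"
    unfolding eventually_at_right_field by auto
  have "c * r \<le> f r" if "0 \<le> r \<and> r < s" for r
  proof (cases "r = 0")
    case False
    then show ?thesis
      using s(2)[of r] that by (simp add: less_divide_eq)
  qed (use * in simp)
  then show ?thesis
    using c(1) s(1) by auto
qed

lemma linear_upper_bound_below_zero: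
  fixes f :: "real \<Rightarrow> real"
  assumes "Liminf (at_left z) (\<lambda>s. ereal (f s / (s - z))) > 0"
  shows "\<exists>c>0. \<exists>s>0. \<forall>r. z - s < r \<and> r < z \<longrightarrow> f r \<le> c * (r - z)"
proof -
  obtain c where c: "0 < ereal c" "ereal c < Liminf (at_left z) (\<lambda>s. ereal (f s / (s - z)))"
    using assms ereal_dense2 by blast
  from less_LiminfD[OF c(2)] obtain b where b: "b < z" "\<And>r. b < r \<Longrightarrow> r < z \<Longrightarrow> c < f r / (r - z)"
    unfolding eventually_at_left_field by auto
  have "f r \<le> c * (r - z)" if "z - (z - b) < r \<and> r < z" for r
    using b(2)[of r] that by (simp add: less_divide_eq)
  moreover have "0 < z - b"
    using b(1) by simp
  ultimately show ?thesis
    using c(1) by (metis ereal_less(2))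
qed

lemma closure_half_space: "closure (half_space :: (real \<times> (real^'m)) set) = {0..} \<times> UNIV"
  by (simp add: half_space_def closure_Times)

theorem theorem1p4:
  fixes f :: "real \<Rightarrow> real"
    and \<mu> \<mu>' :: real
    and u\<^sub>0 :: "real^'m \<Rightarrow> real"
    and u :: "real \<times> (real^'m) \<Rightarrow> real"
  assumes f_lip: "local_lipschitz (UNIV :: real set) {0..} (\<lambda>_. f)"
    and mu_pos: "\<mu> > 0"
    and f_pos: "\<forall>s\<in>{0<..<\<mu>}. f s > 0"
    and f_nonpos: "\<forall>s\<in>{\<mu>..}. f s \<le> 0"
    and mu': "\<mu>' \<in> {0<..<\<mu>}"
    and f_antimono: "antimono_on {\<mu>'..\<mu>} f"
    and f_zero: "f 0 > 0 \<or> (f 0 = 0 \<and> Liminf (at_right 0) (\<lambda>s. ereal (f s / s)) > 0)"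
    and f_zeros: "\<forall>z>\<mu>. f z = 0 \<longrightarrow> Liminf (at_left z) (\<lambda>s. ereal (f s / (s - z))) > 0"
    and u0_cont: "continuous_on UNIV u\<^sub>0"
    and u0_bounded: "bounded (range u\<^sub>0)"
    and u0_nonneg: "\<forall>y. u\<^sub>0 y \<ge> 0"
    and u0_nonzero: "\<exists>y. u\<^sub>0 y \<noteq> 0"
    and u_sol: "bounded_solution f half_space u"
    and u_nonneg: "\<forall>x\<in>closure half_space. u x \<ge> 0"
    and u_bdry: "\<forall>y. u (0, y) = u\<^sub>0 y"
  shows "\<exists>z\<ge>\<mu>. f z = 0 \<and>
    (\<forall>A. \<forall>\<beta>\<in>{0..<1}.
       converges_in_C2b \<beta> ({A..} \<times> UNIV)
         (\<lambda>h (x\<^sub>1, y). u (x\<^sub>1 + h, y)) (\<lambda>_. z) at_top)"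
proof -
  define e :: "real \<times> (real^'m)" where "e = (1, 0)"
  have e: "e \<in> Basis"
    by (simp add: e_def Basis_prod_def)
  have inner_e: "x \<bullet> e = fst x" for x
    by (simp add: e_def inner_prod_def)
  have half: "half_space = {x. 0 < x \<bullet> e}"
    by (auto simp: half_space_def inner_e)
  note sol = u_sol[unfolded bounded_solution_def]
  obtain K where K: "\<And>x. x \<in> closure half_space \<Longrightarrow> \<bar>u x\<bar> \<le> K"
    using sol by (auto simp: bounded_iff)
  have f_cont: "continuous_on {0..} f"
    using local_lipschitz_continuous_on[OF f_lip] by blast
  have "local_lipschitz {0::real} {0..K} (\<lambda>_. f)"
    by (rule local_lipschitz_subset[OF f_lip]) auto
  then obtain L where L: "\<And>t. t \<in> {0::real} \<Longrightarrow> L-lipschitz_on {0..K} f"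
    using local_lipschitz_compact_implies_lipschitz[of "{0::real}" "{0..K}" "\<lambda>_. f"] by auto
  then have L: "L-lipschitz_on {0..K} f" by simp
  have lip: "\<bar>f s - f t\<bar> \<le> (L + 1) * \<bar>s - t\<bar>" if "0 \<le> s" "s \<le> K" "0 \<le> t" "t \<le> K" for s t
    using lipschitz_onD[OF L, of s t] that by (simp add: dist_real_def algebra_simps)
  have "0 \<le> L"
    using L by (rule lipschitz_on_nonneg)
  have u_range: "0 \<le> u x \<and> u x \<le> K" if "0 < x \<bullet> e" for x
  proof -
    have "x \<in> closure half_space"
      using that closure_subset half by blast
    then show ?thesis
      using K[of x] u_nonneg by auto
  qed
  have "\<exists>x. 0 < x \<bullet> e \<and> 0 < u x"
  proof -
    obtain y where "u\<^sub>0 y \<noteq> 0"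
      using u0_nonzero by blast
    then have pos: "0 < u (0, y)"
      using u_bdry u0_nonneg by (simp add: order_less_le)
    have "continuous_on ({0..} \<times> UNIV) u"
      using sol by (simp add: closure_half_space)
    then obtain d where d: "0 < d"
        "\<And>x. x \<in> {0..} \<times> UNIV \<Longrightarrow> dist x (0, y) < d \<Longrightarrow> dist (u x) (u (0, y)) < u (0, y)"
      using pos unfolding continuous_on_iff by (metis SigmaI UNIV_I atLeast_iff order_refl)
    have "dist (u (d / 2, y)) (u (0, y)) < u (0, y)"
      using d(1) by (intro d(2)) (auto simp: dist_prod_def)
    then have "0 < u (d / 2, y)"
      by (auto simp: dist_real_def abs_less_iff)
    then show ?thesis
      using d(1) by (intro exI[of _ "(d / 2, y)"]) (simp add: inner_e)
  qed
  then interpret half_space_semilinear e u f \<mu> K "L + 1"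
  proof unfold_locales
    show "laplacian u x = - f (u x)" if "0 < x \<bullet> e" for x
    proof -
      have "x \<in> half_space"
        using that unfolding half by blast
      then have "laplacian u x + f (u x) = 0"
        using sol by blast
      then show ?thesis by simp
    qed
    show "C2_on {x. 0 < x \<bullet> e} u"
      using sol half by simp
    show "\<exists>c>0. \<exists>s>0. \<forall>r. 0 \<le> r \<and> r < s \<longrightarrow> c * r \<le> f r"
      by (rule linear_lower_bound_at_0[OF f_cont f_zero])
    show "\<exists>c>0. \<exists>s>0. \<forall>r. z - s < r \<and> r < z \<longrightarrow> f r \<le> c * (r - z)"
      if "\<mu> < z" "f z = 0" for z
      using linear_upper_bound_below_zero f_zeros that by blast
  qed (use e u_range mu_pos f_pos f_nonpos \<open>0 \<le> L\<close> lip f_cont in auto)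
  obtain z where z: "\<mu> \<le> z" "f z = 0"
      and lim: "\<And>\<eta>. 0 < \<eta> \<Longrightarrow> \<exists>R. \<forall>x. R \<le> x \<bullet> e \<longrightarrow> \<bar>u x - z\<bar> < \<eta>"
    using uniform_convergence by blast
  have shift: "(\<lambda>h (x\<^sub>1, y). u (x\<^sub>1 + h, y)) = (\<lambda>h x. u (x + h *\<^sub>R e))"
    by (auto simp: fun_eq_iff e_def)
  have "converges_in_C2b \<beta> ({A..} \<times> UNIV) (\<lambda>h (x\<^sub>1, y). u (x\<^sub>1 + h, y)) (\<lambda>_. z) at_top"
    if "\<beta> \<in> {0..<1}" for A \<beta>
    unfolding shift
    by (rule converges_in_C2b[OF z(2) _ lim, of _ _ A]) (use z(1) mu_pos that in \<open>auto simp: inner_e\<close>)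
  then show ?thesis
    using z by blast
qed

end
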